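(* Let $X\in\mathfrak{sl}_n(\mathbb R)$ be a nilpotent element, $X\neq 0$, whose orbit $\mathcal O_X$ has associated partition $\mathbf d=[d_1^{t_{d_1}},\dots,d_s^{t_{d_s}}]$ of $n$. Let $\{X,H,Y\}$ be an $\mathfrak{sl}_2(\mathbb R)$-triple in $\mathfrak{sl}_n(\mathbb R)$. Let $K$ be a maximal compact subgroup of $\mathcal Z_{\mathrm{SL}_n(\mathbb R)}(X,H,Y)$. Let $\mathcal B$ be the ordered basis of $\mathbb R^n$, and $\Lambda_{\mathcal B}$, $\mathbf D$, $\chi_{\mathbf d}$ the maps, defined in the context. Then $\Lambda_{\mathcal B}(K)$ is given by $$\Lambda_{\mathcal B}(K)=\Big\{\mathbf D(g)\ \Big|\ g\in\prod_{i=1}^s \mathrm O_{t_{d_i}},\ \chi_{\mathbf d}(g)=1\Big\}.$$ The nilpotent orbit $\mathcal O_X$ in $\mathfrak{sl}_n(\mathbb R)$ is homotopic to (has the homotopy type of) $\mathrm{SO}_n/\Lambda_{\mathcal B}(K)$.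
   Context: Here $n$ is a positive integer. An $\mathfrak{sl}_2(\mathbb R)$-triple $\{X,H,Y\}$ satisfies $X\neq0$, $[H,X]=2X$, $[H,Y]=-2Y$, $[X,Y]=H$. $\mathcal Z_G(X,H,Y)$ is the subgroup of elements of $G$ fixing $X,H,Y$ under the adjoint action. $\mathcal O_X=\{\mathrm{Ad}(g)X: g\in\mathrm{SL}_n(\mathbb R)\}$. $\mathrm O_t$ and $\mathrm{SO}_n$ are the compact real orthogonal and special orthogonal groups. Let $V=\mathbb R^n$ (column vectors). For $d\ge1$ let $M(d-1)$ be the sum of all $\mathbb R$-subspaces of $V$ of dimension $d$ that are irreducible $\mathrm{Span}_{\mathbb R}\{X,H,Y\}$-submodules, $L(d-1)=M(d-1)\cap\ker Y$, and $t_d=\dim_{\mathbb R}L(d-1)$. Let $d_1<\dots<d_s$ be the integers $d$ with $t_d>0$. Then $\sum_i t_{d_i}d_i=n$, and $\mathbf d=[d_1^{t_{d_1}},\dots,d_s^{t_{d_s}}]$ is the partition associated to $\mathcal O_X$ (it depends only on $\mathcal O_X$). For each $d\in\{d_1,\dots,d_s\}$ an ordered $\mathbb R$-basis $(v^d_1,\dots,v^d_{t_d})$ of $L(d-1)$ is fixed. Let $\mathcal B^l(d)=(X^lv^d_1,\dots,X^lv^d_{t_d})$, an ordered basis of $X^lL(d-1)$, for $0\le l\le d-1$; let $\mathcal B(d)$ be the concatenation of $\mathcal B^0(d),\dots,\mathcal B^{d-1}(d)$ in this order, and let $\mathcal B$ be the concatenation of $\mathcal B(d_1),\dots,\mathcal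 B(d_s)$; $\mathcal B$ is an ordered basis of $V$. $\Lambda_{\mathcal B}:\mathrm{End}_{\mathbb R}(V)\to\mathrm M_n(\mathbb R)$ is the algebra isomorphism sending an endomorphism to its matrix with respect to $\mathcal B$. $\mathbf D:\prod_{i=1}^s\mathrm M_{t_{d_i}}(\mathbb R)\to\mathrm M_n(\mathbb R)$ sends $(A_{d_1},\dots,A_{d_s})$ to the block diagonal matrix $\bigoplus_{j=1}^s(A_{d_j}\oplus\cdots\oplus A_{d_j})$ with $A_{d_j}$ repeated $d_j$ times. $\chi_{\mathbf d}(g_1,\dots,g_s)=\prod_{i=1}^s(\det g_i)^{d_i}$.
   Formalization: For arbitrary K and arbitrary fixed bases of the L(d-1) the equality can fail (e.g. d=[2^2]); it and the homotopy claim are proved for a suitable conjugate of K in the centralizer with the given basis, and for K itself with suitably chosen bases of the L(d-1). *)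

theory Defs
  imports
    "HOL-Algebra.Coset"
    "Jordan_Normal_Form.Determinant"
    "HOL-Analysis.Analysis"
begin

text \<open>
  The index type of \<open>\<real>\<^sup>n\<close> is a finite linearly ordered type, and \<open>n = CARD('n)\<close>.
  The order is what makes ``ordered basis'' and ``block diagonal'' meaningful.
  Blocks, whose sizes vary, are Jordan-Normal-Form matrices (\<open>real mat\<close>); elements of
  \<open>M\<^sub>n(\<real>)\<close> are of type \<open>real^'n^'n\<close>.
\<close>

section \<open>Matrix groups and the adjoint action\<close>

definition SL :: "(real^'n^'n) set" where
  "SL = {g. Determinants.det g = 1}"

definition SO :: "(real^'n^'n) set" where
  "SO = {g. orthogonal_matrix g \<and> Determinants.det g = 1}"

definition sl :: "(real^'n^'n) set" where
  "sl = {A. Determinants.trace A = 0}"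

definition lie_bracket :: "real^'n^'n \<Rightarrow> real^'n^'n \<Rightarrow> real^'n^'n" where
  "lie_bracket A B = A ** B - B ** A"

text \<open>Powers are iterated matrix products; \<open>^\<close> on \<open>real^'n^'n\<close> is componentwise.\<close>

definition nilpotent_matrix :: "real^'n^'n \<Rightarrow> bool" where
  "nilpotent_matrix A \<longleftrightarrow> (\<exists>k. (((**) A) ^^ k) (Finite_Cartesian_Product.mat 1) = 0)"

definition sl2_triple :: "real^'n^'n \<Rightarrow> real^'n^'n \<Rightarrow> real^'n^'n \<Rightarrow> bool" where
  "sl2_triple X H Y \<longleftrightarrow> X \<in> sl \<and> H \<in> sl \<and> Y \<in> sl \<and> X \<noteq> 0 \<and>
     lie_bracket H X = 2 *\<^sub>R X \<and> lie_bracket H Y = - 2 *\<^sub>R Y \<and> lie_bracket X Y = H"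

definition Ad :: "real^'n^'n \<Rightarrow> real^'n^'n \<Rightarrow> real^'n^'n" where
  "Ad g A = g ** A ** matrix_inv g"

definition nilp_orbit :: "real^'n^'n \<Rightarrow> (real^'n^'n) set" where
  "nilp_orbit X = (\<lambda>g. Ad g X) ` SL"

definition triple_centralizer ::
    "real^'n^'n \<Rightarrow> real^'n^'n \<Rightarrow> real^'n^'n \<Rightarrow> (real^'n^'n) set" where
  "triple_centralizer X H Y = {g \<in> SL. Ad g X = X \<and> Ad g H = H \<and> Ad g Y = Y}"

definition matrix_group :: "(real^'n^'n) set \<Rightarrow> (real^'n^'n) monoid" where
  "matrix_group G =
     \<lparr>carrier = G, monoid.mult = (**), one = Finite_Cartesian_Product.mat 1\<rparr>"

definition maximal_compact_subgroup :: "(real^'n^'n) set \<Rightarrow> (real^'n^'n) set \<Rightarrow> bool" where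
  "maximal_compact_subgroup G K \<longleftrightarrow>
     subgroup K (matrix_group G) \<and> compact K \<and>
     (\<forall>K'. subgroup K' (matrix_group G) \<and> compact K' \<and> K \<subseteq> K' \<longrightarrow> K' = K)"

section \<open>Quotient spaces\<close>

definition quotient_topology :: "'a topology \<Rightarrow> ('a \<Rightarrow> 'b) \<Rightarrow> 'b topology" where
  "quotient_topology T q =
     topology (\<lambda>U. U \<subseteq> q ` topspace T \<and> openin T {x \<in> topspace T. q x \<in> U})"

lemma openin_quotient_topology:
  "openin (quotient_topology T q) U \<longleftrightarrow>
     U \<subseteq> q ` topspace T \<and> openin T {x \<in> topspace T. q x \<in> U}"
proof -
  have 1: "openin T {x \<in> topspace T. q x \<in> U \<inter> V}"
    if "openin T {x \<in> topspace T. q x \<in> U}" "openin T {x \<in> topspace T. q x \<in> V}" for U V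
  proof -
    have "{x \<in> topspace T. q x \<in> U \<inter> V} =
      {x \<in> topspace T. q x \<in> U} \<inter> {x \<in> topspace T. q x \<in> V}" by auto
    with that show ?thesis by (simp add: openin_Int)
  qed
  have 2: "openin T {x \<in> topspace T. q x \<in> \<Union>\<U>}"
    if "\<forall>U\<in>\<U>. openin T {x \<in> topspace T. q x \<in> U}" for \<U>
  proof -
    have "{x \<in> topspace T. q x \<in> \<Union>\<U>} = \<Union>((\<lambda>U. {x \<in> topspace T. q x \<in> U}) ` \<U>)" by auto
    with that show ?thesis by auto
  qed
  have "istopology (\<lambda>U. U \<subseteq> q ` topspace T \<and> openin T {x \<in> topspace T. q x \<in> U})"
    unfolding istopology_def using 1 2 by blast
  then show ?thesis
    by (simp add: quotient_topology_def topology_inverse')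
qed

lemma topspace_quotient_topology [simp]:
  "topspace (quotient_topology T q) = q ` topspace T"
proof -
  have "{x \<in> topspace T. q x \<in> q ` topspace T} = topspace T" by auto
  then have "openin (quotient_topology T q) (q ` topspace T)"
    by (simp add: openin_quotient_topology)
  then show ?thesis
    by (metis openin_quotient_topology openin_subset openin_topspace subset_antisym)
qed

lemma quotient_map_quotient_topology: "quotient_map T (quotient_topology T q) q"
  unfolding quotient_map_def by (auto simp: openin_quotient_topology)

definition coset_space :: "(real^'n^'n) set \<Rightarrow> (real^'n^'n) set \<Rightarrow> (real^'n^'n) set topology" where
  "coset_space G K = quotient_topology (top_of_set G) (\<lambda>g. g <#\<^bsub>matrix_group G\<^esub> K)"

section \<open>Isotypic decomposition and the associated partition\<close>

definition mat_submodule :: "(real^'n^'n) set \<Rightarrow> (real^'n) set \<Rightarrow> bool" where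
  "mat_submodule S W \<longleftrightarrow> subspace W \<and> (\<forall>A\<in>S. \<forall>w\<in>W. A *v w \<in> W)"

definition irreducible_mat_submodule :: "(real^'n^'n) set \<Rightarrow> (real^'n) set \<Rightarrow> bool" where
  "irreducible_mat_submodule S W \<longleftrightarrow> mat_submodule S W \<and> W \<noteq> {0} \<and>
     (\<forall>U. mat_submodule S U \<and> U \<subseteq> W \<longrightarrow> U = {0} \<or> U = W)"

text \<open>\<open>isotypic X H Y d\<close> and \<open>lowest X H Y d\<close> are \<open>M(d-1)\<close> and \<open>L(d-1)\<close>: here they
  are indexed by the dimension \<open>d\<close> of the simple module, not by its highest weight.\<close>

definition isotypic ::
    "real^'n^'n \<Rightarrow> real^'n^'n \<Rightarrow> real^'n^'n \<Rightarrow> nat \<Rightarrow> (real^'n) set" where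
  "isotypic X H Y d =
     span (\<Union>{W. irreducible_mat_submodule (span {X, H, Y}) W \<and> dim W = d})"

definition lowest ::
    "real^'n^'n \<Rightarrow> real^'n^'n \<Rightarrow> real^'n^'n \<Rightarrow> nat \<Rightarrow> (real^'n) set" where
  "lowest X H Y d = isotypic X H Y d \<inter> {v. Y *v v = 0}"

definition mult_dims :: "real^'n^'n \<Rightarrow> real^'n^'n \<Rightarrow> real^'n^'n \<Rightarrow> nat list" where
  "mult_dims X H Y = sorted_list_of_set {d. d \<ge> 1 \<and> dim (lowest X H Y d) > 0}"

text \<open>A partition \<open>[d\<^sub>1^t\<^sub>1, \<dots>, d\<^sub>s^t\<^sub>s]\<close> is the list of pairs \<open>(d\<^sub>i, t\<^sub>i)\<close>.\<close>

definition assoc_partition ::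
    "real^'n^'n \<Rightarrow> real^'n^'n \<Rightarrow> real^'n^'n \<Rightarrow> (nat \<times> nat) list" where
  "assoc_partition X H Y = map (\<lambda>d. (d, dim (lowest X H Y d))) (mult_dims X H Y)"

section \<open>The ordered basis and matrices with respect to it\<close>

definition ordered_basis_of :: "(real^'n) set \<Rightarrow> (real^'n) list \<Rightarrow> bool" where
  "ordered_basis_of W vs \<longleftrightarrow> distinct vs \<and> independent (set vs) \<and> span (set vs) = W"

definition lowest_bases ::
    "real^'n^'n \<Rightarrow> real^'n^'n \<Rightarrow> real^'n^'n \<Rightarrow> (nat \<Rightarrow> (real^'n) list) \<Rightarrow> bool" where
  "lowest_bases X H Y v \<longleftrightarrow>
     (\<forall>d \<in> set (mult_dims X H Y). ordered_basis_of (lowest X H Y d) (v d))"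

definition basis_layer ::
    "real^'n^'n \<Rightarrow> (nat \<Rightarrow> (real^'n) list) \<Rightarrow> nat \<Rightarrow> nat \<Rightarrow> (real^'n) list" where
  "basis_layer X v d l = map (((*v) X) ^^ l) (v d)"

definition total_basis ::
    "real^'n^'n \<Rightarrow> real^'n^'n \<Rightarrow> real^'n^'n \<Rightarrow> (nat \<Rightarrow> (real^'n) list) \<Rightarrow> (real^'n) list" where
  "total_basis X H Y v =
     concat (map (\<lambda>d. concat (map (basis_layer X v d) [0..<d])) (mult_dims X H Y))"

text \<open>The position of an index, counted from \<open>0\<close>.\<close>

definition idx :: "'n::{finite,linorder} \<Rightarrow> nat" where
  "idx i = card {..<i}"

definition Lambda ::
    "(real^'n::{finite,linorder}) list \<Rightarrow> (real^'n::{finite,linorder} \<Rightarrow> real^'n::{finite,linorder})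
      \<Rightarrow> real^'n::{finite,linorder}^'n::{finite,linorder}" where
  "Lambda B f = (\<chi> i j. representation (set B) (f (B ! idx j)) (B ! idx i))"

section \<open>Orthogonal blocks, block diagonal embedding and character\<close>

definition O_group :: "nat \<Rightarrow> real Matrix.mat set" where
  "O_group t = {A \<in> carrier_mat t t. transpose_mat A * A = 1\<^sub>m t}"

definition O_prod :: "(nat \<times> nat) list \<Rightarrow> (nat \<Rightarrow> real Matrix.mat) set" where
  "O_prod p = (\<Pi>\<^sub>E i\<in>{..<length p}. O_group (snd (p ! i)))"

text \<open>Meaningful when the parts of \<open>p\<close> sum to \<open>CARD('n)\<close> and the \<open>i\<close>-th block is a
  \<open>t\<^sub>i \<times> t\<^sub>i\<close> matrix, so that the indices exhaust the block diagonal matrix.\<close>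

definition D_embed ::
    "(nat \<times> nat) list \<Rightarrow> (nat \<Rightarrow> real Matrix.mat)
      \<Rightarrow> real^'n::{finite,linorder}^'n::{finite,linorder}" where
  "D_embed p g =
     (let M = diag_block_mat (concat (map (\<lambda>i. replicate (fst (p ! i)) (g i)) [0..<length p]))
      in (\<chi> i j. M $$ (idx i, idx j)))"

definition chi_char :: "(nat \<times> nat) list \<Rightarrow> (nat \<Rightarrow> real Matrix.mat) \<Rightarrow> real" where
  "chi_char p g = (\<Prod>i<length p. Determinant.det (g i) ^ fst (p ! i))"

end

theory Submission
  imports Defs
begin

text \<open>
  In the basis \<open>X\<^sup>l v\<^sup>d\<^sub>a\<close> the nilpotent \<open>X\<close> becomes a direct sum \<open>N\<close> of shifts. An orthogonal matrix
  commuting with \<open>N\<close> also commutes with its transpose, hence preserves the weights; so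
  \<open>{D(g) | g orthogonal, \<chi>(g) = 1}\<close> is the stabilizer of \<open>N\<close> in \<open>SO\<^sub>n\<close>, and \<open>SO\<^sub>n\<close> modulo this group is
  the \<open>SO\<^sub>n\<close>-orbit of \<open>N\<close>. It remains to retract the \<open>SL\<^sub>n\<close>-orbit of \<open>N\<close> onto its \<open>SO\<^sub>n\<close>-orbit.

  Given \<open>X\<close> in the former, the frames \<open>h\<close> with \<open>X h = h N\<close> form a linear space, on which \<open>det h\<close> has a maximum under
  the constraint \<open>|h|\<^sup>2 = n\<close>. At a maximum, \<open>tr (h\<^sup>T h x) = tr x\<close> for all \<open>x\<close> commuting with \<open>N\<close>, and the
  grading of the centralizer of \<open>N\<close> shows that this equation determines \<open>p = h h\<^sup>T\<close>; so \<open>p\<close> is a continuous function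
  of \<open>X\<close>, equal to \<open>1\<close> on the \<open>SO\<^sub>n\<close>-orbit. Conjugating \<open>X\<close> by the square roots of \<open>(1 - t) + t p\<close> is the
  retraction.

  A compact group \<open>K\<close> commuting with the triple fixes a positive definite matrix, namely the
  minimum point of a strictly convex \<open>K\<close>-invariant function on the convex hull of \<open>{k k\<^sup>T}\<close>. Its factorization inside
  the centralizer of the triple conjugates \<open>K\<close> into the orthogonal block matrices.
\<close>

text \<open>Maximizing the determinant takes its place. Two frames of the same matrix differ by a
  right factor in the centralizer; stationarity removes the part of positive degree of this factor
  and leaves its part of degree zero free only up to an orthogonal matrix. That residual freedom
  cancels in \<open>h h^T\<close>, which is why the metric and not the frame enters the retraction.

  Continuity of the metric comes from compactness: maximal frames stay on a sphere, limits of
  maximal frames are maximal, and the metric is unique. Maximality of a limit has to be tested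
  against every frame of the limit matrix, and such frames are approximable because the space of
  frames has constant dimension along the orbit.

  The same extremal problem, posed in a matrix algebra closed under transposition and with the form
  given by the inverse of \<open>p\<close>, factors \<open>p\<close> inside that algebra. Both the
  square roots and the conjugation of compact groups start from this factorization.\<close>

no_notation vec_index (infixl "$" 100)
no_notation scalar_prod (infix "\<bullet>" 70)
hide_const (open) Determinant.det Matrix.mat Matrix.row Matrix.col Matrix.vec
hide_fact (open) Matrix.mat_def

section \<open>Real square matrices\<close>

lemma bounded_bilinear_matrix_mult:
  "bounded_bilinear ((**) :: real^'m^'n \<Rightarrow> real^'p^'m \<Rightarrow> real^'p^'n)"
proof -
  have "bilinear ((**) :: real^'m^'n \<Rightarrow> real^'p^'m \<Rightarrow> real^'p^'n)"
    unfolding bilinear_def linear_iff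
    by (intro conjI allI)
       (simp_all add: matrix_add_ldistrib matrix_scalar_ac scalar_matrix_assoc,
        simp_all add: matrix_matrix_mult_def vec_eq_iff distrib_right sum.distrib)
  then show ?thesis
    by (simp add: bilinear_conv_bounded_bilinear)
qed

lemmas matmul_distribs =
  bounded_bilinear.add_left[OF bounded_bilinear_matrix_mult]
  bounded_bilinear.add_right[OF bounded_bilinear_matrix_mult]
  bounded_bilinear.diff_left[OF bounded_bilinear_matrix_mult]
  bounded_bilinear.diff_right[OF bounded_bilinear_matrix_mult]
  bounded_bilinear.scaleR_left[OF bounded_bilinear_matrix_mult]
  bounded_bilinear.scaleR_right[OF bounded_bilinear_matrix_mult]
  bounded_bilinear.minus_left[OF bounded_bilinear_matrix_mult]
  bounded_bilinear.minus_right[OF bounded_bilinear_matrix_mult]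

lemmas matmul_zero =
  bounded_bilinear.zero_left[OF bounded_bilinear_matrix_mult]
  bounded_bilinear.zero_right[OF bounded_bilinear_matrix_mult]

lemmas tendsto_matmul = bounded_bilinear.tendsto[OF bounded_bilinear_matrix_mult]
lemmas continuous_on_matmul = bounded_bilinear.continuous_on[OF bounded_bilinear_matrix_mult]

lemma bounded_linear_transpose: "bounded_linear (transpose :: real^'m^'n \<Rightarrow> _)"
  by (intro linear_conv_bounded_linear[THEN iffD1])
     (simp add: linear_iff transpose_def vec_eq_iff)

lemmas tendsto_transpose = bounded_linear.tendsto[OF bounded_linear_transpose]
lemmas continuous_on_transpose = bounded_linear.continuous_on[OF bounded_linear_transpose]

lemma transpose_add: "transpose (A + B) = transpose A + transpose (B :: real^'m^'n)"
  and transpose_scaleR: "transpose (c *\<^sub>R A) = c *\<^sub>R transpose A"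
  by (simp_all add: transpose_def vec_eq_iff)

lemma inner_eq_trace: "A \<bullet> B = trace (transpose A ** (B :: real^'n^'m))"
  unfolding trace_def inner_vec_def matrix_matrix_mult_def transpose_def
  by simp (rule sum.swap)

lemma trace_scaleR: "trace (c *\<^sub>R A) = c * trace (A :: real^'n^'n)"
  by (simp add: trace_def sum_distrib_left)

lemma inner_mul_left: "(A ** B) \<bullet> C = B \<bullet> (transpose A ** (C :: real^'n^'m))"
  by (simp add: inner_eq_trace matrix_transpose_mul matrix_mul_assoc)

lemma inner_mul_right: "(A ** B) \<bullet> C = A \<bullet> (C ** transpose (B :: real^'n^'m))"
  using trace_mul_sym[of "transpose B" "transpose A ** C"]
  by (simp add: inner_eq_trace matrix_transpose_mul matrix_mul_assoc)

lemma inner_transpose: "transpose A \<bullet> transpose B = A \<bullet> (B :: real^'n^'m)"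
  unfolding inner_vec_def transpose_def by simp (rule sum.swap)

lemma inner_mat_1: "mat 1 \<bullet> A = trace (A :: real^'n^'n)"
  by (simp add: inner_eq_trace transpose_mat)

lemma matrix_inv_right: "A ** matrix_inv A = mat 1" (is ?r)
  and matrix_inv_left: "matrix_inv A ** A = mat 1" (is ?l)
  if "det (A :: real^'n^'n) \<noteq> 0"
proof -
  from that obtain B where "A ** B = mat 1 \<and> B ** A = mat 1"
    by (auto simp: invertible_det_nz[symmetric] invertible_def)
  then have "A ** matrix_inv A = mat 1 \<and> matrix_inv A ** A = mat 1"
    unfolding matrix_inv_def by (rule someI)
  then show ?r ?l by auto
qed

lemma matrix_inv_unique: "A ** B = mat 1 \<Longrightarrow> matrix_inv A = (B :: real^'n^'n)"
proof -
  assume AB: "A ** B = mat 1"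
  then have "det A * det B = 1" by (metis det_mul det_I)
  then have "det A \<noteq> 0" by auto
  then show ?thesis
    by (metis AB matrix_inv_left matrix_mul_assoc matrix_mul_lid matrix_mul_rid)
qed

lemma det_matrix_inv: "det (A :: real^'n^'n) \<noteq> 0 \<Longrightarrow> det (matrix_inv A) = 1 / det A"
  by (metis det_I det_mul matrix_inv_right nonzero_mult_div_cancel_left)

lemma matrix_inv_mul:
  "det A \<noteq> 0 \<Longrightarrow> det B \<noteq> 0 \<Longrightarrow> matrix_inv (A ** B) = matrix_inv B ** matrix_inv (A :: real^'n^'n)"
  by (intro matrix_inv_unique) (metis matrix_inv_right matrix_mul_assoc matrix_mul_lid)

lemma matrix_inv_matrix_inv:
  "det A \<noteq> 0 \<Longrightarrow> matrix_inv (matrix_inv A) = (A :: real^'n^'n)"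
  by (intro matrix_inv_unique matrix_inv_left)

lemma matrix_inv_transpose:
  "det A \<noteq> 0 \<Longrightarrow> matrix_inv (transpose A) = transpose (matrix_inv (A :: real^'n^'n))"
  by (intro matrix_inv_unique) (metis matrix_inv_left matrix_transpose_mul transpose_mat)

lemma matrix_inv_cancel [simp]:
  fixes A :: "real^'n^'n"
  assumes "det A \<noteq> 0"
  shows "A ** (matrix_inv A ** B) = B" "matrix_inv A ** (A ** B) = B"
    "B ** A ** matrix_inv A = B" "B ** matrix_inv A ** A = B"
  using assms
  by (simp_all add: matrix_mul_assoc matrix_inv_left matrix_inv_right)
     (simp_all add: matrix_mul_assoc[symmetric] matrix_inv_left matrix_inv_right)

section \<open>Continuity of determinant and inverse, derivative of the determinant\<close>

lemma tendsto_det: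
  fixes f :: "'a \<Rightarrow> real^'n^'n"
  assumes "(f \<longlongrightarrow> A) F"
  shows "((\<lambda>x. det (f x)) \<longlongrightarrow> det A) F"
  unfolding Determinants.det_def by (intro tendsto_intros assms)

lemma continuous_on_det:
  fixes f :: "'a::topological_space \<Rightarrow> real^'n^'n"
  assumes "continuous_on S f"
  shows "continuous_on S (\<lambda>x. det (f x))"
  using assms unfolding continuous_on_def by (auto intro: tendsto_det)

lemma det_scaleR: "det (c *\<^sub>R A) = c ^ CARD('n) * det (A :: real^'n^'n)"
  unfolding Determinants.det_def
  by (simp add: sum_distrib_left prod.distrib ac_simps)

lemma det_zero [simp]: "det (0 :: real^'n^'n) = 0"
  using det_scaleR[of 0 "mat 1 :: real^'n^'n"] by (simp add: power_0_left)

text \<open>Cramer's rule, applied to the columns of the inverse, writes its entries as quotients of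
  determinants. The formula \<open>cof\<close> agrees with the inverse only where the determinant is
  nonzero, which holds eventually along \<open>F\<close>.\<close>

lemma tendsto_matrix_inv:
  fixes f :: "'a \<Rightarrow> real^'n^'n"
  assumes f: "(f \<longlongrightarrow> A) F" and nz: "det A \<noteq> 0"
  shows "((\<lambda>x. matrix_inv (f x)) \<longlongrightarrow> matrix_inv A) F"
proof -
  define cof where "cof A = (\<chi> k j. det (\<chi> i l. if l = k then axis j 1 $ i else A $ i $ l) / det A)"
    for A :: "real^'n^'n"
  have eq: "matrix_inv A = cof A" if "det A \<noteq> 0" for A :: "real^'n^'n"
  proof -
    have "matrix_inv A $ k $ j = cof A $ k $ j" for k j
    proof -
      have "A *v (matrix_inv A *v axis j 1) = axis j 1"
        by (simp add: matrix_vector_mul_assoc matrix_inv_right that)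
      then have "matrix_inv A *v axis j 1 = (\<chi> k. det (\<chi> i l. if l = k then axis j 1 $ i else A $ i $ l) / det A)"
        by (rule cramer[OF that, THEN iffD1])
      from arg_cong[OF this, of "\<lambda>v. v $ k"] show ?thesis
        by (simp add: matrix_vector_mul_component inner_axis cof_def)
    qed
    then show ?thesis by (intro vec_eq_iff[THEN iffD2] allI)
  qed
  have "((\<lambda>x. cof (f x)) \<longlongrightarrow> cof A) F"
  proof (intro vec_tendstoI)
    fix k j
    have "((\<lambda>x. (\<chi> i l. if l = k then axis j 1 $ i else f x $ i $ l)) \<longlongrightarrow>
        (\<chi> i l. if l = k then axis j 1 $ i else A $ i $ l)) F"
      by (intro vec_tendstoI) (auto intro: tendsto_vec_nth[OF tendsto_vec_nth[OF f]])
    then have "((\<lambda>x. det (\<chi> i l. if l = k then axis j 1 $ i else f x $ i $ l) / det (f x)) \<longlongrightarrow>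
        det (\<chi> i l. if l = k then axis j 1 $ i else A $ i $ l) / det A) F"
      by (intro tendsto_divide tendsto_det f nz)
    then show "((\<lambda>x. cof (f x) $ k $ j) \<longlongrightarrow> cof A $ k $ j) F"
      by (simp add: cof_def)
  qed
  moreover have "\<forall>\<^sub>F x in F. det (f x) \<noteq> 0"
    using tendsto_det[OF f] nz by (rule tendsto_imp_eventually_ne)
  then have "\<forall>\<^sub>F x in F. cof (f x) = matrix_inv (f x)"
    by eventually_elim (simp add: eq)
  ultimately show ?thesis
    unfolding eq[OF nz] by (rule Lim_transform_eventually)
qed

text \<open>In the Leibniz expansion a permutation other than the identity moves at least two
  indices, so its term vanishes to second order; the identity contributes the trace.\<close>

lemma has_derivative_det_at_mat_1:
  fixes x :: "real^'n^'n"
  shows "((\<lambda>e. det (mat 1 + e *\<^sub>R x)) has_field_derivative trace x) (at 0)"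
proof -
  let ?f = "\<lambda>p i e. (mat 1 + e *\<^sub>R x) $ i $ p i"
  define d where "d p = of_int (sign p) * (\<Sum>i\<in>UNIV. x $ i $ p i * (\<Prod>j\<in>UNIV-{i}. ?f p j 0))" for p
  have entry: "((\<lambda>e. (mat 1 + e *\<^sub>R x) $ i $ k) has_field_derivative x $ i $ k) (at 0)" for i k
    by (auto intro!: derivative_eq_intros)
  have 1: "((\<lambda>e. det (mat 1 + e *\<^sub>R x)) has_field_derivative
      (\<Sum>p\<in>{p. p permutes (UNIV::'n set)}. d p)) (at 0)"
    unfolding Determinants.det_def d_def
    by (intro DERIV_sum DERIV_cmult has_field_derivative_prod entry)
  have "d p = 0" if p: "p permutes UNIV" "p \<noteq> id" for p :: "'n \<Rightarrow> 'n"
  proof -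
    have "(\<Prod>j\<in>UNIV-{i}. ?f p j 0) = 0" for i
    proof -
      have "\<exists>j\<in>UNIV-{i}. p j \<noteq> j"
      proof (rule ccontr)
        assume "\<not> ?thesis"
        then have *: "\<And>j. j \<noteq> i \<Longrightarrow> p j = j" by auto
        moreover have "p i = i" using p(1) * by (metis permutes_def)
        ultimately show False using p(2) by (metis id_apply ext)
      qed
      then show ?thesis by (force simp: mat_def)
    qed
    then show ?thesis unfolding d_def by (simp only: mult_zero_right sum.neutral_const)
  qed
  then have "(\<Sum>p\<in>{p. p permutes (UNIV::'n set)}. d p) = (\<Sum>p\<in>{id}. d p)"
    by (intro sum.mono_neutral_right finite_permutations finite) (auto simp: permutes_id)
  also have "\<dots> = trace x"
    by (simp add: trace_def mat_def d_def)
  finally show ?thesis using 1 by simp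
qed

section \<open>Positive definite matrices and frames of maximal determinant\<close>

text \<open>Serves to prove continuity of maps defined by uniqueness, such as \<open>msqrt\<close>
  and \<open>metric_of\<close>: bounded values with a single possible limit point converge.\<close>

lemma tendsto_from_subsequences:
  fixes X :: "nat \<Rightarrow> 'a::heine_borel"
  assumes bdd: "bounded (range X)"
    and lim: "\<And>r l. strict_mono (r :: nat \<Rightarrow> nat) \<Longrightarrow> (X \<circ> r) \<longlonglongrightarrow> l \<Longrightarrow> l = L"
  shows "X \<longlonglongrightarrow> L"
proof (rule ccontr)
  assume "\<not> X \<longlonglongrightarrow> L"
  then obtain e where e: "e > 0" "\<not> (\<forall>\<^sub>F n in sequentially. dist (X n) L < e)"
    unfolding tendsto_iff by blast
  then have "\<exists>\<^sub>F n in sequentially. dist (X n) L \<ge> e"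
    by (simp add: not_eventually not_less)
  then have "infinite {n. dist (X n) L \<ge> e}"
    by (simp add: frequently_cofinite[symmetric] cofinite_eq_sequentially)
  then obtain r :: "nat \<Rightarrow> nat" where r: "strict_mono r" "\<And>n. dist (X (r n)) L \<ge> e"
    using infinite_enumerate by blast
  have "bounded (range (X \<circ> r))"
    using bdd by (rule bounded_subset) auto
  then obtain l r' where l: "strict_mono (r' :: nat \<Rightarrow> nat)" "((X \<circ> r) \<circ> r') \<longlonglongrightarrow> l"
    using bounded_imp_convergent_subsequence by blast
  then have "l = L"
    using lim[of "r \<circ> r'" l] r(1) by (simp add: strict_mono_o comp_assoc)
  then have "\<forall>\<^sub>F n in sequentially. dist (X (r (r' n))) L < e"
    using l(2) e(1) unfolding tendsto_iff by simp
  then show False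
    using r(2) by (meson eventually_sequentially le_refl not_less)
qed

definition pos_def :: "real^'n^'n \<Rightarrow> bool" where
  "pos_def M \<longleftrightarrow> transpose M = M \<and> (\<forall>v. v \<noteq> 0 \<longrightarrow> v \<bullet> (M *v v) > 0)"

lemma pos_def_symmetric: "pos_def M \<Longrightarrow> transpose M = M"
  and pos_def_pos: "pos_def M \<Longrightarrow> v \<noteq> 0 \<Longrightarrow> v \<bullet> (M *v v) > 0"
  by (auto simp: pos_def_def)

lemma pos_def_nonneg: "pos_def M \<Longrightarrow> v \<bullet> (M *v v) \<ge> 0"
  by (cases "v = 0") (auto simp: pos_def_def less_imp_le)

lemma pos_def_mat_1: "pos_def (mat 1)"
  by (auto simp: pos_def_def transpose_mat)

lemma pos_def_add: "pos_def A \<Longrightarrow> pos_def B \<Longrightarrow> pos_def (A + B)"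
  by (auto simp: pos_def_def transpose_add matrix_vector_mult_add_rdistrib inner_add_right add_pos_pos)

lemma pos_def_scaleR: "pos_def A \<Longrightarrow> c > 0 \<Longrightarrow> pos_def (c *\<^sub>R A)"
  by (auto simp: pos_def_def transpose_scaleR scaleR_matrix_vector_assoc[symmetric])

lemma pos_def_convex:
  assumes "pos_def A" "pos_def B" "0 \<le> t" "t \<le> 1"
  shows "pos_def ((1 - t) *\<^sub>R A + t *\<^sub>R B)"
proof (cases "t = 0 \<or> t = 1")
  case False
  then show ?thesis
    using assms by (intro pos_def_add pos_def_scaleR) auto
qed (use assms in auto)

lemma pos_def_det_nz: "pos_def M \<Longrightarrow> det M \<noteq> 0"
proof
  assume M: "pos_def M" and "det M = 0"
  then obtain v where "v \<noteq> 0" "M *v v = 0"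
    using matrix_left_invertible_ker[of M] by (metis invertible_det_nz invertible_left_inverse)
  then show False using pos_def_pos[OF M, of v] by simp
qed

lemma inner_matrix_vector_transpose: "x \<bullet> (A *v y) = (transpose A *v x) \<bullet> (y :: real^'n)"
  by (simp add: dot_lmul_matrix)

lemma pos_def_matrix_inv:
  assumes M: "pos_def M" shows "pos_def (matrix_inv M)"
  unfolding pos_def_def
proof (intro conjI allI impI)
  note nz = pos_def_det_nz[OF M]
  show "transpose (matrix_inv M) = matrix_inv M"
    using matrix_inv_transpose[OF nz] M by (simp add: pos_def_def)
  fix v :: "real^'a" assume "v \<noteq> 0"
  define w where "w = matrix_inv M *v v"
  have v: "M *v w = v"
    by (simp add: w_def matrix_vector_mul_assoc matrix_inv_right nz)
  then have "w \<noteq> 0" using \<open>v \<noteq> 0\<close> by auto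
  then show "v \<bullet> (matrix_inv M *v v) > 0"
    using pos_def_pos[OF M, of w] v by (simp add: w_def[symmetric] inner_commute)
qed

lemma pos_def_mul_transpose:
  assumes "det h \<noteq> 0" shows "pos_def (h ** transpose (h :: real^'n^'n))"
  unfolding pos_def_def
proof (intro conjI allI impI)
  show "transpose (h ** transpose h) = h ** transpose h"
    by (simp add: matrix_transpose_mul)
  fix v :: "real^'n" assume v: "v \<noteq> 0"
  have "transpose h *v v \<noteq> 0"
  proof
    assume "transpose h *v v = 0"
    then have "matrix_inv (transpose h) *v (transpose h *v v) = 0" by simp
    with v show False using assms
      by (simp add: matrix_vector_mul_assoc matrix_inv_left del: transpose_matrix_vector)
  qed
  then show "v \<bullet> (h ** transpose h *v v) > 0"
    by (simp add: matrix_vector_mul_assoc[symmetric] inner_matrix_vector_transpose)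
qed

lemma inner_mul_eq_sum_columns:
  "A \<bullet> (M ** B) = (\<Sum>j\<in>UNIV. column j A \<bullet> (M *v column j (B :: real^'m^'n)))"
  unfolding inner_vec_def matrix_matrix_mult_def matrix_vector_mult_def column_def
  by simp (rule sum.swap)

lemma column_eq_0_iff: "(\<forall>j. column j A = 0) \<longleftrightarrow> A = 0"
  by (auto simp: column_def vec_eq_iff)

lemma pos_def_inner_nonneg: "pos_def M \<Longrightarrow> A \<bullet> (M ** A) \<ge> 0"
  unfolding inner_mul_eq_sum_columns by (intro sum_nonneg pos_def_nonneg)

lemma pos_def_inner_pos:
  assumes M: "pos_def M" and A: "A \<noteq> 0" shows "A \<bullet> (M ** A) > 0"
proof -
  obtain j where j: "column j A \<noteq> 0" using A column_eq_0_iff by blast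
  show ?thesis
    unfolding inner_mul_eq_sum_columns
    by (rule sum_pos2[of _ j])
       (auto simp: pos_def_nonneg[OF M] pos_def_pos[OF M j] simp del: transpose_matrix_vector)
qed

text \<open>The form is positive on the compact unit sphere, hence bounded below there, and it is
  homogeneous of degree two. This bounds the competitors in \<open>max_frame_exists\<close>.\<close>

lemma pos_def_inner_coercive:
  fixes M :: "real^'n^'n"
  assumes M: "pos_def M"
  obtains m where "m > 0" "\<And>A :: real^'n^'n. A \<bullet> (M ** A) \<ge> m * (norm A)^2"
proof -
  let ?S = "sphere 0 1 :: (real^'n^'n) set"
  have ne: "?S \<noteq> {}" by simp
  have "continuous_on ?S (\<lambda>A. A \<bullet> (M ** A))"
    by (intro continuous_intros continuous_on_matmul)
  then obtain A0 where A0: "A0 \<in> ?S" "\<And>A. A \<in> ?S \<Longrightarrow> A0 \<bullet> (M ** A0) \<le> A \<bullet> (M ** A)"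
    using continuous_attains_inf[OF compact_sphere ne] by blast
  have "A \<bullet> (M ** A) \<ge> (A0 \<bullet> (M ** A0)) * (norm A)^2" for A :: "real^'n^'n"
  proof (cases "A = 0")
    case False
    then have "A0 \<bullet> (M ** A0) \<le> (A /\<^sub>R norm A) \<bullet> (M ** (A /\<^sub>R norm A))"
      by (intro A0) auto
    also have "\<dots> = (A \<bullet> (M ** A)) / (norm A)^2"
      by (simp add: matmul_distribs power2_eq_square divide_inverse)
    finally show ?thesis using False by (simp add: pos_le_divide_eq)
  qed auto
  moreover have "A0 \<bullet> (M ** A0) > 0"
    using A0(1) by (intro pos_def_inner_pos M) auto
  ultimately show ?thesis using that by blast
qed

text \<open>Maximality of \<open>det\<close> on the level set where the form equals
  \<open>CARD('n)\<close>, in scale-invariant form: both sides have degree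
  \<open>2 * CARD('n)\<close> in \<open>g\<close>. Competitors need no normalization, so they can be
  perturbed and approximated freely.\<close>

definition max_frame :: "real^'n^'n \<Rightarrow> (real^'n^'n) set \<Rightarrow> real^'n^'n \<Rightarrow> bool" where
  "max_frame M E h \<longleftrightarrow> h \<in> E \<and> det h > 0 \<and> h \<bullet> (M ** h) = CARD('n) \<and>
     (\<forall>g\<in>E. det g > 0 \<longrightarrow>
        real CARD('n) ^ CARD('n) * (det g)^2 \<le> (det h)^2 * (g \<bullet> (M ** g)) ^ CARD('n))"

lemma max_frame_exists:
  fixes M :: "real^'n^'n"
  assumes M: "pos_def M" and E: "subspace E" and g0: "g0 \<in> E" "det g0 > 0"
  obtains h where "max_frame M E h"
proof -
  let ?n = "real CARD('n)"
  let ?q = "\<lambda>g :: real^'n^'n. g \<bullet> (M ** g)"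
  \<comment> \<open>The closed conditions \<open>\<le>\<close> make \<open>S\<close> compact; that
    the maximum has positive determinant and lies on the boundary of the first condition is
    recovered afterwards.\<close>
  define S where "S = {g \<in> E. ?q g \<le> ?n \<and> 0 \<le> det g}"
  have q_pos: "?q g > 0" if "det g > 0" for g
    using that by (intro pos_def_inner_pos M) auto
  define sc where "sc g = sqrt (?n / ?q g) *\<^sub>R g" for g :: "real^'n^'n"
  have q_sc: "?q (sc g) = ?n" if "det g > 0" for g
  proof -
    have "?q (sc g) = (sqrt (?n / ?q g))^2 * ?q g"
      unfolding sc_def matmul_distribs inner_scaleR_left inner_scaleR_right power2_eq_square
      by (simp only: mult.assoc)
    then show ?thesis using q_pos[OF that] by simp
  qed
  have det_sc: "det (sc g) = sqrt (?n / ?q g) ^ CARD('n) * det g" for g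
    by (simp add: sc_def det_scaleR)
  have sc_S: "sc g \<in> S" if "g \<in> E" "det g > 0" for g
    using that q_sc[OF that(2)] q_pos[OF that(2)] subspace_scale[OF E that(1)]
    unfolding S_def mem_Collect_eq det_sc by (simp add: sc_def)
  obtain m where m: "m > 0" "\<And>A. ?q A \<ge> m * (norm A)^2"
    using pos_def_inner_coercive[OF M] by blast
  have "bounded S"
  proof (rule boundedI)
    fix g assume "g \<in> S"
    then have "m * (norm g)^2 \<le> ?n" using m(2)[of g] by (auto simp: S_def)
    then show "norm g \<le> sqrt (?n / m)"
      using m(1) by (intro real_le_rsqrt) (simp add: field_simps)
  qed
  moreover have "closed S"
  proof -
    have "closed {g :: real^'n^'n. ?q g \<le> ?n}" "closed {g :: real^'n^'n. 0 \<le> det g}"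
      by (intro closed_Collect_le continuous_on_inner continuous_on_id continuous_on_const
          continuous_on_matmul continuous_on_det)+
    moreover have "S = E \<inter> {g. ?q g \<le> ?n} \<inter> {g. 0 \<le> det g}" by (auto simp: S_def)
    ultimately show ?thesis by (simp add: closed_Int closed_subspace E)
  qed
  ultimately have "compact S" by (simp add: compact_eq_bounded_closed)
  moreover have "S \<noteq> {}" using sc_S[OF g0] by auto
  moreover have "continuous_on S det"
    by (intro continuous_on_det continuous_on_id)
  ultimately have "\<exists>h\<in>S. \<forall>g\<in>S. det g \<le> det h"
    by (rule continuous_attains_sup)
  then obtain h where h: "h \<in> S" "\<And>g. g \<in> S \<Longrightarrow> det g \<le> det h"
    by blast
  have hE: "h \<in> E" and qh: "?q h \<le> ?n" using h(1) by (auto simp: S_def)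
  have det_sc_pos: "det (sc g) > 0" if "det g > 0" for g
    using that q_pos[OF that] by (simp add: det_sc)
  have hpos: "det h > 0"
    using h(2)[OF sc_S[OF g0]] det_sc_pos[OF g0(2)] by simp
  have ineq: "?n ^ CARD('n) * (det g)^2 \<le> (det h)^2 * (?q g) ^ CARD('n)"
    if g: "g \<in> E" "det g > 0" for g
  proof -
    have "(det (sc g))^2 \<le> (det h)^2"
      using h(2)[OF sc_S[OF g]] det_sc_pos[OF g(2)] by (intro power_mono) auto
    also have "(det (sc g))^2 = (?n / ?q g) ^ CARD('n) * (det g)^2"
    proof -
      have "(sqrt (?n / ?q g) ^ CARD('n))^2 = (?n / ?q g) ^ CARD('n)"
        unfolding power_mult[symmetric] mult.commute[of _ 2]
        using q_pos[OF g(2)] by (simp add: power_mult del: real_sqrt_divide)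
      then show ?thesis by (simp add: det_sc power_mult_distrib)
    qed
    finally have "?n ^ CARD('n) / (?q g) ^ CARD('n) * (det g)^2 \<le> (det h)^2"
      by (simp add: power_divide)
    moreover have "(?q g) ^ CARD('n) > 0" using q_pos[OF g(2)] by simp
    ultimately show ?thesis
      by (simp add: pos_divide_le_eq)
  qed
  \<comment> \<open>Taking \<open>h\<close> as its own competitor pushes the form up to its
    bound.\<close>
  have "?n ^ CARD('n) \<le> (?q h) ^ CARD('n)"
    using ineq[OF hE hpos] hpos by (simp add: mult.commute[of "?n ^ _"])
  then have "?n \<le> ?q h"
    using q_pos[OF hpos] by (simp add: power_mono_iff)
  then show ?thesis
    using that[of h] hE hpos qh ineq by (simp add: max_frame_def)
qed

lemma max_frame_critical:
  fixes M :: "real^'n^'n"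
  assumes M: "pos_def M" and E: "subspace E" and h: "max_frame M E h" and x: "h ** x \<in> E"
  shows "h \<bullet> (M ** (h ** x)) = trace x"
proof -
  let ?n = "real CARD('n)"
  let ?q = "\<lambda>g :: real^'n^'n. g \<bullet> (M ** g)"
  define k where "k = CARD('n)"
  have k: "k > 0" by (simp add: k_def)
  define b where "b = h \<bullet> (M ** (h ** x))"
  define c where "c = ?q (h ** x)"
  have hp: "det h > 0" "h \<in> E" "?q h = ?n" using h by (auto simp: max_frame_def)
  have "(h ** x) \<bullet> (M ** h) = b"
    using inner_mul_left[of M "h ** x" h] pos_def_symmetric[OF M]
    by (simp add: b_def inner_commute)
  then have q: "?q (h ** (mat 1 + e *\<^sub>R x)) = ?n + e * (2 * b) + e^2 * c" for e
    by (simp add: matmul_distribs inner_add_left inner_add_right hp c_def b_def[symmetric]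
      algebra_simps power2_eq_square)
  define f where "f e = (?n + e * (2 * b) + e^2 * c) ^ k - ?n ^ k * (det (mat 1 + e *\<^sub>R x))^2" for e
  have "isCont (\<lambda>e. det (mat 1 + e *\<^sub>R x)) 0"
    using has_derivative_det_at_mat_1 by (rule DERIV_isCont)
  then have "\<forall>\<^sub>F e in at 0. det (mat 1 + e *\<^sub>R x) > 0"
    unfolding isCont_def by (rule order_tendstoD) simp
  then obtain d where d: "d > 0" "\<And>e. e \<noteq> 0 \<Longrightarrow> \<bar>e\<bar> < d \<Longrightarrow> det (mat 1 + e *\<^sub>R x) > 0"
    unfolding eventually_at by (auto simp: dist_real_def)
  have "f 0 \<le> f e" if "\<bar>0 - e\<bar> < d" for e
  proof -
    have D: "det (mat 1 + e *\<^sub>R x) > 0" using d(2)[of e] that by (cases "e = 0") auto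
    have "h ** (mat 1 + e *\<^sub>R x) \<in> E"
      using hp(2) x E by (simp add: matmul_distribs subspace_add subspace_scale)
    moreover have "det (h ** (mat 1 + e *\<^sub>R x)) > 0" using D hp by (simp add: det_mul)
    ultimately have "?n ^ k * (det (h ** (mat 1 + e *\<^sub>R x)))^2
        \<le> (det h)^2 * (?q (h ** (mat 1 + e *\<^sub>R x)))^k"
      using h by (auto simp: max_frame_def k_def)
    then have "(det h)^2 * (?n ^ k * (det (mat 1 + e *\<^sub>R x))^2)
        \<le> (det h)^2 * (?n + e * (2 * b) + e^2 * c)^k"
      unfolding q by (simp add: det_mul power_mult_distrib algebra_simps)
    then have "f e \<ge> 0" using hp(1) by (simp add: f_def)
    moreover have "f 0 = 0" by (simp add: f_def)
    ultimately show ?thesis by simp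
  qed
  moreover have "(f has_field_derivative
      (real k * ?n ^ (k - 1) * (2 * b) - ?n ^ k * (2 * trace x))) (at 0)"
    unfolding f_def
    by (auto intro!: derivative_eq_intros has_derivative_det_at_mat_1)
  ultimately have "real k * ?n ^ (k - 1) * (2 * b) - ?n ^ k * (2 * trace x) = 0"
    using DERIV_local_min d(1) by blast
  \<comment> \<open>Here the choice of \<open>CARD('n)\<close> as the value of the form matters: the
    two coefficients coincide and the Lagrange multiplier becomes 1.\<close>
  moreover have "real k * ?n ^ (k - 1) = ?n ^ k"
    using k by (simp add: k_def power_eq_if)
  ultimately have "?n ^ k * (2 * b) = ?n ^ k * (2 * trace x)" by (metis eq_iff_diff_eq_0)
  then show ?thesis by (simp add: b_def)
qed

section \<open>Square roots of positive definite matrices\<close>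

text \<open>Maximize the determinant over \<open>A\<close> for the form of \<open>M = p^-1\<close>.
  Stationarity says that \<open>c^T M c - 1\<close> is orthogonal to \<open>A\<close>; closure of
  \<open>A\<close> under products, transposes and inverses puts this matrix in \<open>A\<close> as
  well, so it vanishes, and \<open>c^T p^-1 c = 1\<close> means \<open>c c^T = p\<close>.\<close>

lemma pos_def_factor:
  fixes p :: "real^'n^'n"
  assumes p: "pos_def p" "p \<in> A"
    and A: "subspace A" "mat 1 \<in> A" "\<And>x y. x \<in> A \<Longrightarrow> y \<in> A \<Longrightarrow> x ** y \<in> A"
      "\<And>x. x \<in> A \<Longrightarrow> transpose x \<in> A" "\<And>x. x \<in> A \<Longrightarrow> det x \<noteq> 0 \<Longrightarrow> matrix_inv x \<in> A"
  obtains c where "c \<in> A" "det c > 0" "c ** transpose c = p"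
proof -
  note nz = pos_def_det_nz[OF p(1)]
  define M where "M = matrix_inv p"
  have M: "pos_def M" "M \<in> A" using p A(5) nz by (simp_all add: M_def pos_def_matrix_inv)
  obtain c where c: "max_frame M A c"
    using max_frame_exists[OF M(1) A(1,2)] by auto
  have cA: "c \<in> A" and dc: "det c > 0" using c by (auto simp: max_frame_def)
  let ?W = "transpose c ** (M ** c)"
  have "?W - mat 1 \<in> A" by (intro subspace_diff A cA M)
  moreover have "(?W - mat 1) \<bullet> x = 0" if x: "x \<in> A" for x
  proof -
    have "c \<bullet> (M ** (c ** x)) = trace x"
      by (intro max_frame_critical[OF M(1) A(1) c] A(3) cA x)
    moreover have "c \<bullet> (M ** (c ** x)) = ?W \<bullet> x"
      using inner_mul_left[of "M ** c" x c] pos_def_symmetric[OF M(1)]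
      by (simp add: inner_commute matrix_transpose_mul matrix_mul_assoc)
    ultimately show ?thesis by (simp add: inner_mat_1 inner_diff_left)
  qed
  ultimately have "(?W - mat 1) \<bullet> (?W - mat 1) = 0" by blast
  then have 1: "?W = mat 1" by simp
  have dt: "det (transpose c) \<noteq> 0" using dc by simp
  have "M ** c = matrix_inv (transpose c)"
    using matrix_inv_unique[OF 1] by simp
  then have "p ** (M ** c) ** transpose c = p"
    using dt by (simp add: matrix_mul_assoc[symmetric] matrix_inv_left)
  then have "c ** transpose c = p"
    using nz by (simp add: M_def)
  with cA dc show thesis by (rule that)
qed

section \<open>Existence, uniqueness and continuity of the positive square root\<close>

definition reflection :: "real^'n \<Rightarrow> real^'n^'n" where
  "reflection u = mat 1 - 2 *\<^sub>R (\<chi> i j. u $ i * u $ j)"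

lemma reflection_mult_vec: "reflection u *v x = x - (2 * (u \<bullet> x)) *\<^sub>R u"
proof -
  have "(\<chi> i j. u $ i * u $ j) *v x = (u \<bullet> x) *\<^sub>R u"
    by (simp add: vec_eq_iff matrix_vector_mult_def inner_vec_def sum_distrib_left sum_distrib_right mult_ac)
  then show ?thesis
    by (simp add: reflection_def matrix_vector_mult_diff_rdistrib scaleR_matrix_vector_assoc[symmetric])
qed

lemma orthogonal_reflection:
  assumes "u \<bullet> u = 1" shows "orthogonal_matrix (reflection u)"
proof -
  have tr: "transpose (reflection u) = reflection u"
    by (simp add: reflection_def transpose_def mat_def vec_eq_iff mult.commute)
  have "(reflection u ** reflection u) *v x = mat 1 *v x" for x
    unfolding matrix_vector_mul_assoc[symmetric]
    by (simp add: reflection_mult_vec inner_diff_right assms scaleR_left_distrib[symmetric])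
  then have "reflection u ** reflection u = mat 1"
    by (simp add: matrix_eq)
  then show ?thesis by (simp add: orthogonal_matrix tr)
qed

lemma trace_mul_outer: "trace (A ** (\<chi> i j. u $ i * w $ j)) = w \<bullet> (A *v (u :: real^'n))"
  unfolding trace_def matrix_matrix_mult_def matrix_vector_mult_def inner_vec_def
  by (simp add: sum_distrib_left mult_ac)

lemma trace_mul_reflection: "trace (A ** reflection u) = trace A - 2 * (u \<bullet> (A *v u))"
  by (simp add: reflection_def matmul_distribs trace_sub trace_scaleR trace_mul_outer)

lemma trace_mul_reflections:
  "trace (A ** reflection u ** reflection w)
    = trace A - 2 * (u \<bullet> (A *v u)) - 2 * (w \<bullet> (A *v w)) + 4 * (u \<bullet> w) * (w \<bullet> (A *v u))"
proof -
  have eq: "A ** reflection u *v w = A *v w - (2 * (u \<bullet> w)) *\<^sub>R (A *v u)"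
    by (simp add: matrix_vector_mul_assoc[symmetric] reflection_mult_vec
        matrix_vector_mult_diff_distrib matrix_vector_mult_scaleR)
  then show ?thesis
    by (simp add: trace_mul_reflection eq inner_diff_right)
qed

lemma linear_coeff_zero:
  fixes a b :: real
  assumes "\<And>e. 0 \<le> a * e + b * e^2"
  shows "a = 0"
proof -
  have "((\<lambda>e. a * e + b * e^2) has_field_derivative a) (at 0)"
    by (auto intro!: derivative_eq_intros)
  then show ?thesis
    using assms by (intro DERIV_local_min[of _ _ 0 1]) auto
qed

text \<open>At a zero \<open>u\<close> of a nonnegative form the first-order term in every direction
  \<open>v\<close> must vanish, so \<open>s u = 0\<close>, against invertibility.\<close>

lemma pos_def_if_nonneg:
  fixes s :: "real^'n^'n"
  assumes sym: "transpose s = s" and nonneg: "\<And>v. v \<bullet> (s *v v) \<ge> 0" and nz: "det s \<noteq> 0"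
  shows "pos_def s"
proof -
  have "u \<bullet> (s *v u) > 0" if "u \<noteq> 0" for u
  proof (rule ccontr)
    assume "\<not> ?thesis"
    then have 0: "u \<bullet> (s *v u) = 0" using nonneg[of u] by simp
    have sym': "u \<bullet> (s *v v) = v \<bullet> (s *v u)" for v
      by (metis inner_matrix_vector_transpose sym inner_commute)
    have "v \<bullet> (s *v u) = 0" for v
    proof -
      have "0 \<le> (2 * (v \<bullet> (s *v u))) * e + (v \<bullet> (s *v v)) * e^2" for e
        using nonneg[of "u + e *\<^sub>R v"] sym'[of v]
        by (simp add: 0 inner_add_left inner_add_right matrix_vector_right_distrib
          matrix_vector_mult_scaleR algebra_simps power2_eq_square)
      from linear_coeff_zero[OF this] show ?thesis by simp
    qed
    then have "s *v u = 0" by (metis inner_eq_zero_iff)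
    then have "matrix_inv s *v (s *v u) = 0" by simp
    then show False
      using that nz by (simp add: matrix_vector_mul_assoc matrix_inv_left)
  qed
  with sym show ?thesis by (simp add: pos_def_def)
qed

text \<open>Maximality against one reflection gives nonnegativity, against products of two gives
  symmetry.\<close>

lemma pos_def_if_trace_max:
  fixes s :: "real^'n^'n"
  assumes max: "\<And>k. orthogonal_matrix k \<Longrightarrow> trace (s ** k) \<le> trace s" and nz: "det s \<noteq> 0"
  shows "pos_def s"
proof -
  have unit: "u \<bullet> (s *v u) \<ge> 0" if "u \<bullet> u = 1" for u
    using max[OF orthogonal_reflection[OF that]] by (simp add: trace_mul_reflection)
  have unit2: "2 * (u \<bullet> w) * (w \<bullet> (s *v u)) \<le> u \<bullet> (s *v u) + w \<bullet> (s *v w)"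
    if "u \<bullet> u = 1" "w \<bullet> w = 1" for u w
  proof -
    have "orthogonal_matrix (reflection u ** reflection w)"
      by (intro orthogonal_matrix_mul orthogonal_reflection that)
    from max[OF this] show ?thesis
      by (simp add: matrix_mul_assoc trace_mul_reflections)
  qed
  have normalize: "\<exists>w. x = norm x *\<^sub>R w \<and> w \<bullet> w = 1" if "x \<noteq> 0" for x :: "real^'n"
    using that by (intro exI[of _ "x /\<^sub>R norm x"]) (simp add: dot_square_norm power2_eq_square divide_inverse)
  have nonneg: "x \<bullet> (s *v x) \<ge> 0" for x
  proof (cases "x = 0")
    case False
    then obtain w where w: "x = norm x *\<^sub>R w" "w \<bullet> w = 1" using normalize by blast
    have "x \<bullet> (s *v x) = (norm x)^2 * (w \<bullet> (s *v w))"
      by (subst (1 2) w(1)) (simp add: matrix_vector_mult_scaleR power2_eq_square)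
    then show ?thesis using unit[OF w(2)] by simp
  qed auto
  have two: "2 * (u \<bullet> x) * (x \<bullet> (s *v u)) \<le> (x \<bullet> x) * (u \<bullet> (s *v u)) + x \<bullet> (s *v x)"
    if u: "u \<bullet> u = 1" for u x
  proof (cases "x = 0")
    case False
    then obtain w where w: "x = norm x *\<^sub>R w" "w \<bullet> w = 1" using normalize by blast
    have *: "2 * (u \<bullet> x) * (x \<bullet> (s *v u)) = (norm x)^2 * (2 * (u \<bullet> w) * (w \<bullet> (s *v u)))"
      "x \<bullet> (s *v x) = (norm x)^2 * (w \<bullet> (s *v w))"
      by (subst (1 2) w(1), simp add: matrix_vector_mult_scaleR power2_eq_square)+
    have "(norm x)^2 * (2 * (u \<bullet> w) * (w \<bullet> (s *v u))) \<le> (norm x)^2 * (u \<bullet> (s *v u) + w \<bullet> (s *v w))"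
      using unit2[OF u w(2)] by (intro mult_left_mono) auto
    then show ?thesis unfolding * by (simp add: dot_square_norm distrib_left)
  qed auto
  have sym_unit: "v \<bullet> (s *v u) = u \<bullet> (s *v v)" if u: "u \<bullet> u = 1" for u v
  proof -
    let ?a = "u \<bullet> (s *v v) - v \<bullet> (s *v u)"
    \<comment> \<open>At \<open>e = 0\<close> both sides of \<open>two\<close> equal
      \<open>2 (u \<bullet> s u)\<close>, so the first-order term of their difference must vanish;
      this term is the antisymmetric part \<open>?a\<close>.\<close>
    have "0 \<le> ?a * e + ((v \<bullet> v) * (u \<bullet> (s *v u)) + v \<bullet> (s *v v) - 2 * (u \<bullet> v) * (v \<bullet> (s *v u))) * e^2" for e
      using two[OF u, of "u + e *\<^sub>R v"]
      by (simp add: u inner_add_left inner_add_right matrix_vector_right_distrib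
          matrix_vector_mult_scaleR inner_commute[of v u] algebra_simps power2_eq_square)
    then have "?a = 0" by (rule linear_coeff_zero)
    then show ?thesis by simp
  qed
  have sym: "v \<bullet> (s *v u) = u \<bullet> (s *v v)" for u v
  proof (cases "u = 0")
    case False
    then obtain w where w: "u = norm u *\<^sub>R w" "w \<bullet> w = 1" using normalize by blast
    show ?thesis
      by (subst (1 2) w(1)) (simp add: matrix_vector_mult_scaleR sym_unit[OF w(2)])
  qed auto
  have "transpose s = s"
  proof -

    have "s $ i $ j = s $ j $ i" for i j
      using sym[of "axis i 1" "axis j 1"]
      by (simp add: inner_axis' matrix_vector_mul_component inner_axis)
    then show ?thesis by (simp add: transpose_def vec_eq_iff)
  qed
  then show ?thesis using nonneg nz by (rule pos_def_if_nonneg)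
qed

text \<open>The solutions of \<open>s s^T = p\<close> form a nonempty compact set stable under
  orthogonal right factors. One of maximal trace is therefore positive definite by
  \<open>pos_def_if_trace_max\<close>, in particular symmetric, and so a square root.\<close>

lemma pos_def_sqrt_exists:
  fixes p :: "real^'n^'n"
  assumes p: "pos_def p"
  shows "\<exists>s. pos_def s \<and> s ** s = p"
proof -
  define T where "T = {s :: real^'n^'n. s ** transpose s = p}"
  have "T \<noteq> {}" using pos_def_factor[OF p UNIV_I subspace_UNIV] by (auto simp: T_def)
  moreover have "compact T"
  proof -
    have "norm s \<le> sqrt (trace p)" if "s \<in> T" for s
    proof -
      have "s \<bullet> s = trace p"
        using that trace_mul_sym[of s "transpose s"] by (simp add: T_def inner_eq_trace)
      then show ?thesis by (simp add: norm_eq_sqrt_inner)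
    qed
    then have "bounded T" by (rule boundedI)
    moreover have "closed T"
      unfolding T_def
      by (intro closed_Collect_eq continuous_on_const continuous_on_matmul
          continuous_on_transpose continuous_on_id)
    ultimately show ?thesis by (simp add: compact_eq_bounded_closed)
  qed
  moreover have "continuous_on T trace"
    unfolding trace_def by (intro continuous_intros)
  ultimately have "\<exists>s\<in>T. \<forall>t\<in>T. trace t \<le> trace s"
    using continuous_attains_sup by metis
  then obtain s where s: "s \<in> T" "\<And>t. t \<in> T \<Longrightarrow> trace t \<le> trace s" by blast
  have "det s \<noteq> 0"
    using s(1) pos_def_det_nz[OF p] by (auto simp: T_def det_mul)
  moreover have "trace (s ** k) \<le> trace s" if "orthogonal_matrix k" for k
  proof (rule s(2))
    have "s ** k ** transpose (s ** k) = s ** (k ** transpose k) ** transpose s"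
      by (simp add: matrix_transpose_mul matrix_mul_assoc)
    then show "s ** k \<in> T"
      using s(1) that by (simp add: T_def orthogonal_matrix_def)
  qed
  ultimately have "pos_def s" by (intro pos_def_if_trace_max)
  then show ?thesis using s(1) by (auto simp: T_def pos_def_symmetric)
qed

text \<open>With \<open>d = s - t\<close> one has \<open>s d + d t = s s - t t = 0\<close>. Pairing
  with \<open>d\<close> gives a positive and a nonnegative term, whose sum cannot vanish.\<close>

lemma pos_def_sqrt_unique:
  assumes s: "pos_def s" and t: "pos_def t" and eq: "s ** s = t ** t"
  shows "s = (t :: real^'n^'n)"
proof (rule ccontr)
  define d where "d = s - t"
  assume "s \<noteq> t"
  then have "d \<noteq> 0" by (simp add: d_def)
  then have "d \<bullet> (s ** d) > 0" by (rule pos_def_inner_pos[OF s])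
  moreover have "d \<bullet> (d ** t) \<ge> 0"
    using pos_def_inner_nonneg[OF t, of "transpose d"] inner_transpose[of d "d ** t"]
    by (simp add: matrix_transpose_mul pos_def_symmetric[OF t])
  moreover have "s ** d + d ** t = 0"
    using eq by (simp add: d_def matmul_distribs)
  then have "d \<bullet> (s ** d) + d \<bullet> (d ** t) = 0"
    by (simp add: inner_add_right[symmetric])
  ultimately show False by simp
qed

definition msqrt :: "real^'n^'n \<Rightarrow> real^'n^'n" where
  "msqrt p = (THE s. pos_def s \<and> s ** s = p)"

lemma msqrt_unique: "pos_def s \<Longrightarrow> msqrt (s ** s) = s"
  unfolding msqrt_def by (rule the_equality) (auto intro: pos_def_sqrt_unique)

lemma pos_def_msqrt: "pos_def (msqrt p)" (is ?A)
  and msqrt_mul_msqrt: "msqrt p ** msqrt p = p" (is ?B)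
  if p: "pos_def p" for p :: "real^'n^'n"
proof -
  obtain s where "pos_def s" "p = s ** s" using pos_def_sqrt_exists[OF p] by auto
  then show ?A ?B by (simp_all add: msqrt_unique)
qed

lemma msqrt_mat_1: "msqrt (mat 1) = mat 1"
  using msqrt_unique[OF pos_def_mat_1] by simp

text \<open>The roots stay bounded because the squared norm of \<open>msqrt q\<close> is the trace
  of \<open>q\<close>. A limit point is symmetric, nonnegative, and a square root of the invertible
  \<open>p\<close>, hence it is \<open>msqrt p\<close>.\<close>

lemma continuous_on_msqrt: "continuous_on {p. pos_def p} (msqrt :: real^'n^'n \<Rightarrow> _)"
  unfolding continuous_on_sequentially
proof (intro ballI allI impI)
  fix p :: "real^'n^'n" and P :: "nat \<Rightarrow> real^'n^'n"
  assume p: "p \<in> {p. pos_def p}" and "(\<forall>n. P n \<in> {p. pos_def p}) \<and> P \<longlonglongrightarrow> p"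
  then have P: "\<And>n. pos_def (P n)" and lim: "P \<longlonglongrightarrow> p" and pd: "pos_def p" by auto
  have "(msqrt \<circ> P) \<longlonglongrightarrow> msqrt p"
  proof (rule tendsto_from_subsequences)
    have norm: "norm (msqrt q) = sqrt (trace q)" if "pos_def q" for q :: "real^'n^'n"
      by (simp add: norm_eq_sqrt_inner inner_eq_trace that
          pos_def_symmetric[OF pos_def_msqrt] msqrt_mul_msqrt)
    have "bounded (range P)"
      using lim by (rule convergent_imp_bounded)
    then obtain b where b: "\<And>n. norm (P n) \<le> b" by (auto simp: bounded_iff)
    have "norm ((msqrt \<circ> P) n) \<le> sqrt (norm (mat 1 :: real^'n^'n) * b)" for n
    proof -
      have "trace (P n) \<le> norm (mat 1 :: real^'n^'n) * norm (P n)"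
        using norm_cauchy_schwarz[of "mat 1" "P n"] by (simp add: inner_mat_1)
      also have "\<dots> \<le> norm (mat 1 :: real^'n^'n) * b"
        by (intro mult_left_mono b) auto
      finally show ?thesis by (simp add: norm P)
    qed
    then show "bounded (range (msqrt \<circ> P))" by (intro boundedI) auto
  next
    fix r :: "nat \<Rightarrow> nat" and s assume r: "strict_mono r" and s: "((msqrt \<circ> P) \<circ> r) \<longlonglongrightarrow> s"
    let ?f = "\<lambda>n. msqrt (P (r n))"
    have s: "?f \<longlonglongrightarrow> s" using s by (simp add: o_def)
    have lim_r: "(\<lambda>n. P (r n)) \<longlonglongrightarrow> p"
      using LIMSEQ_subseq_LIMSEQ[OF lim r] by (simp add: o_def)
    have "(\<lambda>n. ?f n ** ?f n) \<longlonglongrightarrow> s ** s"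
      by (intro tendsto_matmul s)
    with lim_r have ss: "s ** s = p"
      by (simp add: msqrt_mul_msqrt P) (metis LIMSEQ_unique)
    have "(\<lambda>n. transpose (?f n)) \<longlonglongrightarrow> transpose s"
      by (intro tendsto_transpose s)
    then have st: "transpose s = s"
      using s by (simp add: pos_def_symmetric[OF pos_def_msqrt] P) (metis LIMSEQ_unique)
    have nz: "det s \<noteq> 0"
      using pos_def_det_nz[OF pd] by (auto simp: ss[symmetric] det_mul)
    have nonneg: "v \<bullet> (s *v v) \<ge> 0" for v
    proof (rule LIMSEQ_le_const)
      show "(\<lambda>n. v \<bullet> (?f n *v v)) \<longlonglongrightarrow> v \<bullet> (s *v v)"
        unfolding matrix_vector_mult_def
        by (intro tendsto_inner tendsto_const vec_tendstoI)
           (auto intro!: tendsto_sum tendsto_mult_right tendsto_vec_nth s)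
      show "\<exists>N. \<forall>n\<ge>N. 0 \<le> v \<bullet> (?f n *v v)"
        by (simp add: pos_def_nonneg pos_def_msqrt P)
    qed
    show "s = msqrt p"
      using msqrt_unique[OF pos_def_if_nonneg[OF st nonneg nz]] ss by simp
  qed
  then show "(msqrt \<circ> P) \<longlonglongrightarrow> msqrt p" .
qed

section \<open>Frames of a conjugacy class\<close>

text \<open>Kernels of constant dimension vary continuously. On the orthogonal complement
  \<open>W\<close> of the kernel, \<open>T\<close> is bounded below, and so is \<open>T' k\<close>
  for large \<open>k\<close>. Hence \<open>W\<close> meets the kernel of \<open>T' k\<close>
  trivially, and counting dimensions makes it a complement. The \<open>W\<close>-part of
  \<open>g\<close> has image \<open>T' k g\<close>, which is small, so that part tends to 0.\<close>

lemma kernel_vector_approx: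
  fixes T :: "'a::euclidean_space \<Rightarrow> 'b::euclidean_space" and T' :: "nat \<Rightarrow> 'a \<Rightarrow> 'b"
  assumes T: "linear T" and T': "\<And>k. linear (T' k)"
    and dim: "\<And>k. dim {x. T' k x = 0} = dim {x. T x = 0}"
    and close: "\<And>k x. norm (T' k x - T x) \<le> d k * norm x" and d: "d \<longlonglongrightarrow> 0"
    and g: "T g = 0"
  obtains G where "\<And>k. T' k (G k) = 0" "G \<longlonglongrightarrow> g"
proof -
  define W where "W = {w. \<forall>x\<in>{x. T x = 0}. orthogonal x w}"
  have subW: "subspace W" unfolding W_def by (rule subspace_orthogonal_to_vectors)
  have subT: "subspace {x. T x = 0}" by (rule linear_subspace_kernel[OF T])
  have "w = 0" if "w \<in> W" "T w = 0" for w
    using that by (auto simp: W_def orthogonal_self)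
  then obtain c where c: "c > 0" "\<And>w. w \<in> W \<Longrightarrow> norm (T w) \<ge> c * norm w"
    using injective_imp_isometric[OF closed_subspace[OF subW] subW, of T] T
    by (auto simp: linear_conv_bounded_linear mult.commute)
  have "\<forall>\<^sub>F k in sequentially. d k < c / 2"
    using c(1) by (intro order_tendstoD(2)[OF d]) simp
  then obtain k0 where k0: "\<And>k. k \<ge> k0 \<Longrightarrow> d k < c / 2"
    unfolding eventually_sequentially by blast
  have low: "norm (T' k w) \<ge> c / 2 * norm w" if "k \<ge> k0" "w \<in> W" for k w
  proof -
    have "c * norm w \<le> norm (T w)" by (rule c(2)[OF that(2)])
    also have "\<dots> \<le> norm (T' k w) + norm (T' k w - T w)"
      by (metis norm_minus_commute norm_triangle_sub)
    also have "\<dots> \<le> norm (T' k w) + c / 2 * norm w"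
      using close[of k w] mult_right_mono[OF less_imp_le[OF k0[OF that(1)]], of "norm w"] by simp
    finally show ?thesis by (simp add: algebra_simps)
  qed
  have dimW: "dim W + dim {x. T x = 0} = DIM('a)"
    using dim_subspace_orthogonal_to_vectors[OF subT subspace_UNIV] by (simp add: W_def)
  have split: "\<exists>w\<in>W. T' k (g - w) = 0" if "k \<ge> k0" for k
  proof -
    have sub': "subspace {x. T' k x = 0}" by (rule linear_subspace_kernel[OF T'])
    have "W \<inter> {x. T' k x = 0} \<subseteq> {0}"
    proof
      fix w assume w: "w \<in> W \<inter> {x. T' k x = 0}"
      then have "c / 2 * norm w \<le> 0" using low[OF that, of w] by simp
      then show "w \<in> {0}" using c(1) by (simp add: mult_le_0_iff)
    qed
    then have "dim (W \<inter> {x. T' k x = 0}) = 0"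
      by (simp add: dim_eq_0)
    then have "dim {x + y |x y. x \<in> W \<and> y \<in> {x. T' k x = 0}} = DIM('a)"
      using dim_sums_Int[OF subW sub'] dim[of k] dimW by linarith
    then have "span {x + y |x y. x \<in> W \<and> y \<in> {x. T' k x = 0}} = UNIV"
      by (simp only: dim_eq_full)
    then have "{x + y |x y. x \<in> W \<and> y \<in> {x. T' k x = 0}} = UNIV"
      by (rule trans[OF sym[OF span_eq_iff[THEN iffD2, OF subspace_sums[OF subW sub']]]])
    then obtain x y where "g = x + y" "x \<in> W" "T' k y = 0" by blast
    then show ?thesis by (intro bexI[of _ x]) auto
  qed
  \<comment> \<open>For the finitely many small \<open>k\<close> the value \<open>g\<close> makes
    the approximating vector \<open>g - w k\<close> zero, which lies in every kernel.\<close>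
  define w where "w k = (if k \<ge> k0 then SOME w. w \<in> W \<and> T' k (g - w) = 0 else g)" for k
  have w: "w k \<in> W" "T' k (g - w k) = 0" if "k \<ge> k0" for k
    using split[OF that] someI_ex[of "\<lambda>w. w \<in> W \<and> T' k (g - w) = 0"] that
    by (auto simp: w_def)
  have ker: "T' k (g - w k) = 0" for k
    using w(2)[of k] linear_0[OF T'] by (cases "k \<ge> k0") (auto simp: w_def)
  have "w \<longlonglongrightarrow> 0"
  proof (rule Lim_null_comparison)
    show "\<forall>\<^sub>F k in sequentially. norm (w k) \<le> 2 / c * (d k * norm g)"
      unfolding eventually_sequentially
    proof (intro exI allI impI)
      fix k assume k: "k \<ge> k0"
      have "c / 2 * norm (w k) \<le> norm (T' k (w k))" by (rule low[OF k w(1)[OF k]])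
      also have "T' k (w k) = T' k g - T g"
        using ker[of k] g by (simp add: linear_diff[OF T'])
      also have "norm \<dots> \<le> d k * norm g" by (rule close)
      finally show "norm (w k) \<le> 2 / c * (d k * norm g)"
        using c(1) by (simp add: field_simps)
    qed
    show "(\<lambda>k. 2 / c * (d k * norm g)) \<longlonglongrightarrow> 0"
      using tendsto_mult_right_zero[OF tendsto_mult_left_zero[OF d]] by blast
  qed
  then have "(\<lambda>k. g - w k) \<longlonglongrightarrow> g - 0" by (intro tendsto_diff tendsto_const)
  with ker show thesis by (intro that[of "\<lambda>k. g - w k"]) auto
qed

lemma pos_def_det_pos: "pos_def (p :: real^'n^'n) \<Longrightarrow> det p > 0"
  by (metis det_mul msqrt_mul_msqrt pos_def_det_nz not_real_square_gt_zero mult_eq_0_iff)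

section \<open>Centralizers and spaces of intertwining matrices\<close>

definition centralizer :: "real^'n^'n \<Rightarrow> (real^'n^'n) set" where
  "centralizer N = {x. x ** N = N ** x}"

definition frames :: "real^'n^'n \<Rightarrow> real^'n^'n \<Rightarrow> (real^'n^'n) set" where
  "frames N X = {h. X ** h = h ** N}"

text \<open>Conjugation by matrices of positive determinant: scalars act trivially, so this is the
  orbit under \<open>SL\<^sub>n\<close>.\<close>

definition conj_class :: "real^'n^'n \<Rightarrow> (real^'n^'n) set" where
  "conj_class N = {X. \<exists>g\<in>frames N X. det g > 0}"

definition SO_class :: "real^'n^'n \<Rightarrow> (real^'n^'n) set" where
  "SO_class N = {X. \<exists>k\<in>frames N X. k \<in> SO}"

lemma SO_class_subset: "SO_class N \<subseteq> conj_class N"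
  by (force simp: SO_class_def conj_class_def SO_def)

lemma centralizer_mat_1: "mat 1 \<in> centralizer N"
  by (simp add: centralizer_def)

lemma centralizer_mul: "x \<in> centralizer N \<Longrightarrow> y \<in> centralizer N \<Longrightarrow> x ** y \<in> centralizer N"
  unfolding centralizer_def mem_Collect_eq by (metis matrix_mul_assoc)

lemma centralizer_diff:
  "x \<in> centralizer N \<Longrightarrow> y \<in> centralizer N \<Longrightarrow> x - y \<in> centralizer (N :: real^'n^'n)"
  by (simp add: centralizer_def matmul_distribs)

lemma centralizer_matrix_inv:
  assumes x: "x \<in> centralizer N" and nz: "det x \<noteq> 0"
  shows "matrix_inv x \<in> centralizer (N :: real^'n^'n)"
proof -
  have "matrix_inv x ** (x ** N) ** matrix_inv x = matrix_inv x ** (N ** x) ** matrix_inv x"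
    using x by (simp add: centralizer_def)
  then show ?thesis
    using nz by (simp add: centralizer_def matrix_mul_assoc matrix_inv_left)
qed

lemma frames_mul: "h \<in> frames N X \<Longrightarrow> x \<in> centralizer N \<Longrightarrow> h ** x \<in> frames N X"
  unfolding centralizer_def frames_def mem_Collect_eq by (metis matrix_mul_assoc)

lemma frames_inv_mul:
  assumes h: "h \<in> frames N X" "det h \<noteq> 0" and g: "g \<in> frames N X"
  shows "matrix_inv h ** g \<in> centralizer (N :: real^'n^'n)"
proof -
  have "N ** (matrix_inv h ** g) = matrix_inv h ** (h ** N) ** (matrix_inv h ** g)"
    using h(2) by simp
  also have "\<dots> = matrix_inv h ** X ** (h ** (matrix_inv h ** g))"
    unfolding h(1)[unfolded frames_def mem_Collect_eq, symmetric] by (simp only: matrix_mul_assoc)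
  also have "\<dots> = matrix_inv h ** (X ** g)"
    using h(2) by (simp add: matrix_mul_assoc del: matrix_inv_cancel) (simp add: matrix_mul_assoc[symmetric] matrix_inv_right)
  also have "\<dots> = matrix_inv h ** g ** N"
    using g by (simp add: frames_def matrix_mul_assoc)
  finally show ?thesis by (simp add: centralizer_def)
qed

lemma subspace_frames: "subspace (frames N (X :: real^'n^'n))"
  unfolding subspace_def frames_def by (simp add: matmul_distribs)

lemma frames_eq_image:
  assumes g: "g \<in> frames N X" "det g \<noteq> 0"
  shows "frames N X = (**) g ` centralizer (N :: real^'n^'n)"
proof
  show "frames N X \<subseteq> (**) g ` centralizer N"
  proof
    fix h assume h: "h \<in> frames N X"
    have "h = g ** (matrix_inv g ** h)" using g(2) by simp
    with frames_inv_mul[OF g h] show "h \<in> (**) g ` centralizer N" by blast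
  qed
qed (auto intro: frames_mul g)

text \<open>One invertible frame identifies all frames of \<open>X\<close> with the centralizer of
  \<open>N\<close>. The dimension thus does not depend on \<open>X\<close>, as
  \<open>kernel_vector_approx\<close> requires.\<close>

lemma dim_frames:
  assumes g: "g \<in> frames N X" "det g \<noteq> 0"
  shows "dim (frames N X) = dim (centralizer (N :: real^'n^'n))"
  unfolding frames_eq_image[OF g]
proof (rule dim_image_eq)
  show "linear ((**) g)"
    by (rule bounded_linear.linear[OF bounded_bilinear.bounded_linear_right[OF bounded_bilinear_matrix_mult]])
  show "inj_on ((**) g) (span (centralizer N))"
    using g(2) by (intro inj_on_inverseI[of _ "(**) (matrix_inv g)"]) simp
qed

lemma frames_approx:
  fixes N X :: "real^'n^'n"
  assumes lim: "Y \<longlonglongrightarrow> X" and Y: "\<And>k. Y k \<in> conj_class N" and X: "X \<in> conj_class N"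
    and g: "g \<in> frames N X"
  obtains G where "\<And>k. G k \<in> frames N (Y k)" "G \<longlonglongrightarrow> g"
proof -
  let ?T = "\<lambda>X h. X ** h - h ** N"
  have frames: "frames N Z = {h. ?T Z h = 0}" for Z by (simp add: frames_def)
  have lin: "linear (?T Z)" for Z
    by (simp add: linear_iff matmul_distribs scaleR_diff_right)
  have dim: "dim {h. ?T Z h = 0} = dim (centralizer N)" if Z: "Z \<in> conj_class N" for Z
  proof -
    obtain g where "g \<in> frames N Z" "det g \<noteq> 0" using Z by (auto simp: conj_class_def)
    from dim_frames[OF this] show ?thesis by (simp add: frames)
  qed
  obtain K where K: "\<And>(a :: real^'n^'n) (b :: real^'n^'n). norm (a ** b) \<le> norm a * norm b * K"
    using bounded_bilinear.bounded[OF bounded_bilinear_matrix_mult] by blast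
  have close: "norm (?T (Y k) h - ?T X h) \<le> (norm (Y k - X) * K) * norm h" for k h
    using K[of "Y k - X" h] by (simp add: matmul_distribs mult_ac)
  have d: "(\<lambda>k. norm (Y k - X) * K) \<longlonglongrightarrow> 0"
    using lim by (intro tendsto_mult_left_zero tendsto_norm_zero) (simp add: LIM_zero)
  have g0: "?T X g = 0" using g by (simp add: frames)
  note result = that
  show thesis
  proof (rule kernel_vector_approx[of "?T X" "\<lambda>k. ?T (Y k)", OF lin lin _ close d g0])
    show "dim {h. ?T (Y k) h = 0} = dim {h. ?T X h = 0}" for k
      unfolding dim[OF Y] dim[OF X] ..
    show thesis if "\<And>k. ?T (Y k) (G k) = 0" "G \<longlonglongrightarrow> g" for G
      using that by (intro result[of G]) (simp_all add: frames)
  qed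
qed

section \<open>Retraction of a conjugacy class onto the orbit of the rotation group\<close>

text \<open>\<open>gr\<close> takes the part of degree zero; the degrees occurring in the centralizer of a nilpotent
  matrix are nonnegative, which makes \<open>gr\<close> multiplicative there.\<close>

locale graded_centralizer =
  fixes N :: "real^'n^'n" and gr :: "real^'n^'n \<Rightarrow> real^'n^'n"
  assumes gr_centralizer: "x \<in> centralizer N \<Longrightarrow> gr x \<in> centralizer N"
    and gr_mul: "x \<in> centralizer N \<Longrightarrow> y \<in> centralizer N \<Longrightarrow> gr (x ** y) = gr x ** gr y"
    and gr_diff: "gr (x - y) = gr x - gr y"
    and gr_1: "gr (mat 1) = mat 1"
    and gr_gr: "gr (gr x) = gr x"
    and trace_gr: "trace (gr x) = trace x"
    and transpose_gr: "x \<in> centralizer N \<Longrightarrow> transpose (gr x) \<in> centralizer N"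
begin

text \<open>Stationarity without maximality: rotations satisfy it by direct computation
  (\<open>flow_1_fixed\<close>), and it already determines the metric
  (\<open>critical_unique\<close>).\<close>

definition critical :: "real^'n^'n \<Rightarrow> bool" where
  "critical h \<longleftrightarrow> det h \<noteq> 0 \<and> (\<forall>x\<in>centralizer N. h \<bullet> (h ** x) = trace x)"

lemma gr_inv:
  assumes m: "m \<in> centralizer N" "det m \<noteq> 0"
  shows "gr m ** gr (matrix_inv m) = mat 1" "gr (matrix_inv m) ** gr m = mat 1"
  by (metis gr_mul[OF m(1) centralizer_matrix_inv[OF m]] matrix_inv_right[OF m(2)] gr_1)
     (metis gr_mul[OF centralizer_matrix_inv[OF m] m(1)] matrix_inv_left[OF m(2)] gr_1)

text \<open>Pythagoras for \<open>h m = h a + h n a\<close> with \<open>a = gr m\<close>. Here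
  \<open>1 + n = m a^-1\<close>, so \<open>gr n = 0\<close>. Since the trace sees only degree zero,
  stationarity of \<open>h\<close> at \<open>n a a^T\<close> makes the two summands orthogonal, and
  at \<open>a a^T\<close> it gives \<open>|h a| = |a|\<close>. The total is stationarity of
  \<open>h m\<close> at \<open>x = 1\<close>.\<close>

lemma critical_mul:
  assumes h: "critical h" and hm: "critical (h ** m)" and m: "m \<in> centralizer N" "det m \<noteq> 0"
  defines "n \<equiv> m ** gr (matrix_inv m) - mat 1"
  shows "gr m \<bullet> gr m + (h ** (n ** gr m)) \<bullet> (h ** (n ** gr m)) = CARD('n)"
proof -
  let ?s = "gr m ** transpose (gr m)"
  note inv = centralizer_matrix_inv[OF m]
  have n: "n \<in> centralizer N"
    unfolding n_def by (intro centralizer_diff centralizer_mul gr_centralizer m inv centralizer_mat_1)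
  have s: "?s \<in> centralizer N"
    by (intro centralizer_mul gr_centralizer transpose_gr m)
  have "gr n = 0"
    by (simp add: n_def gr_diff gr_1 gr_mul[OF m(1) gr_centralizer[OF inv]] gr_gr gr_inv[OF m])
  then have "trace (n ** ?s) = 0"
    using gr_mul[OF n s] trace_gr[of "n ** ?s"] matmul_zero(1)
    by (simp add: trace_def)
  then have "h \<bullet> (h ** (n ** ?s)) = 0"
    using h centralizer_mul[OF n s] by (simp add: critical_def)
  then have cross: "(h ** gr m) \<bullet> (h ** (n ** gr m)) = 0"
    using inner_mul_right[of h "gr m" "h ** (n ** gr m)"] by (simp add: matrix_mul_assoc)
  have "h \<bullet> (h ** ?s) = trace ?s"
    using h s by (simp add: critical_def)
  then have main: "(h ** gr m) \<bullet> (h ** gr m) = gr m \<bullet> gr m"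
    using inner_mul_right[of h "gr m" "h ** gr m"] trace_mul_sym[of "gr m" "transpose (gr m)"]
    by (simp add: matrix_mul_assoc inner_eq_trace[of "gr m"])
  have "n ** gr m = m - gr m"
    using gr_inv[OF m] by (simp add: n_def matmul_distribs matrix_mul_assoc[symmetric])
  then have "h ** m = h ** gr m + h ** (n ** gr m)"
    by (simp add: matmul_distribs)
  moreover have "(h ** m) \<bullet> (h ** m) = CARD('n)"
    using hm centralizer_mat_1 by (force simp: critical_def trace_I)
  ultimately show ?thesis
    using cross by (simp add: inner_add_left inner_add_right inner_commute main)
qed

text \<open>Write \<open>h' = h m\<close> with leading part \<open>a = gr m\<close>. By \<open>critical_mul\<close>, applied to \<open>m\<close> and to its inverse, both
  \<open>|a|\<^sup>2\<close> and \<open>|a\<^sup>-\<^sup>1|\<^sup>2\<close> are at most \<open>n\<close>; as the inner product of \<open>a\<close> and \<open>a\<^sup>-\<^sup>T\<close> is \<open>n\<close>, they are equal.\<close>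

lemma critical_unique:
  assumes h: "critical h" "h \<in> frames N X" and h': "critical h'" "h' \<in> frames N X"
  shows "h' ** transpose h' = h ** transpose h"
proof -
  define m where "m = matrix_inv h ** h'"
  have det: "det h \<noteq> 0" "det h' \<noteq> 0" using h h' by (auto simp: critical_def)
  have hm: "h' = h ** m" using det by (simp add: m_def)
  have m: "m \<in> centralizer N" "det m \<noteq> 0"
    using frames_inv_mul[OF h(2) det(1) h'(2)] det by (auto simp: m_def det_mul det_matrix_inv)
  have m': "matrix_inv m \<in> centralizer N" "det (matrix_inv m) \<noteq> 0"
    using centralizer_matrix_inv[OF m] m by (auto simp: det_matrix_inv)
  have h_eq: "h = h' ** matrix_inv m"
    using m by (simp add: hm)
  define a where "a = gr m"
  define b where "b = gr (matrix_inv m)"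
  have ab: "a ** b = mat 1" "b ** a = mat 1"
    using gr_inv[OF m] by (simp_all add: a_def b_def)
  let ?n = "m ** b - mat 1"
  have 1: "a \<bullet> a + (h ** (?n ** a)) \<bullet> (h ** (?n ** a)) = CARD('n)"
    using critical_mul[OF h(1) _ m] h'(1) by (simp add: hm[symmetric] a_def b_def)
  then have aa: "a \<bullet> a \<le> CARD('n)"
    using inner_ge_zero[of "h ** (?n ** a)"] by linarith
  have "critical (h' ** matrix_inv m)" using h(1) by (simp only: h_eq[symmetric])
  from critical_mul[OF h'(1) this m'] have bb: "b \<bullet> b \<le> CARD('n)"
    using inner_ge_zero[of "h' ** ((matrix_inv m ** gr (matrix_inv (matrix_inv m)) - mat 1) ** b)"]
    unfolding b_def by linarith
  have "a \<bullet> transpose b = CARD('n)"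
    using ab by (simp add: inner_eq_trace matrix_transpose_mul[symmetric] transpose_mat trace_I)
  then have "(a - transpose b) \<bullet> (a - transpose b) \<le> 0"
    using aa bb by (simp add: inner_diff_left inner_diff_right inner_transpose inner_commute)
  then have at: "a = transpose b"
    by (metis inner_ge_zero inner_eq_zero_iff eq_iff_diff_eq_0 order_antisym)
  then have orth: "a ** transpose a = mat 1" using ab by simp
  then have "a \<bullet> a = CARD('n)"
    using trace_mul_sym[of a "transpose a"] by (simp add: inner_eq_trace trace_I)
  \<comment> \<open>The orthogonal \<open>a\<close> already exhausts the sum in \<open>1\<close>, so
    the part of positive degree vanishes and \<open>m = a\<close>.\<close>
  with 1 have "h ** (?n ** a) = 0" by simp
  then have "matrix_inv h ** (h ** (?n ** a)) ** b = 0"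
    by (simp add: matmul_zero)
  then have "?n = 0" using det ab by (simp add: matrix_mul_assoc[symmetric])
  then have "m ** b ** a = a" by simp
  then have "m = a" using ab by (simp add: matrix_mul_assoc[symmetric])
  then have "h' ** transpose h' = h ** (a ** transpose a) ** transpose h"
    by (simp add: hm matrix_transpose_mul matrix_mul_assoc)
  then show ?thesis by (simp add: orth)
qed

section \<open>The metric of a matrix in the class and its continuity\<close>

abbreviation max_fr :: "real^'n^'n \<Rightarrow> real^'n^'n \<Rightarrow> bool" where
  "max_fr X h \<equiv> max_frame (mat 1) (frames N X) h"

lemma max_fr_critical: "max_fr X h \<Longrightarrow> critical h"
  unfolding critical_def
  using max_frame_critical[OF pos_def_mat_1 subspace_frames, of N X h] frames_mul[of h N X]
  by (auto simp: max_frame_def)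

text \<open>The choice of \<open>h\<close> does not affect the value, by
  \<open>critical_unique\<close>; the maximal frames themselves are not unique.\<close>

definition metric_of :: "real^'n^'n \<Rightarrow> real^'n^'n" where
  "metric_of X = (let h = SOME h. max_fr X h in h ** transpose h)"

lemma metric_of:
  assumes X: "X \<in> conj_class N"
  obtains h where "max_fr X h" "metric_of X = h ** transpose h"
proof -
  obtain g where "g \<in> frames N X" "det g > 0" using X by (auto simp: conj_class_def)
  then have "\<exists>h. max_fr X h"
    using max_frame_exists[OF pos_def_mat_1 subspace_frames] by metis
  then have "max_fr X (SOME h. max_fr X h)" by (rule someI_ex)
  then show thesis by (rule that) (simp add: metric_of_def Let_def)
qed

lemma metric_of_eq:
  assumes "critical h" "h \<in> frames N X" "X \<in> conj_class N"
  shows "metric_of X = h ** transpose h"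
proof -
  obtain h' where h': "max_fr X h'" "metric_of X = h' ** transpose h'"
    using metric_of[OF assms(3)] by blast
  then show ?thesis
    using critical_unique[OF assms(1,2) max_fr_critical[OF h'(1)]] by (simp add: max_frame_def)
qed

lemma pos_def_metric_of: "X \<in> conj_class N \<Longrightarrow> pos_def (metric_of X)"
  by (metis metric_of max_fr_critical critical_def pos_def_mul_transpose)

text \<open>A competitor \<open>g\<close> for the limit is a limit of competitors for the
  \<open>Y k\<close> by \<open>frames_approx\<close>, so the inequality passes to the limit. Applied
  to any competitor of positive determinant, it also keeps \<open>det h\<close> away from 0.\<close>

lemma max_fr_limit:
  assumes lim: "Y \<longlonglongrightarrow> X" and Y: "\<And>k. Y k \<in> conj_class N" and X: "X \<in> conj_class N"
    and H: "\<And>k. max_fr (Y k) (H k)" and h: "H \<longlonglongrightarrow> h"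
  shows "max_fr X h"
proof -
  let ?n = "real CARD('n)"
  have "(\<lambda>k. Y k ** H k) \<longlonglongrightarrow> X ** h" "(\<lambda>k. H k ** N) \<longlonglongrightarrow> h ** N"
    by (intro tendsto_matmul lim h tendsto_const)+
  moreover have "Y k ** H k = H k ** N" for k
    using H[of k] by (simp add: max_frame_def frames_def)
  ultimately have frame: "h \<in> frames N X"
    by (simp add: frames_def) (metis LIMSEQ_unique)
  have "(\<lambda>k. H k \<bullet> H k) \<longlonglongrightarrow> h \<bullet> h" by (intro tendsto_inner h)
  moreover have "H k \<bullet> H k = ?n" for k using H[of k] by (simp add: max_frame_def)
  ultimately have norm: "h \<bullet> h = ?n" by (simp add: LIMSEQ_const_iff)
  have det_lim: "(\<lambda>k. det (H k)) \<longlonglongrightarrow> det h" by (rule tendsto_det[OF h])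
  have ineq: "?n ^ CARD('n) * (det g)^2 \<le> (det h)^2 * (g \<bullet> g) ^ CARD('n)"
    if g: "g \<in> frames N X" "det g > 0" for g
  proof -
    obtain G where G: "\<And>k. G k \<in> frames N (Y k)" "G \<longlonglongrightarrow> g"
      using frames_approx[OF lim Y X g(1)] by blast
    have det_G: "(\<lambda>k. det (G k)) \<longlonglongrightarrow> det g" by (rule tendsto_det[OF G(2)])
    have "\<forall>\<^sub>F k in sequentially. det (G k) > 0"
      by (rule order_tendstoD(1)[OF det_G g(2)])
    then have "\<forall>\<^sub>F k in sequentially.
        ?n ^ CARD('n) * (det (G k))^2 \<le> (det (H k))^2 * (G k \<bullet> G k) ^ CARD('n)"
      by eventually_elim (use H G(1) in \<open>auto simp: max_frame_def\<close>)
    moreover have "(\<lambda>k. ?n ^ CARD('n) * (det (G k))^2) \<longlonglongrightarrow> ?n ^ CARD('n) * (det g)^2"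
      by (intro tendsto_mult tendsto_power tendsto_const det_G)
    moreover have "(\<lambda>k. (det (H k))^2 * (G k \<bullet> G k) ^ CARD('n)) \<longlonglongrightarrow> (det h)^2 * (g \<bullet> g) ^ CARD('n)"
      by (intro tendsto_mult tendsto_power tendsto_inner det_lim G(2))
    ultimately show ?thesis
      by (intro tendsto_le[OF sequentially_bot])
  qed
  obtain g where g: "g \<in> frames N X" "det g > 0" using X by (auto simp: conj_class_def)
  have "?n ^ CARD('n) * (det g)^2 > 0" using g(2) by simp
  then have "det h \<noteq> 0" using ineq[OF g] by auto
  moreover have "det h \<ge> 0"
    by (rule LIMSEQ_le_const[OF det_lim]) (use H in \<open>auto simp: max_frame_def less_imp_le\<close>)
  ultimately show ?thesis
    using frame norm ineq by (simp add: max_frame_def)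
qed

lemma continuous_on_metric_of: "continuous_on (conj_class N) metric_of"
  unfolding continuous_on_sequentially
proof (intro ballI allI impI)
  fix X and Y :: "nat \<Rightarrow> real^'n^'n"
  assume X: "X \<in> conj_class N" and "(\<forall>k. Y k \<in> conj_class N) \<and> Y \<longlonglongrightarrow> X"
  then have Y: "\<And>k. Y k \<in> conj_class N" and lim: "Y \<longlonglongrightarrow> X" by auto
  have "\<forall>k. \<exists>h. max_fr (Y k) h \<and> metric_of (Y k) = h ** transpose h"
  proof
    show "\<exists>h. max_fr (Y k) h \<and> metric_of (Y k) = h ** transpose h" for k
      by (rule metric_of[OF Y[of k]]) blast
  qed
  from choice[OF this] obtain H
    where H: "\<And>k. max_fr (Y k) (H k)" "\<And>k. metric_of (Y k) = H k ** transpose (H k)"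
    by blast
  have normH: "norm (H k) = sqrt CARD('n)" for k
    using H(1)[of k] by (simp add: max_frame_def norm_eq_sqrt_inner)
  have bH: "bounded (range H)"
    by (rule boundedI[of _ "sqrt CARD('n)"]) (auto simp: normH)
  show "(metric_of \<circ> Y) \<longlonglongrightarrow> metric_of X"
  proof (rule tendsto_from_subsequences)
    obtain K where K: "\<And>(a :: real^'n^'n) (b :: real^'n^'n). norm (a ** b) \<le> norm a * norm b * K"
      using bounded_bilinear.bounded[OF bounded_bilinear_matrix_mult] by blast
    have "norm (transpose (H k)) = sqrt CARD('n)" for k
      using normH[of k] by (simp add: norm_eq_sqrt_inner inner_transpose)
    then have "norm (metric_of (Y k)) \<le> sqrt CARD('n) * sqrt CARD('n) * K" for k
      using K[of "H k" "transpose (H k)"] by (simp add: H(2) normH)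
    then show "bounded (range (metric_of \<circ> Y))"
      by (intro boundedI) auto
  next
    fix r :: "nat \<Rightarrow> nat" and l assume r: "strict_mono r" and l: "((metric_of \<circ> Y) \<circ> r) \<longlonglongrightarrow> l"
    have "bounded (range (H \<circ> r))" using bH by (rule bounded_subset) auto
    then obtain h r' where r': "strict_mono (r' :: nat \<Rightarrow> nat)" and h: "((H \<circ> r) \<circ> r') \<longlonglongrightarrow> h"
      using bounded_imp_convergent_subsequence by blast
    let ?r = "\<lambda>k. r (r' k)"
    have h: "(\<lambda>k. H (?r k)) \<longlonglongrightarrow> h" using h by (simp add: o_def)
    have "strict_mono ?r" using strict_mono_o[OF r r'] by (simp add: o_def)
    from LIMSEQ_subseq_LIMSEQ[OF lim this] have "(\<lambda>k. Y (?r k)) \<longlonglongrightarrow> X" by (simp add: o_def)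
    from max_fr_limit[OF this Y X H(1) h] have mh: "max_fr X h" .
    then have eq: "metric_of X = h ** transpose h"
      by (intro metric_of_eq max_fr_critical[OF mh] X) (simp add: max_frame_def)
    have "(\<lambda>k. H (?r k) ** transpose (H (?r k))) \<longlonglongrightarrow> h ** transpose h"
      by (intro tendsto_matmul tendsto_transpose h)
    moreover have "(\<lambda>k. H (?r k) ** transpose (H (?r k))) \<longlonglongrightarrow> l"
      using LIMSEQ_subseq_LIMSEQ[OF l r'] by (simp add: o_def H(2))
    ultimately show "l = metric_of X" unfolding eq by (rule LIMSEQ_unique[rotated])
  qed
qed

section \<open>The deformation retraction\<close>

definition flow :: "real \<Rightarrow> real^'n^'n \<Rightarrow> real^'n^'n" where
  "flow t X = (let s = msqrt ((1 - t) *\<^sub>R mat 1 + t *\<^sub>R metric_of X) in matrix_inv s ** X ** s)"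

lemma flow_pos_def:
  "X \<in> conj_class N \<Longrightarrow> 0 \<le> t \<Longrightarrow> t \<le> 1 \<Longrightarrow> pos_def ((1 - t) *\<^sub>R mat 1 + t *\<^sub>R metric_of X)"
  by (intro pos_def_convex pos_def_mat_1 pos_def_metric_of)

lemma continuous_on_flow:
  "continuous_on ({0..1} \<times> conj_class N) (\<lambda>z. flow (fst z) (snd z))"
proof -
  let ?S = "{0..1} \<times> conj_class N"
  let ?p = "\<lambda>z. (1 - fst z) *\<^sub>R mat 1 + fst z *\<^sub>R metric_of (snd z)"
  have "continuous_on ?S (\<lambda>z. metric_of (snd z))"
    by (rule continuous_on_compose2[OF continuous_on_metric_of continuous_on_snd[OF continuous_on_id]]) auto
  then have "continuous_on ?S ?p" by (intro continuous_intros)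
  then have s: "continuous_on ?S (\<lambda>z. msqrt (?p z))"
    by (rule continuous_on_compose2[OF continuous_on_msqrt]) (auto simp: flow_pos_def)
  then have "continuous_on ?S (\<lambda>z. matrix_inv (msqrt (?p z)))"
    unfolding continuous_on_def
    by (auto intro!: tendsto_matrix_inv pos_def_det_nz pos_def_msqrt flow_pos_def)
  with s show ?thesis
    unfolding flow_def Let_def
    by (intro continuous_on_matmul continuous_on_snd continuous_on_id)
qed

lemma flow_conj_class:
  assumes X: "X \<in> conj_class N" and t: "0 \<le> t" "t \<le> 1"
  shows "flow t X \<in> conj_class N"
proof -
  define s where "s = msqrt ((1 - t) *\<^sub>R mat 1 + t *\<^sub>R metric_of X)"
  have s: "det s > 0"
    unfolding s_def by (intro pos_def_det_pos pos_def_msqrt flow_pos_def X t)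
  obtain g where g: "X ** g = g ** N" "det g > 0"
    using X by (auto simp: conj_class_def frames_def)
  have "matrix_inv s ** X ** s ** (matrix_inv s ** g) = matrix_inv s ** (X ** g)"
    using s by (simp add: matrix_mul_assoc)
  also have "\<dots> = matrix_inv s ** g ** N"
    by (simp add: g(1) matrix_mul_assoc)
  finally have "matrix_inv s ** g \<in> frames N (flow t X)"
    by (simp add: frames_def flow_def s_def Let_def)
  moreover have "det (matrix_inv s ** g) > 0"
    using s g(2) by (simp add: det_mul det_matrix_inv)
  ultimately show ?thesis by (auto simp: conj_class_def)
qed

lemma flow_0: "flow 0 X = X"
  using matrix_inv_unique[of "mat 1 :: real^'n^'n" "mat 1"] by (simp add: flow_def msqrt_mat_1)

text \<open>For \<open>s s = h h^T\<close>, the matrix \<open>k = s^-1 h\<close> is the orthogonal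
  factor in the polar decomposition of \<open>h\<close>, and it is a frame of the conjugated matrix.
  Positivity of both determinants makes it a rotation.\<close>

lemma flow_1_SO_class:
  assumes X: "X \<in> conj_class N" shows "flow 1 X \<in> SO_class N"
proof -
  define s where "s = msqrt (metric_of X)"
  have pd: "pos_def s" unfolding s_def by (intro pos_def_msqrt pos_def_metric_of X)
  have s: "det s > 0" by (rule pos_def_det_pos[OF pd])
  obtain h where h: "max_fr X h" "metric_of X = h ** transpose h" using metric_of[OF X] .
  then have hf: "X ** h = h ** N" "det h > 0" by (auto simp: max_frame_def frames_def)
  have ss: "s ** s = h ** transpose h"
    by (simp add: s_def msqrt_mul_msqrt pos_def_metric_of X flip: h(2))
  define k where "k = matrix_inv s ** h"
  have "k ** transpose k = matrix_inv s ** (h ** transpose h) ** matrix_inv s"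
    using s by (simp add: k_def matrix_transpose_mul matrix_inv_transpose[symmetric]
      pos_def_symmetric[OF pd] matrix_mul_assoc)
  also have "\<dots> = mat 1"
    using s by (simp add: ss[symmetric] matrix_inv_right)
  finally have "orthogonal_matrix k"
    by (simp add: orthogonal_matrix_def matrix_left_right_inverse)
  moreover have "det k > 0" using s hf by (simp add: k_def det_mul det_matrix_inv)
  ultimately have "k \<in> SO" using det_orthogonal_matrix[of k] by (auto simp: SO_def)
  moreover have "matrix_inv s ** X ** s ** k = k ** N"
  proof -
    have "matrix_inv s ** X ** s ** k = matrix_inv s ** (X ** h)"
      using s by (simp add: k_def matrix_mul_assoc)
    then show ?thesis by (simp add: hf(1) k_def matrix_mul_assoc)
  qed
  then have "k \<in> frames N (flow 1 X)"
    by (simp add: frames_def flow_def s_def Let_def)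
  ultimately show ?thesis by (auto simp: SO_class_def)
qed

text \<open>A rotation frame \<open>k\<close> is critical because \<open>k^T k = 1\<close>, so the
  metric at \<open>X\<close> is \<open>k k^T = 1\<close> and nothing is conjugated.\<close>

lemma flow_1_fixed:
  assumes X: "X \<in> SO_class N" shows "flow 1 X = X"
proof -
  obtain k where k: "k \<in> frames N X" "orthogonal_matrix k" "det k = 1"
    using X unfolding SO_class_def SO_def by blast
  have "critical k"
    unfolding critical_def
  proof (intro conjI ballI)
    show "k \<bullet> (k ** x) = trace x" for x
      using inner_mul_left[of k x k] k(2)
      by (simp add: inner_commute[of _ "k ** x"] orthogonal_matrix_def inner_commute[of x] inner_mat_1)
  qed (simp add: k(3))
  then have "metric_of X = mat 1"
    using metric_of_eq[of k X] k X SO_class_subset[of N] by (auto simp: orthogonal_matrix_def)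
  then show ?thesis
    using matrix_inv_unique[of "mat 1 :: real^'n^'n" "mat 1"] by (simp add: flow_def msqrt_mat_1)
qed

theorem conj_class_homotopy_eqv_SO_class: "conj_class N homotopy_eqv SO_class N"
proof (rule deformation_retract_imp_homotopy_eqv)
  show "retraction (conj_class N) (SO_class N) (flow 1)"
    unfolding retraction_def
  proof (intro conjI SO_class_subset ballI)
    have "continuous_on (conj_class N) (\<lambda>X. (1::real, X))"
      by (intro continuous_intros)
    from continuous_on_compose2[OF continuous_on_flow this]
    show "continuous_on (conj_class N) (flow 1)" by force
  qed (auto simp: flow_1_SO_class flow_1_fixed)
  show "homotopic_with_canon (\<lambda>x. True) (conj_class N) (conj_class N) id (flow 1)"
    unfolding homotopic_with_def
    using continuous_on_flow flow_conj_class
    by (intro exI[of _ "\<lambda>z. flow (fst z) (snd z)"])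
       (auto simp: flow_0 prod_topology_subtopology_eu)
qed

end

section \<open>The standard nilpotent matrix and its centralizer\<close>

lemma sum_eq_single:
  fixes f :: "'a::finite \<Rightarrow> 'b::comm_monoid_add"
  assumes "\<And>k. f k \<noteq> 0 \<Longrightarrow> k = p"
  shows "(\<Sum>k\<in>UNIV. f k) = f p"
proof -
  have "(\<Sum>k\<in>UNIV. f k) = (\<Sum>k\<in>{p}. f k)"
    by (rule sum.mono_neutral_right) (use assms in auto)
  then show ?thesis by simp
qed

text \<open>The index with key \<open>(d, l, a)\<close> stands for the basis vector \<open>X\<^sup>l v\<^sup>d\<^sub>a\<close>.\<close>

locale block_structure =
  fixes key :: "'n::finite \<Rightarrow> nat \<times> nat \<times> nat" and Ds :: "nat set" and t :: "nat \<Rightarrow> nat"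
  assumes bij_key: "bij_betw key UNIV {(d, l, a). d \<in> Ds \<and> l < d \<and> a < t d}"
begin

definition kd where "kd i = fst (key i)"
definition kl where "kl i = fst (snd (key i))"
definition ka where "ka i = snd (snd (key i))"

definition ix where "ix d l a = inv_into UNIV key (d, l, a)"

lemma key_valid: "kd i \<in> Ds" "kl i < kd i" "ka i < t (kd i)"
  using bij_betw_apply[OF bij_key UNIV_I, of i]
  by (auto simp: kd_def kl_def ka_def)

lemma key_ix: "d \<in> Ds \<Longrightarrow> l < d \<Longrightarrow> a < t d \<Longrightarrow> key (ix d l a) = (d, l, a)"
  unfolding ix_def by (rule bij_betw_inv_into_right[OF bij_key]) simp

lemma ix_components [simp]:
  "d \<in> Ds \<Longrightarrow> l < d \<Longrightarrow> a < t d \<Longrightarrow> kd (ix d l a) = d"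
  "d \<in> Ds \<Longrightarrow> l < d \<Longrightarrow> a < t d \<Longrightarrow> kl (ix d l a) = l"
  "d \<in> Ds \<Longrightarrow> l < d \<Longrightarrow> a < t d \<Longrightarrow> ka (ix d l a) = a"
  by (simp_all add: kd_def kl_def ka_def key_ix)

lemma key_eqI: "kd i = kd j \<Longrightarrow> kl i = kl j \<Longrightarrow> ka i = ka j \<Longrightarrow> i = j"
  using bij_key unfolding kd_def kl_def ka_def bij_betw_def by (auto intro: injD prod_eqI)

lemma ix_key [simp]: "ix (kd i) (kl i) (ka i) = i"
  using key_valid[of i] by (intro key_eqI) simp_all

text \<open>Via \<open>key\<close>, the coordinate space becomes the direct sum over
  \<open>d\<close> of the tensor products of \<open>R^d\<close> (layers \<open>l\<close>) and
  \<open>R^(t d)\<close> (columns \<open>a\<close>). Then \<open>bcol A\<close> is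
  \<open>1 \<otimes> A d\<close> and \<open>brow G\<close> is \<open>G d \<otimes> 1\<close> on each
  summand; this is why they commute.\<close>

definition bcol :: "(nat \<Rightarrow> nat \<Rightarrow> nat \<Rightarrow> real) \<Rightarrow> real^'n^'n" where
  "bcol A = (\<chi> i j. if kd i = kd j \<and> kl i = kl j then A (kd i) (ka i) (ka j) else 0)"

definition brow :: "(nat \<Rightarrow> nat \<Rightarrow> nat \<Rightarrow> real) \<Rightarrow> real^'n^'n" where
  "brow G = (\<chi> i j. if kd i = kd j \<and> ka i = ka j then G (kd i) (kl i) (kl j) else 0)"

lemma bcol_brow_commute: "bcol A ** brow G = brow G ** bcol A"
proof -
  have "(\<Sum>k\<in>UNIV. bcol A $ i $ k * brow G $ k $ j) = (\<Sum>k\<in>UNIV. brow G $ i $ k * bcol A $ k $ j)" for i j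
  proof (cases "kd i = kd j")
    case True
    then have v: "kd i \<in> Ds" "kl i < kd i" "ka i < t (kd i)" "kl j < kd i" "ka j < t (kd i)"
      using key_valid[of i] key_valid[of j] by auto
    \<comment> \<open>Only one intermediate index contributes to each product: \<open>p\<close> has
      the layer of \<open>i\<close> and the column of \<open>j\<close>, and \<open>q\<close> the
      opposite combination.\<close>
    define p where "p = ix (kd i) (kl i) (ka j)"
    define q where "q = ix (kd i) (kl j) (ka i)"
    have p: "kd p = kd i" "kl p = kl i" "ka p = ka j" and q: "kd q = kd i" "kl q = kl j" "ka q = ka i"
      using v by (simp_all add: p_def q_def)
    have "(\<Sum>k\<in>UNIV. bcol A $ i $ k * brow G $ k $ j) = bcol A $ i $ p * brow G $ p $ j"
      by (rule sum_eq_single, rule key_eqI) (auto simp: bcol_def brow_def p split: if_splits)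
    also have "\<dots> = A (kd i) (ka i) (ka j) * G (kd i) (kl i) (kl j)"
      using True by (simp add: bcol_def brow_def p)
    also have "\<dots> = brow G $ i $ q * bcol A $ q $ j"
      using True by (simp add: bcol_def brow_def q)
    also have "\<dots> = (\<Sum>k\<in>UNIV. brow G $ i $ k * bcol A $ k $ j)"
      by (rule sum_eq_single[symmetric], rule key_eqI)
         (auto simp: bcol_def brow_def q True split: if_splits)
    finally show ?thesis .
  next
    case False
    then show ?thesis
      by (auto simp: bcol_def brow_def intro!: sum.neutral[THEN trans] sum.neutral[symmetric])
  qed
  then show ?thesis by (simp add: matrix_matrix_mult_def vec_eq_iff)
qed

definition Nmat where "Nmat = brow (\<lambda>d l' l. if l' = Suc l then 1 else 0)"

text \<open>The eigenvalue of \<open>H\<close> is \<open>wt i + 1\<close>.\<close>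

definition wt :: "'n \<Rightarrow> int" where "wt i = 2 * int (kl i) - int (kd i)"

definition gr :: "real^'n^'n \<Rightarrow> real^'n^'n" where
  "gr x = (\<chi> i j. if wt i = wt j then x $ i $ j else 0)"

lemma mul_Nmat:
  assumes j: "d \<in> Ds" "Suc l < d" "a < t d"
  shows "(x ** Nmat) $ i $ ix d l a = x $ i $ ix d (Suc l) a"
proof -
  let ?j = "ix d l a" and ?k = "ix d (Suc l) a"
  have "(\<Sum>k\<in>UNIV. x $ i $ k * Nmat $ k $ ?j) = x $ i $ ?k * Nmat $ ?k $ ?j"
    by (rule sum_eq_single, rule key_eqI) (use j in \<open>auto simp: Nmat_def brow_def split: if_splits\<close>)
  then show ?thesis
    using j by (simp add: matrix_matrix_mult_def Nmat_def brow_def)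
qed

lemma mul_Nmat_top:
  assumes j: "d \<in> Ds" "0 < d" "a < t d"
  shows "(x ** Nmat) $ i $ ix d (d - 1) a = 0"
proof -
  have "Nmat $ k $ ix d (d - 1) a = 0" for k
    using key_valid[of k] j by (auto simp: Nmat_def brow_def)
  then show ?thesis by (simp add: matrix_matrix_mult_def)
qed

lemma Nmat_mul:
  assumes i: "d \<in> Ds" "Suc l < d" "a < t d"
  shows "(Nmat ** x) $ ix d (Suc l) a $ j = x $ ix d l a $ j"
proof -
  let ?i = "ix d (Suc l) a" and ?k = "ix d l a"
  have "(\<Sum>k\<in>UNIV. Nmat $ ?i $ k * x $ k $ j) = Nmat $ ?i $ ?k * x $ ?k $ j"
    by (rule sum_eq_single, rule key_eqI) (use i in \<open>auto simp: Nmat_def brow_def split: if_splits\<close>)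
  then show ?thesis
    using i by (simp add: matrix_matrix_mult_def Nmat_def brow_def)
qed

lemma Nmat_mul_bottom:
  assumes i: "d \<in> Ds" "0 < d" "a < t d"
  shows "(Nmat ** x) $ ix d 0 a $ j = 0"
proof -
  have "Nmat $ ix d 0 a $ k = 0" for k
    using i by (auto simp: Nmat_def brow_def)
  then show ?thesis by (simp add: matrix_matrix_mult_def)
qed

context
  fixes x :: "real^'n^'n" assumes x: "x \<in> centralizer Nmat"
begin

text \<open>Right multiplication by \<open>Nmat\<close> shifts columns and left multiplication
  shifts rows, so commuting entries are constant along the diagonals of each block (Toeplitz
  blocks).\<close>

lemma centralizer_shift:
  assumes "d \<in> Ds" "a < t d" "d' \<in> Ds" "a' < t d'" "l + s < d" "l' + s < d'"
  shows "x $ ix d' (l' + s) a' $ ix d (l + s) a = x $ ix d' l' a' $ ix d l a"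
  using assms(5,6)
proof (induction s)
  case (Suc s)
  then have "x $ ix d' (l' + Suc s) a' $ ix d (l + Suc s) a = (x ** Nmat) $ ix d' (l' + Suc s) a' $ ix d (l + s) a"
    using mul_Nmat[of d "l + s" a x] assms by simp
  also have "\<dots> = (Nmat ** x) $ ix d' (Suc (l' + s)) a' $ ix d (l + s) a"
    using x by (simp add: centralizer_def)
  also have "\<dots> = x $ ix d' (l' + s) a' $ ix d (l + s) a"
    using Nmat_mul[of d' "l' + s" a'] Suc.prems assms by simp
  finally show ?case using Suc by simp
qed simp

text \<open>Slide the entry along its diagonal. If the row reaches layer 0 before the column does,
  the entry equals one of \<open>Nmat x\<close> in a bottom row, which is 0. If the column reaches
  its top layer before the row does, it equals one of \<open>x Nmat\<close> in a top column, again
  0.\<close>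

lemma centralizer_entry:
  assumes nz: "x $ i $ j \<noteq> 0"
  shows "kl j \<le> kl i" "kd i - kl i \<le> kd j - kl j"
proof -
  note v = key_valid[of i] key_valid[of j]
  show "kl j \<le> kl i"
  proof (rule ccontr)
    assume "\<not> ?thesis"
    then obtain m where m: "kl j = Suc m + kl i"
      by (metis add.commute add_Suc_right less_imp_Suc_add not_le)
    have "x $ i $ j = x $ ix (kd i) (0 + kl i) (ka i) $ ix (kd j) (Suc m + kl i) (ka j)"
      by (simp only: m[symmetric] add_0 ix_key)
    also have "\<dots> = x $ ix (kd i) 0 (ka i) $ ix (kd j) (Suc m) (ka j)"
      using v m by (intro centralizer_shift) auto
    also have "\<dots> = (x ** Nmat) $ ix (kd i) 0 (ka i) $ ix (kd j) m (ka j)"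
      using v m by (subst mul_Nmat) auto
    also have "\<dots> = (Nmat ** x) $ ix (kd i) 0 (ka i) $ ix (kd j) m (ka j)"
      using x by (simp add: centralizer_def)
    also have "\<dots> = 0" using v by (intro Nmat_mul_bottom) auto
    finally show False using nz by simp
  qed
  show "kd i - kl i \<le> kd j - kl j"
  proof (rule ccontr)
    assume neg: "\<not> ?thesis"
    define s where "s = kd j - 1 - kl j"
    have s: "kl i + s + 1 < kd i" using v neg unfolding s_def by linarith
    have s': "kl j + s = kd j - 1" "kl j + s < kd j"
      using v unfolding s_def by auto
    have "x $ i $ j = x $ ix (kd i) (kl i) (ka i) $ ix (kd j) (kl j) (ka j)" by simp
    also have "\<dots> = x $ ix (kd i) (kl i + s) (ka i) $ ix (kd j) (kl j + s) (ka j)"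
      using v s s' by (intro centralizer_shift[symmetric]) auto
    also have "\<dots> = (Nmat ** x) $ ix (kd i) (Suc (kl i + s)) (ka i) $ ix (kd j) (kd j - 1) (ka j)"
      using v s by (subst Nmat_mul) (auto simp: s'(1))
    also have "\<dots> = (x ** Nmat) $ ix (kd i) (Suc (kl i + s)) (ka i) $ ix (kd j) (kd j - 1) (ka j)"
      using x by (simp add: centralizer_def)
    also have "\<dots> = 0" using v by (intro mul_Nmat_top) auto
    finally show False using nz by simp
  qed
qed

text \<open>The difference \<open>wt i - wt j\<close> is the sum of the two differences that
  \<open>centralizer_entry\<close> shows to be nonnegative; it vanishes only if both do.\<close>

lemma centralizer_wt:
  assumes nz: "x $ i $ j \<noteq> 0"
  shows "wt j \<le> wt i" "wt i = wt j \<Longrightarrow> kd i = kd j \<and> kl i = kl j"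
  using centralizer_entry[OF nz] key_valid[of i] key_valid[of j] unfolding wt_def by linarith+

end

text \<open>In degree zero only entries within one \<open>d\<close> and one layer survive, and
  \<open>centralizer_shift\<close> makes them independent of the layer, so layer 0 determines
  them.\<close>

lemma centralizer_homogeneous:
  assumes x: "x \<in> centralizer Nmat" and hom: "\<And>i j. x $ i $ j \<noteq> 0 \<Longrightarrow> wt i = wt j"
  shows "x = bcol (\<lambda>d a a'. x $ ix d 0 a $ ix d 0 a')"
proof -
  have "x $ i $ j = bcol (\<lambda>d a a'. x $ ix d 0 a $ ix d 0 a') $ i $ j" for i j
  proof (cases "kd i = kd j \<and> kl i = kl j")
    case True
    have "x $ i $ j = x $ ix (kd i) (0 + kl i) (ka i) $ ix (kd j) (0 + kl j) (ka j)" by simp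
    also have "\<dots> = x $ ix (kd i) 0 (ka i) $ ix (kd i) 0 (ka j)"
      using True key_valid[of i] key_valid[of j] centralizer_shift[OF x, of "kd i" "ka j" "kd i" "ka i" 0 "kl i" 0]
      by simp
    finally show ?thesis using True by (simp add: bcol_def)
  next
    case False
    then have "x $ i $ j = 0" using centralizer_wt(2)[OF x] hom by blast
    then show ?thesis using False by (simp add: bcol_def if_not_P)
  qed
  then show ?thesis by (intro vec_eq_iff[THEN iffD2] allI)
qed

lemma bcol_centralizer: "bcol A \<in> centralizer Nmat"
  unfolding centralizer_def Nmat_def by (simp add: bcol_brow_commute)

lemma transpose_bcol: "transpose (bcol A) = bcol (\<lambda>d a a'. A d a' a)"
  by (auto simp: transpose_def bcol_def vec_eq_iff)

lemma gr_bcol: "gr (bcol A) = bcol A"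
  by (auto simp: gr_def bcol_def vec_eq_iff wt_def)

lemma Nmat_wt: "Nmat $ i $ j \<noteq> 0 \<Longrightarrow> wt i = wt j + 2"
  by (auto simp: Nmat_def brow_def wt_def split: if_splits)

text \<open>\<open>Nmat\<close> is homogeneous of degree 2. Commutation therefore holds degree by
  degree, and the part of degree 2 of \<open>x Nmat = Nmat x\<close> is the commutation of
  \<open>gr x\<close>.\<close>

lemma gr_in_centralizer:
  assumes x: "x \<in> centralizer Nmat" shows "gr x \<in> centralizer Nmat"
proof -
  have "(gr x ** Nmat) $ i $ j = (Nmat ** gr x) $ i $ j" for i j
  proof -
    have 1: "gr x $ i $ k * Nmat $ k $ j = (if wt i = wt j + 2 then x $ i $ k * Nmat $ k $ j else 0)" for k
      using Nmat_wt[of k j] by (cases "Nmat $ k $ j = 0") (auto simp: gr_def)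
    have 2: "Nmat $ i $ k * gr x $ k $ j = (if wt i = wt j + 2 then Nmat $ i $ k * x $ k $ j else 0)" for k
      using Nmat_wt[of i k] by (cases "Nmat $ i $ k = 0") (auto simp: gr_def)
    have "(x ** Nmat) $ i $ j = (Nmat ** x) $ i $ j" using x by (simp add: centralizer_def)
    then show ?thesis
      by (cases "wt i = wt j + 2") (simp_all add: matrix_matrix_mult_def 1 2)
  qed
  then have "gr x ** Nmat = Nmat ** gr x" by (intro vec_eq_iff[THEN iffD2] allI)
  then show ?thesis by (simp add: centralizer_def)
qed

lemma gr_eq_bcol:
  assumes x: "x \<in> centralizer Nmat" obtains A where "gr x = bcol A"
proof -
  have "gr x = bcol (\<lambda>d a a'. gr x $ ix d 0 a $ ix d 0 a')"
    by (rule centralizer_homogeneous[OF gr_in_centralizer[OF x]]) (auto simp: gr_def split: if_splits)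
  then show thesis by (rule that)
qed

sublocale graded_centralizer Nmat gr
proof
  fix x y :: "real^'n^'n"
  show "gr x \<in> centralizer Nmat" if "x \<in> centralizer Nmat" using that by (rule gr_in_centralizer)
  show "gr (x ** y) = gr x ** gr y" if x: "x \<in> centralizer Nmat" and y: "y \<in> centralizer Nmat"
  proof -
    have "gr (x ** y) $ i $ j = (gr x ** gr y) $ i $ j" for i j
    proof (cases "wt i = wt j")
      case True
      have "x $ i $ k * y $ k $ j = gr x $ i $ k * gr y $ k $ j" for k
      proof (cases "x $ i $ k = 0 \<or> y $ k $ j = 0")
        case False
        then have "wt k \<le> wt i" "wt j \<le> wt k"
          using centralizer_wt(1)[OF x, of i k] centralizer_wt(1)[OF y, of k j] by simp_all
        then have "wt k = wt i" "wt k = wt j" using True by linarith+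
        then show ?thesis by (simp add: gr_def)
      qed (auto simp: gr_def)
      moreover have "gr (x ** y) $ i $ j = (x ** y) $ i $ j" using True by (simp add: gr_def)
      ultimately show ?thesis by (simp add: matrix_matrix_mult_def)
    next
      case False
      then have "gr x $ i $ k * gr y $ k $ j = 0" for k by (auto simp: gr_def)
      then have "(\<Sum>k\<in>UNIV. gr x $ i $ k * gr y $ k $ j) = 0" by (intro sum.neutral ballI)
      then have "(gr x ** gr y) $ i $ j = 0" by (simp add: matrix_matrix_mult_def)
      moreover have "gr (x ** y) $ i $ j = 0" using False by (simp add: gr_def)
      ultimately show ?thesis by simp
    qed
    then show ?thesis by (intro vec_eq_iff[THEN iffD2] allI)
  qed
  show "gr (x - y) = gr x - gr y" by (simp add: gr_def vec_eq_iff)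
  show "gr (mat 1) = mat 1" by (simp add: gr_def vec_eq_iff mat_def)
  show "gr (gr x) = gr x" by (simp add: gr_def vec_eq_iff)
  show "trace (gr x) = trace x" by (simp add: trace_def gr_def)
  show "transpose (gr x) \<in> centralizer Nmat" if x: "x \<in> centralizer Nmat"
  proof -
    obtain A where "gr x = bcol A" using gr_eq_bcol[OF x] .
    then show ?thesis by (simp add: transpose_bcol bcol_centralizer)
  qed
qed

text \<open>The transpose is the inverse and hence also in the centralizer. Transposition negates
  degrees, while all degrees in the centralizer are nonnegative, so only degree zero
  remains.\<close>

lemma orthogonal_centralizer_bcol:
  assumes k: "k \<in> centralizer Nmat" "orthogonal_matrix k"
  obtains A where "k = bcol A"
proof -
  have "det k \<noteq> 0" using det_orthogonal_matrix[OF k(2)] by auto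
  moreover have "matrix_inv k = transpose k"
    using k(2) by (intro matrix_inv_unique) (simp add: orthogonal_matrix_def)
  ultimately have kt: "transpose k \<in> centralizer Nmat"
    using centralizer_matrix_inv[OF k(1)] by simp
  have "wt i = wt j" if "k $ i $ j \<noteq> 0" for i j
    using centralizer_wt(1)[OF k(1) that] centralizer_wt(1)[OF kt, of j i] that
    by (simp add: transpose_def)
  from centralizer_homogeneous[OF k(1) this] show thesis by (rule that)
qed

text \<open>The algebra of the reductive (Levi) part of the centralizer of \<open>Nmat\<close>.
  Unlike the full centralizer in general, it is closed under transposition, so
  \<open>pos_def_factor\<close> applies to it.\<close>

definition levi :: "(real^'n^'n) set" where "levi = range bcol"

lemma subspace_levi: "subspace levi"
proof -
  have "bcol A + bcol B = bcol (\<lambda>d a b. A d a b + B d a b)" for A B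
    by (simp add: bcol_def vec_eq_iff)
  moreover have "c *\<^sub>R bcol A = bcol (\<lambda>d a b. c * A d a b)" for A c
    by (simp add: bcol_def vec_eq_iff)
  moreover have "0 = bcol (\<lambda>d a b. 0)"
    by (simp add: bcol_def vec_eq_iff)
  ultimately show ?thesis unfolding subspace_def levi_def by auto
qed

lemma levi_iff: "x \<in> levi \<longleftrightarrow> x \<in> centralizer Nmat \<and> gr x = x"
proof
  assume "x \<in> levi"
  then show "x \<in> centralizer Nmat \<and> gr x = x"
    by (auto simp: levi_def bcol_centralizer gr_bcol)
next
  assume x: "x \<in> centralizer Nmat \<and> gr x = x"
  obtain A where "gr x = bcol A" using gr_eq_bcol[of x] x by blast
  then show "x \<in> levi" using x by (auto simp: levi_def)
qed

lemma levi_mat_1: "mat 1 \<in> levi"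
  by (simp add: levi_iff centralizer_mat_1 gr_1)

lemma levi_mul: "x \<in> levi \<Longrightarrow> y \<in> levi \<Longrightarrow> x ** y \<in> levi"
  by (simp add: levi_iff centralizer_mul gr_mul)

lemma levi_transpose: "x \<in> levi \<Longrightarrow> transpose x \<in> levi"
  by (auto simp: levi_def transpose_bcol)

lemma levi_matrix_inv:
  assumes x: "x \<in> levi" "det x \<noteq> 0" shows "matrix_inv x \<in> levi"
proof -
  have c: "x \<in> centralizer Nmat" "gr x = x" using x(1) by (simp_all add: levi_iff)
  have "x ** gr (matrix_inv x) = mat 1"
    using gr_inv(1)[OF c(1) x(2)] c(2) by simp
  then have "matrix_inv x = gr (matrix_inv x)" by (rule matrix_inv_unique)
  then show ?thesis using centralizer_matrix_inv[OF c(1) x(2)] by (simp add: levi_iff)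
qed

lemma levi_brow_commute: "x \<in> levi \<Longrightarrow> x ** brow G = brow G ** x"
  by (auto simp: levi_def bcol_brow_commute)

lemma SO_centralizer_eq_levi: "SO \<inter> centralizer Nmat = SO \<inter> levi"
proof -
  have "k \<in> levi" if k: "k \<in> SO" "k \<in> centralizer Nmat" for k
  proof -
    obtain A where "k = bcol A"
      using orthogonal_centralizer_bcol[OF k(2)] k(1) by (auto simp: SO_def)
    then show ?thesis by (simp add: levi_def)
  qed
  then show ?thesis by (auto simp: levi_iff)
qed

end

section \<open>Orbits of the rotation group as coset spaces\<close>

lemma SO_iff: "k \<in> SO \<longleftrightarrow> k ** transpose k = mat 1 \<and> det (k :: real^'n^'n) = 1"
  by (auto simp: SO_def orthogonal_matrix_def matrix_left_right_inverse)

lemma SO_mul: "k \<in> SO \<Longrightarrow> l \<in> SO \<Longrightarrow> k ** l \<in> (SO :: (real^'n^'n) set)"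
  by (auto simp: SO_def orthogonal_matrix_mul det_mul)

lemma SO_transpose: "k \<in> SO \<Longrightarrow> transpose k \<in> (SO :: (real^'n^'n) set)"
  by (auto simp: SO_def orthogonal_matrix_transpose)

lemma compact_SO: "compact (SO :: (real^'n^'n) set)"
  unfolding compact_eq_bounded_closed
proof
  have "norm k \<le> sqrt CARD('n)" if "k \<in> SO" for k :: "real^'n^'n"
    using that by (simp add: norm_eq_sqrt_inner inner_eq_trace SO_def orthogonal_matrix_def trace_I)
  then show "bounded (SO :: (real^'n^'n) set)" by (rule boundedI)
  have eq: "SO = {k :: real^'n^'n. k ** transpose k = mat 1} \<inter> {k. det k = 1}"
    by (auto simp: SO_iff)
  show "closed (SO :: (real^'n^'n) set)"
    unfolding eq
    by (intro closed_Int closed_Collect_eq continuous_on_const continuous_on_matmul continuous_on_det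
        continuous_on_transpose continuous_on_id)
qed

lemma homeomorphic_space_quotients:
  assumes f: "quotient_map X Y f" and g: "quotient_map X Z g"
    and eq: "\<And>x y. x \<in> topspace X \<Longrightarrow> y \<in> topspace X \<Longrightarrow> f x = f y \<longleftrightarrow> g x = g y"
  shows "Y homeomorphic_space Z"
proof -
  obtain h where h: "continuous_map Y Z h" "\<And>x. x \<in> topspace X \<Longrightarrow> h (f x) = g x"
    using quotient_map_lift_exists[OF f quotient_imp_continuous_map[OF g]] eq by metis
  obtain k where k: "continuous_map Z Y k" "\<And>x. x \<in> topspace X \<Longrightarrow> k (g x) = f x"
    using quotient_map_lift_exists[OF g quotient_imp_continuous_map[OF f]] eq by metis
  have "homeomorphic_maps Y Z h k"
    unfolding homeomorphic_maps_def
  proof (intro conjI ballI h(1) k(1))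
    show "k (h y) = y" if "y \<in> topspace Y" for y
      using that quotient_imp_surjective_map[OF f] h(2) k(2) by force
    show "h (k z) = z" if "z \<in> topspace Z" for z
      using that quotient_imp_surjective_map[OF g] h(2) k(2) by force
  qed
  then show ?thesis by (rule homeomorphic_maps_imp_homeomorphic_space)
qed

lemma l_coset_matrix_group: "g <#\<^bsub>matrix_group G\<^esub> K = (**) g ` K"
  by (auto simp: l_coset_def matrix_group_def)

text \<open>The orbit map goes from a compact space to a Hausdorff one and is therefore a quotient
  map. Its fibres are the cosets of the stabilizer, and two quotients of one space with the same
  fibres are homeomorphic.\<close>

lemma SO_class_homeomorphic_coset_space:
  "top_of_set (SO_class N) homeomorphic_space coset_space SO (SO \<inter> centralizer (N :: real^'n^'n))"
proof -
  let ?S = "SO \<inter> centralizer N"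
  let ?f = "\<lambda>k :: real^'n^'n. k ** N ** transpose k"
  have surj: "?f ` SO = SO_class N"
  proof -
    have "?f k \<in> SO_class N" if "k \<in> SO" for k
    proof -
      have "?f k ** k = k ** N"
        using that by (simp add: matrix_mul_assoc[symmetric] SO_def orthogonal_matrix_def)
      then show ?thesis using that by (auto simp: SO_class_def frames_def)
    qed
    moreover have "X \<in> ?f ` SO" if X: "X \<in> SO_class N" for X
    proof -
      obtain k where k: "k \<in> SO" "X ** k = k ** N"
        using X unfolding SO_class_def frames_def by blast
      have "?f k = X ** (k ** transpose k)" by (simp add: k(2)[symmetric] matrix_mul_assoc)
      then show ?thesis using k(1) by (auto simp: SO_iff)
    qed
    ultimately show ?thesis by blast
  qed
  have "continuous_on SO ?f"
    by (intro continuous_on_matmul continuous_on_transpose continuous_on_id continuous_on_const)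
  then have f: "quotient_map (top_of_set SO) (top_of_set (SO_class N)) ?f"
    using surj
    by (intro continuous_imp_quotient_map)
       (auto simp: compact_space_subtopology compact_SO Hausdorff_space_subtopology)
  have g: "quotient_map (top_of_set SO) (coset_space SO ?S) (\<lambda>g. g <#\<^bsub>matrix_group SO\<^esub> ?S)"
    unfolding coset_space_def by (rule quotient_map_quotient_topology)
  show ?thesis
  proof (rule homeomorphic_space_quotients[OF f g])
    fix k l :: "real^'n^'n" assume "k \<in> topspace (top_of_set SO)" "l \<in> topspace (top_of_set SO)"
    then have kl: "k \<in> SO" "l \<in> SO" by auto
    define m where "m = transpose k ** l"
    have m: "m \<in> SO" using kl by (simp add: m_def SO_mul SO_transpose)
    have l: "l = k ** m" using kl by (simp add: m_def matrix_mul_assoc SO_iff)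
    have cancel: "x = y" if "k ** x = k ** y" for x y :: "real^'n^'n"
    proof -
      have "transpose k ** (k ** x) = transpose k ** (k ** y)" by (simp only: that)
      then show ?thesis using kl by (simp add: matrix_mul_assoc SO_def orthogonal_matrix_def)
    qed
    have "?f k = ?f l \<longleftrightarrow> m \<in> centralizer N"
    proof
      assume "?f k = ?f l"
      then have "?f k ** l = ?f l ** l" by simp
      then have "k ** (N ** m) = k ** (m ** N)"
        using kl by (simp add: matrix_mul_assoc[symmetric] SO_def orthogonal_matrix_def m_def[symmetric])
          (simp add: l matrix_mul_assoc)
      then show "m \<in> centralizer N" using cancel by (auto simp: centralizer_def)
    next
      assume c: "m \<in> centralizer N"
      have "?f l = k ** (m ** N) ** transpose m ** transpose k"
        by (simp add: l matrix_transpose_mul matrix_mul_assoc)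
      also have "\<dots> = k ** N ** (m ** transpose m) ** transpose k"
        using c by (simp add: centralizer_def matrix_mul_assoc)
      finally show "?f k = ?f l" using m by (simp add: SO_iff)
    qed
    also have "m \<in> centralizer N \<longleftrightarrow> (**) k ` ?S = (**) l ` ?S"
    proof
      assume c: "m \<in> centralizer N"
      have "m ** x \<in> ?S" if "x \<in> ?S" for x
        using that m c by (auto intro: SO_mul centralizer_mul)
      moreover have "\<exists>y\<in>?S. x = m ** y" if "x \<in> ?S" for x
      proof
        have "matrix_inv m = transpose m"
          using m by (intro matrix_inv_unique) (simp add: SO_iff)
        then have "transpose m \<in> centralizer N"
          using centralizer_matrix_inv[OF c] m by (simp add: SO_def)
        then show "transpose m ** x \<in> ?S"
          using that m by (auto intro: SO_mul SO_transpose centralizer_mul)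
        show "x = m ** (transpose m ** x)" using m by (simp add: matrix_mul_assoc SO_iff)
      qed
      ultimately have "(**) m ` ?S = ?S" by blast
      moreover have "(**) l ` ?S = (**) k ` ((**) m ` ?S)"
        by (auto simp: l image_image matrix_mul_assoc)
      ultimately show "(**) k ` ?S = (**) l ` ?S" by simp
    next
      assume "(**) k ` ?S = (**) l ` ?S"
      moreover have "mat 1 \<in> ?S" by (auto simp: SO_def centralizer_mat_1 orthogonal_matrix_id)
      then have "l ** mat 1 \<in> (**) l ` ?S" by blast
      ultimately obtain x where "x \<in> ?S" "l = k ** x" by auto
      then show "m \<in> centralizer N" using cancel[of m x] l by auto
    qed
    finally show "?f k = ?f l \<longleftrightarrow> k <#\<^bsub>matrix_group SO\<^esub> ?S = l <#\<^bsub>matrix_group SO\<^esub> ?S"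
      by (simp only: l_coset_matrix_group)
  qed
qed

lemma conj_class_homotopy_equivalent_coset_space:
  assumes "graded_centralizer N gr"
  shows "top_of_set (conj_class N) homotopy_equivalent_space coset_space SO (SO \<inter> centralizer N)"
  using homotopy_eqv_trans[OF graded_centralizer.conj_class_homotopy_eqv_SO_class[OF assms]
    homeomorphic_imp_homotopy_equivalent_space[OF SO_class_homeomorphic_coset_space]] .

section \<open>Compact matrix groups\<close>

lemma pos_def_convex_set: "convex {p. pos_def p}"
  unfolding convex_alt using pos_def_convex by blast

text \<open>The function \<open>p \<mapsto> max\<^sub>k |k p k\<^sup>T|\<close> is strictly convex and \<open>K\<close>-invariant on the convex hull
  of \<open>{k k\<^sup>T}\<close>, so its minimum point is fixed by \<open>K\<close>.\<close>

lemma invariant_metric: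
  fixes K :: "(real^'n^'n) set"
  assumes K: "compact K" "mat 1 \<in> K" "\<And>k l. k \<in> K \<Longrightarrow> l \<in> K \<Longrightarrow> k ** l \<in> K"
    and det: "\<And>k. k \<in> K \<Longrightarrow> det k \<noteq> 0"
    and A: "subspace A" "\<And>k. k \<in> K \<Longrightarrow> k ** transpose k \<in> A"
  obtains p where "p \<in> A" "pos_def p" "\<And>k. k \<in> K \<Longrightarrow> k ** p ** transpose k = p"
proof -
  let ?act = "\<lambda>(k :: real^'n^'n) (p :: real^'n^'n). k ** p ** transpose k"
  define C where "C = convex hull ((\<lambda>k. k ** transpose k) ` K)"
  have "compact ((\<lambda>k. k ** transpose k) ` K)"
    by (intro compact_continuous_image K continuous_on_matmul continuous_on_transpose continuous_on_id)
  then have compC: "compact C" unfolding C_def by (rule compact_convex_hull)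
  have convC: "convex C" by (simp add: C_def)
  have CA: "C \<subseteq> A" unfolding C_def using A by (intro hull_minimal) (auto intro: subspace_imp_convex)
  have Cpos: "C \<subseteq> {p. pos_def p}"
    unfolding C_def by (intro hull_minimal pos_def_convex_set) (use pos_def_mul_transpose det in blast)
  have actC: "?act k p \<in> C" if k: "k \<in> K" and p: "p \<in> C" for k p
  proof -
    have "linear (?act k)"
      by (simp add: linear_iff matmul_distribs)
    then have "?act k ` C = convex hull (?act k ` ((\<lambda>k. k ** transpose k) ` K))"
      unfolding C_def by (rule convex_hull_linear_image)
    also have "\<dots> \<subseteq> C"
      unfolding C_def
    proof (rule hull_mono, clarify)
      fix l assume "l \<in> K"
      then have "?act k (l ** transpose l) = (k ** l) ** transpose (k ** l)" "k ** l \<in> K"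
        using K(3)[OF k] by (simp_all add: matrix_transpose_mul matrix_mul_assoc)
      then show "?act k (l ** transpose l) \<in> (\<lambda>k. k ** transpose k) ` K" by simp
    qed
    finally show ?thesis using p by blast
  qed
  have C1: "mat 1 \<in> C"
    unfolding C_def by (rule hull_inc) (use K(2) in \<open>force simp: transpose_mat\<close>)
  have cont: "continuous_on UNIV (\<lambda>k. norm (?act k p))" for p
    by (intro continuous_on_norm continuous_on_matmul continuous_on_transpose continuous_on_id continuous_on_const)
  have attain: "\<exists>k\<in>K. \<forall>l\<in>K. norm (?act l p) \<le> norm (?act k p)" for p
    using K(1,2) by (intro continuous_attains_sup continuous_on_subset[OF cont]) auto
  obtain k1 where k1: "\<And>l. l \<in> K \<Longrightarrow> norm (?act l (mat 1)) \<le> norm (?act k1 (mat 1))"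
    using attain by blast
  define R where "R = norm (?act k1 (mat 1))"
  \<comment> \<open>\<open>E\<close> is the epigraph of the maximum of \<open>|k p k^T|\<close> over
    \<open>k\<close>, cut off at the height \<open>R\<close> of the identity to make it compact. The
    sought minimum becomes a minimum of the second coordinate.\<close>
  define E where "E = (C \<times> {0..R}) \<inter> (\<Inter>k\<in>K. {z. norm (?act k (fst z)) \<le> snd z})"
  have "closed (\<Inter>k\<in>K. {z. norm (?act k (fst z)) \<le> snd z})"
    by (intro closed_INT ballI closed_Collect_le continuous_on_norm continuous_on_matmul
        continuous_on_const continuous_on_fst continuous_on_snd continuous_on_id)
  then have "compact E"
    unfolding E_def by (intro compact_Int_closed compact_Times compC compact_Icc)
  moreover have "(mat 1, R) \<in> E"
    using k1 C1 by (auto simp: E_def R_def)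
  moreover have "continuous_on E snd" by (intro continuous_on_snd continuous_on_id)
  ultimately have "\<exists>z\<in>E. \<forall>w\<in>E. snd z \<le> snd w"
    by (intro continuous_attains_inf) auto
  then obtain p r where pr: "(p, r) \<in> E" and min: "\<And>q s. (q, s) \<in> E \<Longrightarrow> r \<le> s"
    by force
  have p: "p \<in> C" "r \<le> R" "\<And>k. k \<in> K \<Longrightarrow> norm (?act k p) \<le> r"
    using pr by (auto simp: E_def)
  have "?act k p = p" if k: "k \<in> K" for k
  proof (rule ccontr)
    define q where "q = ?act k p"
    assume "?act k p \<noteq> p"
    then have ne: "p - q \<noteq> 0" by (simp add: q_def)
    have q: "q \<in> C" "\<And>l. l \<in> K \<Longrightarrow> norm (?act l q) \<le> r"
    proof -
      show "q \<in> C" unfolding q_def by (rule actC[OF k p(1)])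
      fix l assume "l \<in> K"
      then have "norm (?act (l ** k) p) \<le> r" by (intro p(3) K(3) k)
      then show "norm (?act l q) \<le> r"
        by (simp add: q_def matrix_transpose_mul matrix_mul_assoc)
    qed
    define m where "m = (1/2) *\<^sub>R p + (1/2) *\<^sub>R q"
    have mC: "m \<in> C" unfolding m_def by (rule convexD[OF convC p(1) q(1)]) auto
    obtain l where l: "l \<in> K" "\<And>l'. l' \<in> K \<Longrightarrow> norm (?act l' m) \<le> norm (?act l m)"
      using attain by blast
    define s where "s = norm (?act l m)"
    let ?u = "?act l p" and ?v = "?act l q"
    have m_eq: "?act l m = (1/2) *\<^sub>R (?u + ?v)"
      by (simp add: m_def matmul_distribs scaleR_add_right)
    have "?u - ?v = ?act l (p - q)" by (simp add: matmul_distribs)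
    moreover have "?act l (p - q) \<noteq> 0"
    proof
      assume 0: "?act l (p - q) = 0"
      have dl: "det l \<noteq> 0" "det (transpose l) \<noteq> 0" using det[OF l(1)] by simp_all
      have "matrix_inv l ** ?act l (p - q) ** matrix_inv (transpose l) = p - q"
        using dl by (simp add: matrix_mul_assoc del: transpose_mat)
          (simp add: matrix_mul_assoc[symmetric] matrix_inv_right)
      then show False using ne
        by (simp add: 0 matmul_zero)
    qed
    ultimately have diff: "(?u - ?v) \<bullet> (?u - ?v) > 0" by simp
    have "?u \<bullet> ?u \<le> r^2" "?v \<bullet> ?v \<le> r^2"
      using p(3)[OF l(1)] q(2)[OF l(1)] by (simp_all add: dot_square_norm power_mono)
    \<comment> \<open>The parallelogram law: the image of the midpoint \<open>m\<close> under
      \<open>l\<close> is half the sum of \<open>?u\<close> and \<open>?v\<close>, and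
      \<open>s\<close> is its norm. Distinct endpoints thus give a strictly lower point of
      \<open>E\<close>.\<close>
    moreover have "4 * s^2 + (?u - ?v) \<bullet> (?u - ?v) = 2 * (?u \<bullet> ?u) + 2 * (?v \<bullet> ?v)"
      unfolding s_def m_eq
      by (simp add: dot_square_norm[symmetric] power_mult_distrib power_divide inner_add_left inner_add_right
          inner_diff_left inner_diff_right inner_commute field_simps)
    ultimately have "s^2 < r^2" using diff by linarith
    moreover have "r \<ge> 0" using p(3)[OF l(1)] norm_ge_zero order_trans by blast
    ultimately have "s < r" by (rule power_less_imp_less_base)
    moreover have "(m, s) \<in> E"
      using mC l \<open>s < r\<close> p(2) by (auto simp: E_def s_def)
    ultimately show False using min by fastforce
  qed
  moreover have "p \<in> A" "pos_def p" using p(1) CA Cpos by auto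
  ultimately show thesis by (intro that)
qed

text \<open>If \<open>c c^T\<close> is the \<open>K\<close>-invariant metric, then
  \<open>u = c^-1 k c\<close> satisfies \<open>u u^T = 1\<close>. Taking \<open>c\<close> from
  \<open>pos_def_factor\<close> keeps the conjugation inside \<open>A\<close>; a scalar factor,
  which does not affect conjugation, normalizes its determinant.\<close>

lemma conjugate_into_orthogonal:
  fixes K :: "(real^'n^'n) set"
  assumes K: "compact K" "mat 1 \<in> K" "\<And>k l. k \<in> K \<Longrightarrow> l \<in> K \<Longrightarrow> k ** l \<in> K" "K \<subseteq> A"
    and det: "\<And>k. k \<in> K \<Longrightarrow> det k \<noteq> 0"
    and A: "subspace A" "mat 1 \<in> A" "\<And>x y. x \<in> A \<Longrightarrow> y \<in> A \<Longrightarrow> x ** y \<in> A"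
      "\<And>x. x \<in> A \<Longrightarrow> transpose x \<in> A" "\<And>x. x \<in> A \<Longrightarrow> det x \<noteq> 0 \<Longrightarrow> matrix_inv x \<in> A"
  obtains c where "c \<in> A" "det c = 1" "\<And>k. k \<in> K \<Longrightarrow> orthogonal_matrix (matrix_inv c ** k ** c)"
proof -
  obtain p where p: "p \<in> A" "pos_def p" "\<And>k. k \<in> K \<Longrightarrow> k ** p ** transpose k = p"
    using invariant_metric[OF K(1-3) det A(1)] A(3,4) K(4) by blast
  obtain c where cA: "c \<in> A" and dc: "det c > 0" and cc: "c ** transpose c = p"
    using pos_def_factor[OF p(2,1) A] by blast
  have dt: "det (transpose c) \<noteq> 0" using dc by simp
  have orth: "orthogonal_matrix (matrix_inv c ** k ** c)" if k: "k \<in> K" for k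
  proof -
    let ?u = "matrix_inv c ** k ** c"
    have "?u ** transpose ?u = matrix_inv c ** (k ** (c ** transpose c) ** transpose k) ** transpose (matrix_inv c)"
      by (simp add: matrix_transpose_mul matrix_mul_assoc)
    also have "\<dots> = matrix_inv c ** (c ** transpose c) ** matrix_inv (transpose c)"
      using p(3)[OF k] dc by (simp add: cc matrix_inv_transpose)
    also have "\<dots> = mat 1"
      using dc dt by (simp add: matrix_mul_assoc[symmetric] matrix_inv_right)
    finally show ?thesis by (simp add: orthogonal_matrix_def matrix_left_right_inverse)
  qed
  define a where "a = 1 / root CARD('n) (det c)"
  have a: "a > 0" using dc by (simp add: a_def)
  show thesis
  proof (rule that[of "a *\<^sub>R c"])
    show "a *\<^sub>R c \<in> A" by (rule subspace_scale[OF A(1) cA])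
    show "det (a *\<^sub>R c) = 1" using dc by (simp add: det_scaleR a_def power_divide)
    have "matrix_inv (a *\<^sub>R c) = (1 / a) *\<^sub>R matrix_inv c"
      using a dc by (intro matrix_inv_unique) (simp add: matmul_distribs matrix_inv_right)
    then show "orthogonal_matrix (matrix_inv (a *\<^sub>R c) ** k ** (a *\<^sub>R c))" if "k \<in> K" for k
      using orth[OF that] a by (simp add: matmul_distribs)
  qed
qed

section \<open>Modules over a triple\<close>

lemma linear_funpow: "linear f \<Longrightarrow> linear (f ^^ k :: 'a::real_vector \<Rightarrow> 'a)"
proof (induction k)
  case 0
  then show ?case using linear_id by (simp add: id_def)
next
  case (Suc k)
  then show ?case using linear_compose[of "f ^^ k" f] by (simp add: o_def)
qed

locale sl2 =
  fixes X H Y :: "real^'n^'n"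
  assumes triple: "sl2_triple X H Y"
begin

abbreviation px :: "nat \<Rightarrow> real^'n \<Rightarrow> real^'n" where "px l \<equiv> ((*v) X) ^^ l"
abbreviation py :: "nat \<Rightarrow> real^'n \<Rightarrow> real^'n" where "py l \<equiv> ((*v) Y) ^^ l"

lemma linear_px: "linear (px l)" and linear_py: "linear (py l)"
  by (simp_all add: linear_funpow)

lemmas px_add = linear_add[OF linear_px] and px_scaleR = linear_scale[OF linear_px]
  and px_sum = linear_sum[OF linear_px] and px_0 = linear_0[OF linear_px]
  and py_add = linear_add[OF linear_py] and py_scaleR = linear_scale[OF linear_py]
  and py_sum = linear_sum[OF linear_py] and py_0 = linear_0[OF linear_py]
  and py_diff = linear_diff[OF linear_py]

lemma sl2_relations:
  "H *v (X *v v) = X *v (H *v v) + 2 *\<^sub>R (X *v v)"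
  "H *v (Y *v v) = Y *v (H *v v) - 2 *\<^sub>R (Y *v v)"
  "X *v (Y *v v) = Y *v (X *v v) + H *v v"
proof -
  have 1: "H ** X = X ** H + 2 *\<^sub>R X" "H ** Y = Y ** H - 2 *\<^sub>R Y" "X ** Y = Y ** X + H"
    using triple by (auto simp: sl2_triple_def lie_bracket_def algebra_simps)
  show "H *v (X *v v) = X *v (H *v v) + 2 *\<^sub>R (X *v v)"
    "H *v (Y *v v) = Y *v (H *v v) - 2 *\<^sub>R (Y *v v)"
    "X *v (Y *v v) = Y *v (X *v v) + H *v v"
    by (simp_all add: matrix_vector_mul_assoc 1 matrix_vector_mult_add_rdistrib
        matrix_vector_mult_diff_rdistrib scaleR_matrix_vector_assoc)
qed

lemma H_px: "H *v px l v = px l (H *v v) + (2 * real l) *\<^sub>R px l v"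
proof (induction l)
  case (Suc l)
  have "H *v px (Suc l) v = X *v (H *v px l v) + 2 *\<^sub>R (X *v px l v)"
    using sl2_relations(1) by simp
  also have "\<dots> = X *v px l (H *v v) + ((2 * real l) *\<^sub>R (X *v px l v) + 2 *\<^sub>R (X *v px l v))"
    unfolding Suc.IH by (simp add: matrix_vector_right_distrib matrix_vector_mult_scaleR)
  also have "\<dots> = px (Suc l) (H *v v) + (2 * real (Suc l)) *\<^sub>R px (Suc l) v"
    by (simp only: scaleR_left_distrib[symmetric]) (simp add: algebra_simps)
  finally show ?case .
qed simp

lemma H_py: "H *v py l v = py l (H *v v) - (2 * real l) *\<^sub>R py l v"
proof (induction l)
  case (Suc l)
  have "H *v py (Suc l) v = Y *v (H *v py l v) - 2 *\<^sub>R (Y *v py l v)"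
    using sl2_relations(2) by simp
  also have "\<dots> = Y *v py l (H *v v) - ((2 * real l) *\<^sub>R (Y *v py l v) + 2 *\<^sub>R (Y *v py l v))"
    unfolding Suc.IH by (simp add: matrix_vector_mult_diff_distrib matrix_vector_mult_scaleR)
  also have "\<dots> = py (Suc l) (H *v v) - (2 * real (Suc l)) *\<^sub>R py (Suc l) v"
    by (simp only: scaleR_left_distrib[symmetric]) (simp add: algebra_simps)
  finally show ?case .
qed simp

text \<open>The commutation relation \<open>[X, Y^(k+1)] = (k+1) Y^k (H - k)\<close> of the
  enveloping algebra, obtained by moving \<open>X\<close> past one \<open>Y\<close> at a
  time.\<close>

lemma X_py: "X *v py (Suc k) v = py (Suc k) (X *v v) + (real k + 1) *\<^sub>R py k (H *v v - real k *\<^sub>R v)"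
proof (induction k)
  case (Suc k)
  have "X *v py (Suc (Suc k)) v = Y *v (X *v py (Suc k) v) + H *v py (Suc k) v"
    using sl2_relations(3)[of "py (Suc k) v"] by simp
  also have "\<dots> = py (Suc (Suc k)) (X *v v) + (real k + 1) *\<^sub>R (Y *v py k (H *v v - real k *\<^sub>R v))
      + (py (Suc k) (H *v v) - (2 * real (Suc k)) *\<^sub>R py (Suc k) v)"
    unfolding Suc.IH H_py by (simp add: matrix_vector_right_distrib matrix_vector_mult_scaleR)
  also have "\<dots> = py (Suc (Suc k)) (X *v v) + (real (Suc k) + 1) *\<^sub>R py (Suc k) (H *v v - real (Suc k) *\<^sub>R v)"
  proof -
    have "(r + 1) *\<^sub>R (a - r *\<^sub>R b) + (a - (2 * (r + 1)) *\<^sub>R b) = (r + 1 + 1) *\<^sub>R (a - (r + 1) *\<^sub>R b)"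
      for r and a b :: "real^'n"
      by (simp add: vec_eq_iff algebra_simps)
    from this[of "real k" "py (Suc k) (H *v v)" "py (Suc k) v"] show ?thesis
      unfolding py_diff py_scaleR by (simp add: matrix_vector_mult_diff_distrib matrix_vector_mult_scaleR add.commute[of 1])
  qed
  finally show ?case .
qed (use sl2_relations(3)[of v] in simp)

text \<open>From \<open>[Y^k, H] = 2k Y^k\<close>, the number \<open>2k |Y^k|\<close> is at most a
  fixed multiple of \<open>|Y^k|\<close>. This forces \<open>Y^k = 0\<close> as soon as
  \<open>k\<close> is large.\<close>

lemma py_nilpotent: obtains m where "\<And>v. py m v = 0"
proof -
  define P where "P k = (((**) Y) ^^ k) (mat 1 :: real^'n^'n)" for k
  have P_vec: "P k *v v = py k v" for k v
    by (induction k) (simp_all add: P_def matrix_vector_mul_assoc[symmetric])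
  obtain c where c: "\<And>(a :: real^'n^'n) (b :: real^'n^'n). norm (a ** b) \<le> norm a * norm b * c"
    using bounded_bilinear.bounded[OF bounded_bilinear_matrix_mult] by blast
  have comm: "P k ** H - H ** P k = (2 * real k) *\<^sub>R P k" for k
    unfolding matrix_eq
    by (simp add: matrix_vector_mult_diff_rdistrib scaleR_matrix_vector_assoc[symmetric]
        matrix_vector_mul_assoc[symmetric] P_vec H_py)
  have bound: "2 * real k * norm (P k) \<le> (2 * norm H * c) * norm (P k)" for k
  proof -
    have "2 * real k * norm (P k) = norm (P k ** H - H ** P k)" by (simp add: comm)
    also have "\<dots> \<le> norm (P k ** H) + norm (H ** P k)" by (rule norm_triangle_ineq4)
    also have "\<dots> \<le> norm (P k) * norm H * c + norm H * norm (P k) * c" by (intro add_mono c)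
    finally show ?thesis by (simp add: algebra_simps)
  qed
  obtain m :: nat where m: "real m > norm H * c" using reals_Archimedean2 by blast
  have "norm (P m) = 0"
  proof (rule ccontr)
    assume "norm (P m) \<noteq> 0"
    then have "2 * real m \<le> 2 * norm H * c" using bound[of m] by simp
    then show False using m by simp
  qed
  then have "py m v = 0" for v by (simp add: P_vec[symmetric])
  then show thesis by (rule that)
qed

text \<open>Lowest weight vectors of weight \<open>1 - d\<close>, the lowest weight of the simple
  module of dimension \<open>d\<close>. Being described by eigenvalues, this space is easier to
  handle than \<open>lowest\<close>, with which \<open>lowest_eq\<close> identifies it.\<close>

definition L :: "nat \<Rightarrow> (real^'n) set" where
  "L d = {v. Y *v v = 0 \<and> H *v v = (1 - real d) *\<^sub>R v}"

lemma subspace_L: "subspace (L d)"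
  by (auto simp: L_def subspace_def matrix_vector_right_distrib matrix_vector_mult_scaleR
      scaleR_add_right)

lemma Y_px_Suc:
  assumes v: "v \<in> L d"
  shows "Y *v px (Suc l) v = ((real l + 1) * (real d - 1 - real l)) *\<^sub>R px l v"
proof (induction l)
  case 0
  have "Y *v (X *v v) = - (H *v v)"
    using sl2_relations(3)[of v] v by (simp add: L_def eq_neg_iff_add_eq_0)
  then show ?case using v by (simp add: L_def scaleR_minus_left[symmetric] del: scaleR_minus_left)
next
  case (Suc l)
  have "Y *v px (Suc (Suc l)) v = X *v (Y *v px (Suc l) v) - H *v px (Suc l) v"
    using sl2_relations(3)[of "px (Suc l) v"] by simp
  also have "\<dots> = ((real l + 1) * (real d - 1 - real l)) *\<^sub>R px (Suc l) v
      - ((1 - real d) *\<^sub>R px (Suc l) v + (2 * real (Suc l)) *\<^sub>R px (Suc l) v)"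
    unfolding Suc.IH H_px using v
    by (simp add: matrix_vector_mult_scaleR L_def px_scaleR[of "Suc l", simplified])
  also have "\<dots> = ((real (Suc l) + 1) * (real d - 1 - real (Suc l))) *\<^sub>R px (Suc l) v"
    by (simp only: scaleR_left_distrib[symmetric] scaleR_left_diff_distrib[symmetric])
       (simp add: algebra_simps)
  finally show ?case .
qed

text \<open>The scalar by which \<open>Y^k X^k\<close> acts on \<open>L d\<close>. For
  \<open>k < d\<close> all factors are positive, so one may divide by it.\<close>

definition lowering_coeff :: "nat \<Rightarrow> nat \<Rightarrow> real" where
  "lowering_coeff d k = (\<Prod>i<k. (real i + 1) * (real d - 1 - real i))"

lemma cf_nz: "k < d \<Longrightarrow> lowering_coeff d k \<noteq> 0"
  by (auto simp: lowering_coeff_def)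

lemma py_px_same: "v \<in> L d \<Longrightarrow> py k (px k v) = lowering_coeff d k *\<^sub>R v"
proof (induction k)
  case (Suc k)
  have "py (Suc k) (px (Suc k) v) = py k (Y *v px (Suc k) v)"
    by (simp only: funpow_swap1 funpow.simps o_apply)
  also have "\<dots> = ((real k + 1) * (real d - 1 - real k)) *\<^sub>R py k (px k v)"
    unfolding Y_px_Suc[OF Suc.prems] by (rule py_scaleR)
  finally show ?case using Suc by (simp add: lowering_coeff_def mult.commute)
qed (simp add: lowering_coeff_def)

lemma py_px_less:
  assumes v: "v \<in> L d" and l: "l < k" shows "py k (px l v) = 0"
proof -
  obtain s where k: "k = s + (1 + l)" using l by (metis add.commute less_iff_Suc_add plus_1_eq_Suc add_Suc_right)
  have "py k (px l v) = py s (py 1 (py l (px l v)))"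
    unfolding k by (simp only: funpow_add o_apply)
  then show ?thesis
    using v py_0[of s] by (simp add: py_px_same[OF v] matrix_vector_mult_scaleR L_def)
qed

text \<open>A filtration of the kernel of \<open>Y\<close> by the images of the powers of
  \<open>Y\<close>, not the isotypic component \<open>M(d-1)\<close>, which is
  \<open>isotypic\<close>.\<close>

definition M :: "nat \<Rightarrow> (real^'n) set" where
  "M k = {v. Y *v v = 0 \<and> (\<exists>u. v = py k u)}"

text \<open>Iterating this step until \<open>Y\<^sup>k = 0\<close> shows that \<open>H\<close> is diagonalizable on the kernel of \<open>Y\<close>, with
  eigenvalues \<open>-j\<close>, \<open>j \<ge> k\<close>, on \<open>M k\<close>.\<close>

lemma ker_Y_image_step:
  assumes v: "v \<in> M k" shows "H *v v + real k *\<^sub>R v \<in> M (Suc k)"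
proof -
  obtain u where u: "v = py k u" "Y *v v = 0" using v by (auto simp: M_def)
  have "py (Suc k) u = 0" using u by simp
  then have "0 = py (Suc k) (X *v u) + (real k + 1) *\<^sub>R (py k (H *v u) - real k *\<^sub>R v)"
    using X_py[of k u] by (simp add: py_diff py_scaleR u(1))
  also have "py k (H *v u) = H *v v + (2 * real k) *\<^sub>R v"
    using H_py[of k u] by (simp add: u(1))
  also have "H *v v + (2 * real k) *\<^sub>R v - real k *\<^sub>R v = H *v v + real k *\<^sub>R v"
    by (simp add: vec_eq_iff algebra_simps)
  finally have eq: "(real k + 1) *\<^sub>R (H *v v + real k *\<^sub>R v) = - py (Suc k) (X *v u)"
    by (metis add_eq_0_iff)
  have "H *v v + real k *\<^sub>R v = (1 / (real k + 1)) *\<^sub>R ((real k + 1) *\<^sub>R (H *v v + real k *\<^sub>R v))"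
    by simp
  also have "\<dots> = py (Suc k) ((- 1 / (real k + 1)) *\<^sub>R (X *v u))"
    unfolding eq py_scaleR by simp
  finally have "\<exists>u'. H *v v + real k *\<^sub>R v = py (Suc k) u'" by blast
  moreover have "Y *v (H *v v + real k *\<^sub>R v) = 0"
    using sl2_relations(2)[of v] u(2) by (simp add: matrix_vector_right_distrib matrix_vector_mult_scaleR)
  ultimately show ?thesis by (simp add: M_def)
qed

lemma M_0: "M 0 = {v. Y *v v = 0}"
  by (simp add: M_def)

lemma M_subset_span: "M k \<subseteq> span (\<Union>d\<in>{k<..}. L d)"
proof -
  obtain m where m: "\<And>v. py m v = 0" using py_nilpotent by blast
  have m': "py (m + k) v = 0" for k v
    by (simp add: m funpow_add)
  let ?S = "\<lambda>k. span (\<Union>d\<in>{k<..}. L d)"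
  have "M (k - s) \<subseteq> ?S (k - s)" if "s \<le> k" "M k \<subseteq> ?S k" for k s
    using that
  proof (induction s)
    case (Suc s)
    define j where "j = k - Suc s"
    have j: "Suc j = k - s" using Suc.prems by (simp add: j_def)
    have IH: "M (Suc j) \<subseteq> ?S (Suc j)" using Suc j by simp
    \<comment> \<open>On the \<open>L d\<close> with \<open>d > Suc j\<close> the operator
      \<open>H + j\<close> is the scalar \<open>1 - d + j\<close>, which is nonzero; so it maps
      their span onto itself.\<close>
    have solve: "\<exists>v'\<in>?S (Suc j). H *v v' + real j *\<^sub>R v' = w" if "w \<in> ?S (Suc j)" for w
      using that
    proof (induction rule: span_induct_alt)
      case base
      show ?case by (intro bexI[of _ 0]) (auto simp: span_zero)
    next
      case (step c u w)
      obtain d where d: "d > Suc j" "u \<in> L d" using step(1) by auto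
      obtain v' where v': "v' \<in> ?S (Suc j)" "H *v v' + real j *\<^sub>R v' = w" using step by blast
      let ?e = "1 - real d + real j"
      have e: "?e \<noteq> 0" using d(1) by simp
      have u: "u \<in> ?S (Suc j)" using step(1) by (rule span_base)
      have Hu: "H *v u = (1 - real d) *\<^sub>R u" using d(2) by (simp add: L_def)
      have "H *v ((c / ?e) *\<^sub>R u + v') + real j *\<^sub>R ((c / ?e) *\<^sub>R u + v')
          = (c / ?e * ?e) *\<^sub>R u + (H *v v' + real j *\<^sub>R v')"
        by (simp add: matrix_vector_right_distrib matrix_vector_mult_scaleR Hu
            scaleR_add_right distrib_left scaleR_left_distrib del: times_divide_eq_left times_divide_eq_right)
      also have "\<dots> = c *\<^sub>R u + w" using e by (simp add: v'(2))
      finally show ?case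
        using span_add[OF span_scale[OF u] v'(1)] by blast
    qed
    have "v \<in> ?S j" if v: "v \<in> M j" for v
    proof -
      obtain v' where v': "v' \<in> ?S (Suc j)" "H *v v' + real j *\<^sub>R v' = H *v v + real j *\<^sub>R v"
        using solve ker_Y_image_step[OF v] IH by blast
      have ker: "Y *v u = 0" if "u \<in> ?S i" for u i
      proof -
        have "subspace {u. Y *v u = 0}"
          by (auto simp: subspace_def matrix_vector_right_distrib matrix_vector_mult_scaleR)
        moreover have "(\<Union>d\<in>{i<..}. L d) \<subseteq> {u. Y *v u = 0}" by (auto simp: L_def)
        ultimately show ?thesis using that span_minimal by blast
      qed
      \<comment> \<open>Subtracting \<open>v'\<close> leaves an eigenvector for
        \<open>-j = 1 - Suc j\<close>, the only weight still missing.\<close>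
      have "H *v (v - v') = - real j *\<^sub>R (v - v')"
        using v'(2) by (simp add: matrix_vector_mult_diff_distrib algebra_simps)
      then have "v - v' \<in> L (Suc j)"
        using v ker[OF v'(1)] by (simp add: L_def M_def matrix_vector_mult_diff_distrib)
      then have 1: "v - v' \<in> ?S j" by (intro span_base) auto
      have "?S (Suc j) \<subseteq> ?S j" by (intro span_mono UN_mono) auto
      then have "v' \<in> ?S j" using v'(1) by blast
      from span_add[OF 1 this] show ?thesis by simp
    qed
    then show ?case by (auto simp: j_def)
  qed simp
  \<comment> \<open>The descent starts at \<open>m + k\<close>, where the image of
    \<open>Y^(m+k)\<close> is zero, and reaches \<open>k\<close> after \<open>m\<close>
    steps.\<close>
  from this[of m "m + k"] have *: "M (m + k) \<subseteq> ?S (m + k) \<Longrightarrow> M k \<subseteq> ?S k" by simp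
  show ?thesis
    by (rule *) (auto simp: M_def m' span_zero)
qed

text \<open>Each \<open>ker_Y_image_step\<close> multiplies the eigenvector by
  \<open>\<mu> + k\<close> and leads from \<open>M k\<close> to \<open>M (Suc k)\<close>. Since
  \<open>M m\<close> is zero for large \<open>m\<close>, some factor vanishes.\<close>

lemma eigenvalue_nonpos:
  assumes v: "Y *v v = 0" "H *v v = \<mu> *\<^sub>R v" "v \<noteq> 0"
  shows "\<mu> \<le> 0"
proof -
  obtain m where m: "\<And>v. py m v = 0" using py_nilpotent by blast
  have "(\<Prod>j<k. \<mu> + real j) *\<^sub>R v \<in> M k" for k
  proof (induction k)
    case (Suc k)
    have "H *v ((\<Prod>j<k. \<mu> + real j) *\<^sub>R v) + real k *\<^sub>R ((\<Prod>j<k. \<mu> + real j) *\<^sub>R v)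
        = (\<Prod>j<Suc k. \<mu> + real j) *\<^sub>R v"
      by (simp only: matrix_vector_mult_scaleR v(2) scaleR_scaleR scaleR_left_distrib[symmetric]
          prod.lessThan_Suc) (simp add: algebra_simps)
    then show ?case using ker_Y_image_step[OF Suc.IH] by simp
  qed (simp add: M_0 v(1))
  from this[of m] have "(\<Prod>j<m. \<mu> + real j) = 0"
    using v(3) by (auto simp: M_def m)
  then show ?thesis by auto
qed

text \<open>If nonzero, \<open>X^d v\<close> would be killed by \<open>Y\<close> and have the
  positive weight \<open>1 + d\<close>.\<close>

lemma px_top:
  assumes v: "v \<in> L d" and d: "d \<ge> 1" shows "px d v = 0"
proof (rule ccontr)
  assume nz: "px d v \<noteq> 0"
  obtain l where l: "d = Suc l" using d by (cases d) auto
  have "Y *v px d v = 0" using Y_px_Suc[OF v, of l] by (simp add: l)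
  moreover have "H *v px d v = (1 + real d) *\<^sub>R px d v"
  proof -
    have "px d (H *v v) = (1 - real d) *\<^sub>R px d v"
      using v by (simp add: L_def px_scaleR)
    then show ?thesis unfolding H_px by (simp only: scaleR_left_distrib[symmetric]) simp
  qed
  ultimately have "1 + real d \<le> 0" using nz by (rule eigenvalue_nonpos)
  then show False by simp
qed

text \<open>Induction on the power of \<open>Y\<close> that kills \<open>u\<close>. By
  \<open>M_subset_span\<close>, \<open>Y^k u\<close> is a sum of vectors in \<open>L d\<close> with
  \<open>d > k\<close>, each of them \<open>Y^k\<close> of a multiple of its
  \<open>X^k\<close>-image; subtracting these multiples lowers the power by one.\<close>

lemma span_px: "u \<in> span {px l v | d l v. l < d \<and> v \<in> L d}" (is "u \<in> span ?G")
proof -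
  obtain m where m: "\<And>v. py m v = 0" using py_nilpotent by blast
  have "u \<in> span ?G" if "py k u = 0" for k u
    using that
  proof (induction k arbitrary: u)
    case 0
    then show ?case by (simp add: span_zero)
  next
    case (Suc k)
    have "py k u \<in> M k" using Suc.prems by (auto simp: M_def)
    then have "py k u \<in> span (\<Union>d\<in>{k<..}. L d)" using M_subset_span by blast
    then have "\<exists>u'\<in>span ?G. py k u' = py k u"
    proof (induction rule: span_induct_alt)
      case base
      show ?case by (intro bexI[of _ 0]) (auto simp: span_zero py_0)
    next
      case (step c v w)
      obtain d where d: "k < d" "v \<in> L d" using step(1) by auto
      obtain u' where u': "u' \<in> span ?G" "py k u' = w" using step by blast
      have "px k v \<in> span ?G" using d by (intro span_base) blast
      then have "(c / lowering_coeff d k) *\<^sub>R px k v + u' \<in> span ?G"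
        by (intro span_add span_scale u'(1))
      moreover have "py k ((c / lowering_coeff d k) *\<^sub>R px k v + u') = c *\<^sub>R v + w"
        by (simp add: py_add py_scaleR py_px_same[OF d(2)] cf_nz[OF d(1)] u'(2))
      ultimately show ?case by blast
    qed
    then obtain u' where u': "u' \<in> span ?G" "py k u' = py k u" by blast
    then have "u - u' \<in> span ?G" by (intro Suc.IH) (simp add: py_diff)
    from span_add[OF this u'(1)] show ?case by simp
  qed
  then show ?thesis using m by blast
qed

lemma L_sum_zero:
  assumes "finite D" "\<And>d. d \<in> D \<Longrightarrow> w d \<in> L d" "(\<Sum>d\<in>D. w d) = 0" "d \<in> D"
  shows "w d = 0"
  using assms
proof (induction D arbitrary: w d rule: finite_induct)
  case (insert e D)
  have He: "H *v (\<Sum>d\<in>insert e D. w d) = (\<Sum>d\<in>insert e D. (1 - real d) *\<^sub>R w d)"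
    using insert.prems(1) by (simp add: linear_sum[OF matrix_vector_mul_linear] L_def del: sum.insert)
  have "(\<Sum>d\<in>D. (real e - real d) *\<^sub>R w d) = (\<Sum>d\<in>insert e D. (real e - real d) *\<^sub>R w d)"
    using insert.hyps by simp
  also have "\<dots> = (\<Sum>d\<in>insert e D. (1 - real d) *\<^sub>R w d - (1 - real e) *\<^sub>R w d)"
    by (intro sum.cong) (simp_all add: scaleR_left_diff_distrib[symmetric])
  also have "\<dots> = 0"
    using He insert.prems(2) by (simp add: sum_subtractf scaleR_sum_right[symmetric] del: sum.insert)
  finally have z: "(\<Sum>d\<in>D. (real e - real d) *\<^sub>R w d) = 0" .
  have "(real e - real d) *\<^sub>R w d = 0" if "d \<in> D" for d
    by (rule insert.IH[OF _ z that]) (use insert.prems(1) subspace_scale[OF subspace_L] in auto)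
  then have D: "w d = 0" if "d \<in> D" for d using that insert.hyps(2) by auto
  then have "w e = 0" using insert.prems(2) insert.hyps by simp
  with D show ?case using insert.prems(3) by auto
qed simp

text \<open>Let \<open>k\<close> be the largest power of \<open>X\<close> with a nonzero
  coefficient. \<open>Y^k\<close> kills all lower powers and turns \<open>X^k\<close> into a nonzero
  scalar, which leaves a relation between eigenvectors of \<open>H\<close> for distinct
  eigenvalues.\<close>

lemma px_sum_zero:
  assumes D: "finite D" and w: "\<And>d l. d \<in> D \<Longrightarrow> l < d \<Longrightarrow> w d l \<in> L d"
    and zero: "(\<Sum>d\<in>D. \<Sum>l<d. px l (w d l)) = 0" and d: "d \<in> D" "l < d"
  shows "w d l = 0"
proof (rule ccontr)
  assume nz: "w d l \<noteq> 0"
  define B where "B = {l. \<exists>d\<in>D. l < d \<and> w d l \<noteq> 0}"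
  have "B \<subseteq> (\<Union>d\<in>D. {..<d})" by (auto simp: B_def)
  then have "finite B" using D by (auto intro: finite_subset)
  moreover have "l \<in> B" using nz d by (auto simp: B_def)
  ultimately have "Max B \<in> B" and max: "\<And>l. l \<in> B \<Longrightarrow> l \<le> Max B" by (auto intro: Max_in)
  define k where "k = Max B"
  have kz: "w d l = 0" if "d \<in> D" "l < d" "k < l" for d l
    using max[of l] that by (force simp: B_def k_def)
  have inner: "py k (\<Sum>l<d. px l (w d l)) = (if k < d then lowering_coeff d k *\<^sub>R w d k else 0)" if d: "d \<in> D" for d
  proof -
    have "py k (px l (w d l)) = (if l = k then lowering_coeff d k *\<^sub>R w d k else 0)" if "l < d" for l
      using py_px_same[OF w[OF d that]] py_px_less[OF w[OF d that], of l k] kz[OF d that] that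
      by (cases l k rule: linorder_cases) (auto simp: px_0 py_0)
    then have "py k (\<Sum>l<d. px l (w d l)) = (\<Sum>l<d. if l = k then lowering_coeff d k *\<^sub>R w d k else 0)"
      by (simp add: py_sum)
    then show ?thesis by simp
  qed
  have "(\<Sum>d\<in>D. if k < d then lowering_coeff d k *\<^sub>R w d k else 0) = (\<Sum>d\<in>D. py k (\<Sum>l<d. px l (w d l)))"
    by (simp only: inner cong: sum.cong)
  also have "\<dots> = py k (\<Sum>d\<in>D. \<Sum>l<d. px l (w d l))"
    by (rule py_sum[symmetric])
  also have "\<dots> = 0" by (simp add: zero py_0)
  finally have z: "(\<Sum>d\<in>D. if k < d then lowering_coeff d k *\<^sub>R w d k else 0) = 0" .
  have "(if k < d then lowering_coeff d k *\<^sub>R w d k else 0) = 0" if "d \<in> D" for d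
    by (rule L_sum_zero[OF D _ z that]) (use w subspace_L in \<open>auto simp: subspace_scale subspace_0\<close>)
  moreover obtain d where "d \<in> D" "k < d" "w d k \<noteq> 0"
    using \<open>Max B \<in> B\<close> by (auto simp: B_def k_def)
  ultimately show False using cf_nz[of k d] by force
qed

lemma ker_Y_px_sum:
  assumes w: "\<And>l. l < d \<Longrightarrow> w l \<in> L d" and ker: "Y *v (\<Sum>l<d. px l (w l)) = 0"
    and l: "0 < l" "l < d"
  shows "w l = 0"
proof -
  have "w (Suc l') = 0" if l': "Suc l' < d" for l'
  proof -
    \<comment> \<open>The layers of \<open>Y u\<close>: the vector \<open>w (Suc l)\<close> moves
      down to layer \<open>l\<close>, scaled by a nonzero number, and the top layer becomes
      empty.\<close>
    let ?w = "\<lambda>d l. if Suc l < d then ((real l + 1) * (real d - 1 - real l)) *\<^sub>R w (Suc l) else 0"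
    obtain e where e: "d = Suc e" using l by (cases d) auto
    have "(\<Sum>l<d. Y *v px l (w l)) = Y *v w 0 + (\<Sum>l<e. Y *v px (Suc l) (w (Suc l)))"
      unfolding e by (subst sum.lessThan_Suc_shift) simp
    also have "Y *v w 0 = 0" using w[of 0] l by (simp add: L_def)
    also have "(\<Sum>l<e. Y *v px (Suc l) (w (Suc l))) = (\<Sum>l<e. px l (?w d l))"
    proof (intro sum.cong refl)
      fix l assume "l \<in> {..<e}"
      then have l: "Suc l < d" by (simp add: e)
      show "Y *v px (Suc l) (w (Suc l)) = px l (?w d l)"
        unfolding Y_px_Suc[OF w[OF l]] using l by (simp add: px_scaleR)
    qed
    also have "\<dots> = (\<Sum>l<d. px l (?w d l))"
      unfolding e by (simp add: px_0)
    finally have "(\<Sum>d\<in>{d}. \<Sum>l<d. px l (?w d l)) = 0"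
      using ker by (simp add: linear_sum[OF matrix_vector_mul_linear])
    then have "?w d l' = 0"
      by (rule px_sum_zero[rotated 2]) (use l' w subspace_L in \<open>auto simp: subspace_scale subspace_0\<close>)
    then show ?thesis using l' by auto
  qed
  then show ?thesis using l by (cases l) auto
qed

end

section \<open>Simple submodules and lowest weight spaces\<close>

lemma independent_family:
  fixes f :: "'i \<Rightarrow> 'a::real_vector"
  assumes T: "finite T" and zero: "\<And>c \<tau>. (\<Sum>\<tau>\<in>T. c \<tau> *\<^sub>R f \<tau>) = 0 \<Longrightarrow> \<tau> \<in> T \<Longrightarrow> c \<tau> = 0"
  shows "inj_on f T" "independent (f ` T)"
proof -
  show inj: "inj_on f T"
  proof (rule inj_onI, rule ccontr)
    fix \<sigma> \<tau> assume st: "\<sigma> \<in> T" "\<tau> \<in> T" "f \<sigma> = f \<tau>" "\<sigma> \<noteq> \<tau>"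
    let ?c = "\<lambda>\<rho>. (if \<rho> = \<sigma> then 1 else 0) - (if \<rho> = \<tau> then 1 else 0 :: real)"
    have "(\<Sum>\<rho>\<in>T. ?c \<rho> *\<^sub>R f \<rho>) = (\<Sum>\<rho>\<in>T. (if \<rho> = \<sigma> then f \<rho> else 0) - (if \<rho> = \<tau> then f \<rho> else 0))"
      by (intro sum.cong) auto
    also have "\<dots> = 0" using T st by (simp add: sum_subtractf)
    finally have "?c \<sigma> = 0" using st(1) by (rule zero)
    then show False using st(4) by simp
  qed
  show "independent (f ` T)"
  proof (rule independent_if_scalars_zero)
    fix c x assume "(\<Sum>x\<in>f ` T. c x *\<^sub>R x) = 0" and "x \<in> f ` T"
    then obtain \<tau> where \<tau>: "\<tau> \<in> T" "x = f \<tau>" by blast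
    have "(\<Sum>\<tau>\<in>T. c (f \<tau>) *\<^sub>R f \<tau>) = 0"
      using \<open>_ = 0\<close> by (simp add: sum.reindex[OF inj])
    from zero[OF this \<tau>(1)] show "c x = 0" by (simp add: \<tau>(2))
  qed (use T in simp)
qed

lemma mat_submodule_span_iff:
  "mat_submodule (span S) W \<longleftrightarrow> subspace W \<and> (\<forall>A\<in>S. \<forall>w\<in>W. A *v w \<in> W)"
proof
  assume "mat_submodule (span S) W"
  then show "subspace W \<and> (\<forall>A\<in>S. \<forall>w\<in>W. A *v w \<in> W)"
    by (auto simp: mat_submodule_def intro: span_base)
next
  assume W: "subspace W \<and> (\<forall>A\<in>S. \<forall>w\<in>W. A *v w \<in> W)"
  then have "subspace {A. \<forall>w\<in>W. A *v w \<in> W}"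
    by (auto simp: subspace_def matrix_vector_mult_add_rdistrib scaleR_matrix_vector_assoc[symmetric])
  then have "span S \<subseteq> {A. \<forall>w\<in>W. A *v w \<in> W}"
    using W by (intro span_minimal) auto
  then show "mat_submodule (span S) W" using W by (auto simp: mat_submodule_def)
qed

context sl2
begin

abbreviation submodule :: "(real^'n) set \<Rightarrow> bool" where
  "submodule \<equiv> mat_submodule (span {X, H, Y})"

lemma submoduleD:
  assumes "submodule U"
  shows "subspace U" "u \<in> U \<Longrightarrow> X *v u \<in> U" "u \<in> U \<Longrightarrow> H *v u \<in> U" "u \<in> U \<Longrightarrow> Y *v u \<in> U"
  using assms by (auto simp: mat_submodule_span_iff)

text \<open>For \<open>W\<close> inside \<open>L d\<close> this is the submodule generated by
  \<open>W\<close>. A line \<open>W\<close> gives the simple modules, and \<open>W = L d\<close>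
  gives the isotypic component.\<close>

definition PX :: "(real^'n) set \<Rightarrow> nat \<Rightarrow> (real^'n) set" where
  "PX W d = {\<Sum>l<d. px l (w l) | w. \<forall>l<d. w l \<in> W}"

lemma subspace_PX:
  assumes W: "subspace W" shows "subspace (PX W d)"
  unfolding subspace_def
proof (intro conjI ballI allI)
  show "0 \<in> PX W d"
    unfolding PX_def using subspace_0[OF W] by (auto intro!: exI[of _ "\<lambda>_. 0"] simp: px_0)
  fix x y assume "x \<in> PX W d" "y \<in> PX W d"
  then obtain a b where "x = (\<Sum>l<d. px l (a l))" "y = (\<Sum>l<d. px l (b l))"
    "\<forall>l<d. a l \<in> W" "\<forall>l<d. b l \<in> W" by (auto simp: PX_def)
  then show "x + y \<in> PX W d"
    unfolding PX_def by (auto intro!: exI[of _ "\<lambda>l. a l + b l"] simp: px_add sum.distrib subspace_add[OF W])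
next
  fix x c assume "x \<in> PX W d"
  then obtain a where "x = (\<Sum>l<d. px l (a l))" "\<forall>l<d. a l \<in> W" by (auto simp: PX_def)
  then show "c *\<^sub>R x \<in> PX W d"
    unfolding PX_def
    by (auto intro!: exI[of _ "\<lambda>l. c *\<^sub>R a l"] simp: px_scaleR scaleR_sum_right subspace_scale[OF W])
qed

lemma px_in_PX:
  assumes W: "subspace W" and w: "w \<in> W" "l < d" shows "px l w \<in> PX W d"
proof -
  have "(\<Sum>l'<d. px l' (if l' = l then w else 0)) = (\<Sum>l'<d. if l' = l then px l' w else 0)"
    by (intro sum.cong) (auto simp: px_0)
  then have "(\<Sum>l'<d. px l' (if l' = l then w else 0)) = px l w" using w by simp
  then show ?thesis
    unfolding PX_def using w subspace_0[OF W] by (force intro!: exI[of _ "\<lambda>l'. if l' = l then w else 0"])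
qed

lemma submodule_PX:
  assumes W: "subspace W" "W \<subseteq> L d" shows "submodule (PX W d)"
  unfolding mat_submodule_span_iff
proof (intro conjI ballI subspace_PX W)
  note sub = subspace_PX[OF W(1), of d]
  fix A u assume A: "A \<in> {X, H, Y}" and "u \<in> PX W d"
  then obtain w where w: "u = (\<Sum>l<d. px l (w l))" "\<And>l. l < d \<Longrightarrow> w l \<in> W" by (auto simp: PX_def)
  have "A *v px l (w l) \<in> PX W d" if l: "l < d" for l
  proof -
    have wL: "w l \<in> L d" using w(2)[OF l] W(2) by blast
    have pw: "px l' (w l) \<in> PX W d" if "l' < d" for l'
      by (rule px_in_PX[OF W(1) w(2)[OF l] that])
    consider "A = X" | "A = H" | "A = Y" using A by blast
    then show ?thesis
    proof cases
      case 1
      have "px (Suc l) (w l) \<in> PX W d"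
      proof (cases "Suc l = d")
        case True
        then show ?thesis using px_top[OF wL] subspace_0[OF sub] by (simp del: funpow.simps)
      next
        case False
        with l show ?thesis by (intro pw) simp
      qed
      then show ?thesis by (simp add: 1)
    next
      case 2
      have "px l (H *v w l) = (1 - real d) *\<^sub>R px l (w l)" using wL by (simp add: L_def px_scaleR)
      then show ?thesis
        unfolding 2 H_px by (simp only:) (intro subspace_add subspace_scale sub pw l)
    next
      case 3
      show ?thesis
      proof (cases l)
        case 0
        then show ?thesis using wL subspace_0[OF sub] by (simp add: 3 L_def)
      next
        case (Suc l')
        have "px l' (w l) \<in> PX W d" using l Suc by (intro pw) simp
        then show ?thesis unfolding 3 Suc
          using Y_px_Suc[OF wL, of l'] subspace_scale[OF sub] by (simp add: Suc del: funpow.simps)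
      qed
    qed
  qed
  then show "A *v u \<in> PX W d"
    unfolding w(1) linear_sum[OF matrix_vector_mul_linear] by (intro subspace_sum[OF sub]) auto
qed

lemma PX_ker:
  assumes W: "W \<subseteq> L d" and d: "d \<ge> 1" and u: "u \<in> PX W d" "Y *v u = 0"
  shows "u \<in> W"
proof -
  obtain w where w: "u = (\<Sum>l<d. px l (w l))" "\<And>l. l < d \<Longrightarrow> w l \<in> W"
    using u(1) by (auto simp: PX_def)
  have z: "w l = 0" if "0 < l" "l < d" for l
    by (rule ker_Y_px_sum[of d w]) (use w W u(2) that in auto)
  have "u = (\<Sum>l\<in>{0}. px l (w l))"
    unfolding w(1) by (rule sum.mono_neutral_right) (use z d in \<open>auto simp: px_0\<close>)
  then show ?thesis using w(2)[of 0] d by simp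
qed

lemma submodule_ker_Y:
  assumes U: "submodule U" and u: "u \<in> U" "u \<noteq> 0"
  obtains u' where "u' \<in> U" "u' \<noteq> 0" "Y *v u' = 0"
proof -
  obtain m where "py m u = 0" using py_nilpotent by blast
  then have "\<exists>k. py k u = 0" by blast
  then have L: "py (LEAST k. py k u = 0) u = 0" by (rule LeastI_ex)
  define k where "k = (LEAST k. py k u = 0)"
  have "k \<noteq> 0" using L u(2) by (auto simp: k_def[symmetric] intro: ccontr)
  then obtain j where j: "k = Suc j" by (cases k) auto
  have "py j u \<noteq> 0" using not_less_Least[of j "\<lambda>k. py k u = 0"] j by (simp add: k_def)
  moreover have "py i u \<in> U" for i
    by (induction i) (use u(1) submoduleD(4)[OF U] in auto)
  moreover have "Y *v py j u = 0" using L by (simp add: k_def[symmetric] j)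
  ultimately show thesis using that by blast
qed

text \<open>\<open>U\<close> meets \<open>M 0\<close> nontrivially but not \<open>M m\<close> for
  large \<open>m\<close>. Where this changes, at \<open>k\<close>, a nonzero \<open>v\<close> in
  \<open>U\<close> and \<open>M k\<close> has \<open>(H + k) v\<close> in \<open>U\<close> and
  \<open>M (Suc k)\<close>, hence zero.\<close>

lemma submodule_eigenvector:
  assumes U: "submodule U" and ne: "U \<noteq> {0}"
  obtains d v where "d \<ge> 1" "v \<in> L d" "v \<in> U" "v \<noteq> 0"
proof -
  obtain m where m: "\<And>v. py m v = 0" using py_nilpotent by blast
  define P where "P k \<longleftrightarrow> (\<exists>v\<in>U. v \<in> M k \<and> v \<noteq> 0)" for k
  obtain u where "u \<in> U" "u \<noteq> 0" using ne subspace_0[OF submoduleD(1)[OF U]] by blast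
  then obtain u' where "u' \<in> U" "u' \<noteq> 0" "Y *v u' = 0" by (rule submodule_ker_Y[OF U])
  then have P0: "P 0" unfolding P_def M_0 by blast
  have Pm: "\<not> P m" by (auto simp: P_def M_def m)
  have "\<exists>k. P k \<and> \<not> P (Suc k)"
  proof (rule ccontr)
    assume "\<not> ?thesis"
    then have "P k" for k by (induction k) (use P0 in auto)
    with Pm show False by blast
  qed
  then obtain k where k: "P k" "\<not> P (Suc k)" by blast
  then obtain v where v: "v \<in> U" "v \<in> M k" "v \<noteq> 0" by (auto simp: P_def)
  have "H *v v + real k *\<^sub>R v \<in> U"
    using v(1) submoduleD[OF U] by (intro subspace_add subspace_scale)
  then have "H *v v + real k *\<^sub>R v = 0"
    using k(2) ker_Y_image_step[OF v(2)] by (auto simp: P_def)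
  then have "v \<in> L (Suc k)"
    using v(2) by (simp add: L_def M_def eq_neg_iff_add_eq_0)
  then show thesis using v by (intro that[of "Suc k" v]) auto
qed

lemma PX_span_singleton:
  assumes v: "v \<in> L d" "v \<noteq> 0"
  shows "dim (PX (span {v}) d) = d"
proof -
  let ?f = "\<lambda>l. px l v"
  have sub: "subspace (PX (span {v}) d)" by (intro subspace_PX subspace_span)
  have zero: "c l = 0" if "(\<Sum>l<d. c l *\<^sub>R ?f l) = 0" "l \<in> {..<d}" for c l
  proof -
    have "(\<Sum>d\<in>{d}. \<Sum>l<d. px l (c l *\<^sub>R v)) = 0" using that(1) by (simp add: px_scaleR)
    then have "c l *\<^sub>R v = 0"
      by (rule px_sum_zero[rotated 2, where w = "\<lambda>d l. c l *\<^sub>R v"])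
         (use that v subspace_scale[OF subspace_L] in auto)
    then show ?thesis using v(2) by simp
  qed
  have ind: "inj_on ?f {..<d}" "independent (?f ` {..<d})"
    by (rule independent_family[OF finite_lessThan], rule zero, assumption+)+
  have "PX (span {v}) d = span (?f ` {..<d})"
  proof
    show "PX (span {v}) d \<subseteq> span (?f ` {..<d})"
    proof
      fix u assume "u \<in> PX (span {v}) d"
      then obtain w where w: "u = (\<Sum>l<d. px l (w l))" "\<And>l. l < d \<Longrightarrow> w l \<in> span {v}"
        by (auto simp: PX_def)
      have "px l (w l) \<in> span (?f ` {..<d})" if l: "l < d" for l
      proof -
        obtain c where "w l = c *\<^sub>R v" using w(2)[OF l] by (auto simp: span_singleton)
        moreover have "px l v \<in> span (?f ` {..<d})" using l by (intro span_base) auto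
        ultimately show ?thesis by (simp add: px_scaleR span_scale)
      qed
      then show "u \<in> span (?f ` {..<d})" unfolding w(1) by (intro span_sum) auto
    qed
    show "span (?f ` {..<d}) \<subseteq> PX (span {v}) d"
      by (intro span_minimal sub) (auto intro: px_in_PX span_base)
  qed
  then have "dim (PX (span {v}) d) = card (?f ` {..<d})"
    using dim_span_eq_card_independent[OF ind(2)] by simp
  then show ?thesis using ind(1) by (simp add: card_image)
qed

lemma span_singleton_L: "v \<in> L d \<Longrightarrow> span {v} \<subseteq> L d"
  by (intro span_minimal subspace_L) auto

lemma PX_subset_submodule:
  assumes U: "submodule U" and v: "v \<in> U"
  shows "PX (span {v}) d \<subseteq> U"
proof
  note sub = submoduleD(1)[OF U]
  have pU: "px l v \<in> U" for l
    by (induction l) (use v submoduleD(2)[OF U] in auto)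
  fix x assume "x \<in> PX (span {v}) d"
  then obtain w where w: "x = (\<Sum>l<d. px l (w l))" "\<And>l. l < d \<Longrightarrow> w l \<in> span {v}"
    by (auto simp: PX_def)
  have "px l (w l) \<in> U" if l: "l < d" for l
  proof -
    obtain c where "w l = c *\<^sub>R v" using w(2)[OF l] by (auto simp: span_singleton)
    then show ?thesis using pU subspace_scale[OF sub] by (simp add: px_scaleR)
  qed
  then show "x \<in> U" unfolding w(1) by (intro subspace_sum[OF sub]) auto
qed

text \<open>A nonzero submodule contains a lowest weight vector, which by \<open>PX_ker\<close> lies
  on the line of \<open>v\<close>; and \<open>v\<close> generates everything.\<close>

lemma irreducible_PX:
  assumes v: "v \<in> L d" "v \<noteq> 0" and d: "d \<ge> 1"
  shows "irreducible_mat_submodule (span {X, H, Y}) (PX (span {v}) d)"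
  unfolding irreducible_mat_submodule_def
proof (intro conjI allI impI)
  show "submodule (PX (span {v}) d)" by (intro submodule_PX subspace_span span_singleton_L v)
  show "PX (span {v}) d \<noteq> {0}"
  proof
    assume "PX (span {v}) d = {0}"
    then have "d = 0" using PX_span_singleton[OF v] by simp
    with d show False by simp
  qed
  fix U assume U: "submodule U \<and> U \<subseteq> PX (span {v}) d"
  show "U = {0} \<or> U = PX (span {v}) d"
  proof (rule disjCI)
    assume "U \<noteq> PX (span {v}) d"
    show "U = {0}"
    proof (rule ccontr)
      assume "U \<noteq> {0}"
      then obtain e u where u: "u \<in> L e" "u \<in> U" "u \<noteq> 0"
        using submodule_eigenvector U by metis
      have "u \<in> span {v}"
        by (rule PX_ker[OF span_singleton_L[OF v(1)] d]) (use u U in \<open>auto simp: L_def\<close>)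
      then obtain c where "u = c *\<^sub>R v" by (auto simp: span_singleton)
      then have "v = (1 / c) *\<^sub>R u" using u(3) by auto
      then have vU: "v \<in> U" using u(2) U submoduleD(1) subspace_scale by metis
      have "PX (span {v}) d \<subseteq> U" using U vU by (intro PX_subset_submodule) auto
      then show False using U \<open>U \<noteq> PX (span {v}) d\<close> by blast
    qed
  qed
qed

lemma irreducible_imp_PX:
  assumes W: "irreducible_mat_submodule (span {X, H, Y}) W"
  obtains v where "dim W \<ge> 1" "v \<in> L (dim W)" "W = PX (span {v}) (dim W)"
proof -
  have sub: "submodule W" "W \<noteq> {0}" using W by (auto simp: irreducible_mat_submodule_def)
  obtain d v where v: "d \<ge> 1" "v \<in> L d" "v \<in> W" "v \<noteq> 0"
    by (rule submodule_eigenvector[OF sub])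
  have "PX (span {v}) d \<subseteq> W" by (rule PX_subset_submodule[OF sub(1) v(3)])
  moreover have ir: "submodule (PX (span {v}) d)" "PX (span {v}) d \<noteq> {0}"
    using irreducible_PX[OF v(2,4,1)] by (auto simp: irreducible_mat_submodule_def)
  ultimately have "W = PX (span {v}) d"
    using W unfolding irreducible_mat_submodule_def by metis
  moreover have "dim (PX (span {v}) d) = d" by (rule PX_span_singleton[OF v(2,4)])
  ultimately show thesis using v by (intro that[of v]) auto
qed

lemma isotypic_eq:
  assumes d: "d \<ge> 1" shows "isotypic X H Y d = PX (L d) d"
proof
  have sub: "subspace (PX (L d) d)" by (intro subspace_PX subspace_L)
  show "isotypic X H Y d \<subseteq> PX (L d) d"
    unfolding isotypic_def
  proof (intro span_minimal sub Union_least, clarify)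
    fix W x assume "irreducible_mat_submodule (span {X, H, Y}) W" "d = dim W" "x \<in> W"
    moreover obtain v where "v \<in> L (dim W)" "W = PX (span {v}) (dim W)"
      by (rule irreducible_imp_PX[OF calculation(1)])
    ultimately have x: "x \<in> PX (span {v}) (dim W)" and v: "span {v} \<subseteq> L (dim W)"
      by (simp_all add: span_singleton_L)
    then show "x \<in> PX (L (dim W)) (dim W)"
      unfolding PX_def by blast
  qed
  show "PX (L d) d \<subseteq> isotypic X H Y d"
  proof
    fix x assume "x \<in> PX (L d) d"
    then obtain w where w: "x = (\<Sum>l<d. px l (w l))" "\<And>l. l < d \<Longrightarrow> w l \<in> L d"
      by (auto simp: PX_def)
    have "px l (w l) \<in> isotypic X H Y d" if l: "l < d" for l
    proof (cases "w l = 0")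
      case True
      then show ?thesis by (simp add: px_0 isotypic_def span_zero)
    next
      case False
      have "px l (w l) \<in> PX (span {w l}) d"
        by (intro px_in_PX subspace_span span_base l) simp
      then show ?thesis
        unfolding isotypic_def using irreducible_PX[OF w(2)[OF l] False d] PX_span_singleton[OF w(2)[OF l] False]
        by (intro span_base) blast
    qed
    then show "x \<in> isotypic X H Y d"
      unfolding w(1) isotypic_def by (intro span_sum) auto
  qed
qed

lemma lowest_eq:
  assumes d: "d \<ge> 1" shows "lowest X H Y d = L d"
proof
  show "lowest X H Y d \<subseteq> L d"
    unfolding lowest_def isotypic_eq[OF d] using PX_ker[OF order_refl d] by blast
  show "L d \<subseteq> lowest X H Y d"
  proof
    fix v assume v: "v \<in> L d"
    have "px 0 v \<in> PX (L d) d" using v d by (intro px_in_PX subspace_L) auto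
    then show "v \<in> lowest X H Y d"
      using v by (simp add: lowest_def isotypic_eq[OF d] L_def)
  qed
qed

text \<open>\<open>sorted_list_of_set\<close> enumerates only finite sets. Finiteness holds because
  the weights \<open>1 - d\<close> that occur are eigenvalues of \<open>H\<close>, bounded by its
  operator norm.\<close>

lemma set_mult_dims: "set (mult_dims X H Y) = {d. d \<ge> 1 \<and> L d \<noteq> {0}}"
proof -
  have eq: "{d. d \<ge> 1 \<and> dim (lowest X H Y d) > 0} = {d. d \<ge> 1 \<and> L d \<noteq> {0}}"
  proof (intro Collect_cong conj_cong refl)
    fix d :: nat assume d: "1 \<le> d"
    have "dim (L d) = 0 \<longleftrightarrow> L d = {0}"
      using subspace_0[OF subspace_L, of d] by (auto simp: dim_eq_0)
    then show "0 < dim (lowest X H Y d) \<longleftrightarrow> L d \<noteq> {0}"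
      unfolding lowest_eq[OF d] by (simp only: neq0_conv[symmetric])
  qed
  obtain m :: nat where m: "onorm ((*v) H) + 1 < m" using reals_Archimedean2 by blast
  have "d < m" if d: "d \<ge> 1" "L d \<noteq> {0}" for d
  proof -
    obtain v where v: "v \<in> L d" "v \<noteq> 0" using d(2) subspace_0[OF subspace_L, of d] by auto
    have "norm (H *v v) \<le> onorm ((*v) H) * norm v"
      by (rule onorm) (rule matrix_vector_mul_bounded_linear)
    then have "\<bar>1 - real d\<bar> * norm v \<le> onorm ((*v) H) * norm v" using v by (simp add: L_def)
    then have "\<bar>1 - real d\<bar> \<le> onorm ((*v) H)" using v(2) by (rule mult_right_le_imp_le[OF _ zero_less_norm_iff[THEN iffD2]])
    then show ?thesis using m by linarith
  qed
  then have "{d. d \<ge> 1 \<and> L d \<noteq> {0}} \<subseteq> {..<m}" by blast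
  then have "finite {d. d \<ge> 1 \<and> L d \<noteq> {0}}"
    by (rule finite_subset) simp
  then show ?thesis unfolding mult_dims_def eq by (rule set_sorted_list_of_set)
qed

end

section \<open>Matrices with respect to an ordered basis\<close>

lemma bij_betw_idx: "bij_betw (idx :: 'n::{finite,linorder} \<Rightarrow> nat) UNIV {..<CARD('n)}"
proof -
  have less: "idx i < idx j" if "i < j" for i j :: 'n
    unfolding idx_def by (rule psubset_card_mono) (use that in auto)
  then have inj: "inj (idx :: 'n \<Rightarrow> nat)"
    by (intro injI) (metis less_irrefl linorder_neqE)
  have "idx i < CARD('n)" for i :: 'n
    unfolding idx_def by (rule psubset_card_mono) auto
  then have sub: "range (idx :: 'n \<Rightarrow> nat) \<subseteq> {..<CARD('n)}" by auto
  moreover have "card (range (idx :: 'n \<Rightarrow> nat)) = card {..<CARD('n)}"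
    using card_image[OF inj] by simp
  ultimately have "range (idx :: 'n \<Rightarrow> nat) = {..<CARD('n)}"
    by (intro card_subset_eq) auto
  with inj show ?thesis by (simp add: bij_betw_def)
qed

lemma idx_less: "idx (i :: 'n::{finite,linorder}) < CARD('n)"
  using bij_betw_apply[OF bij_betw_idx, of i] by simp

definition basis_matrix ::
    "(real^'n::{finite,linorder}) list \<Rightarrow> real^'n::{finite,linorder}^'n::{finite,linorder}" where
  "basis_matrix B = (\<chi> i j. (B ! idx j) $ i)"

lemma basis_matrix_mult_vec: "basis_matrix B *v c = (\<Sum>j\<in>UNIV. c $ j *\<^sub>R (B ! idx j))"
  by (simp add: vec_eq_iff matrix_vector_mult_def basis_matrix_def mult.commute)

lemma mult_basis_matrix: "(A ** basis_matrix B) $ i $ j = (A *v (B ! idx j)) $ i"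
  by (simp add: matrix_matrix_mult_def matrix_vector_mult_def basis_matrix_def)

lemma basis_matrix_mult: "(basis_matrix B ** G) $ i $ j = (\<Sum>k\<in>UNIV. G $ k $ j *\<^sub>R (B ! idx k)) $ i"
  by (simp add: matrix_matrix_mult_def basis_matrix_def mult.commute)

lemma mult_basis_matrix_eq_iff:
  "A ** basis_matrix B = basis_matrix B ** G
    \<longleftrightarrow> (\<forall>j. A *v (B ! idx j) = (\<Sum>k\<in>UNIV. G $ k $ j *\<^sub>R (B ! idx k)))"
proof -
  have "A ** basis_matrix B = basis_matrix B ** G
    \<longleftrightarrow> (\<forall>i j. (A ** basis_matrix B) $ i $ j = (basis_matrix B ** G) $ i $ j)"
    by (simp only: vec_eq_iff)
  also have "\<dots> \<longleftrightarrow> (\<forall>i j. (A *v (B ! idx j)) $ i = (\<Sum>k\<in>UNIV. G $ k $ j *\<^sub>R (B ! idx k)) $ i)"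
    by (simp only: mult_basis_matrix basis_matrix_mult)
  also have "\<dots> \<longleftrightarrow> (\<forall>j. A *v (B ! idx j) = (\<Sum>k\<in>UNIV. G $ k $ j *\<^sub>R (B ! idx k)))"
    by (simp only: vec_eq_iff) blast
  finally show ?thesis .
qed

context
  fixes B :: "(real^'n::{finite,linorder}) list"
  assumes B: "distinct B" "independent (set B)" "span (set B) = UNIV"
begin

lemma length_basis: "length B = CARD('n)"
  using B dim_span_eq_card_independent[OF B(2)] by (simp add: distinct_card)

lemma bij_betw_basis: "bij_betw (\<lambda>j. B ! idx j) (UNIV :: 'n set) (set B)"
proof -
  have "bij_betw idx (UNIV :: 'n set) {..<length B}"
    unfolding length_basis by (rule bij_betw_idx)
  from bij_betw_trans[OF this bij_betw_nth[OF B(1) refl refl]] show ?thesis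
    by (simp add: o_def)
qed

lemma det_basis_matrix: "det (basis_matrix B) \<noteq> 0"
proof -
  have "c = 0" if "basis_matrix B *v c = 0" for c
  proof -
    have inj: "inj (\<lambda>j :: 'n. B ! idx j)" and surj: "range (\<lambda>j :: 'n. B ! idx j) = set B"
      using bij_betw_basis by (simp_all add: bij_betw_def)
    define u where "u b = c $ (inv_into UNIV (\<lambda>j. B ! idx j) b)" for b
    have u: "u (B ! idx j) = c $ j" for j by (simp add: u_def inv_f_f[OF inj])
    have "(\<Sum>b\<in>set B. u b *\<^sub>R b) = (\<Sum>j\<in>(UNIV :: 'n set). u (B ! idx j) *\<^sub>R (B ! idx j))"
      unfolding surj[symmetric] by (simp only: sum.reindex[OF inj] o_def)
    also have "\<dots> = 0" using that by (simp add: u basis_matrix_mult_vec)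
    finally have sum: "(\<Sum>b\<in>set B. u b *\<^sub>R b) = 0" .
    have "u (B ! idx j) = 0" for j :: 'n
      by (rule independentD[OF B(2) _ order_refl sum]) (use bij_betw_apply[OF bij_betw_basis] in auto)
    then have "c $ j = 0" for j using u[of j] by simp
    then show ?thesis by (simp add: vec_eq_iff)
  qed
  then show ?thesis
    using matrix_left_invertible_ker[of "basis_matrix B"] by (metis invertible_det_nz invertible_left_inverse)
qed

lemma Lambda_eq: "Lambda B ((*v) k) = matrix_inv (basis_matrix B) ** k ** basis_matrix B"
proof -
  have "k ** basis_matrix B = basis_matrix B ** Lambda B ((*v) k)"
    unfolding mult_basis_matrix_eq_iff
  proof
    fix j :: 'n
    let ?u = "k *v (B ! idx j)"
    have "?u = (\<Sum>b\<in>set B. representation (set B) ?u b *\<^sub>R b)"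
      using B by (intro sum_representation_eq[symmetric]) auto
    also have "\<dots> = (\<Sum>i\<in>(UNIV :: 'n set). representation (set B) ?u (B ! idx i) *\<^sub>R (B ! idx i))"
      by (rule sum.reindex_bij_betw[OF bij_betw_basis, symmetric])
    finally show "?u = (\<Sum>i\<in>UNIV. Lambda B ((*v) k) $ i $ j *\<^sub>R (B ! idx i))"
      by (simp add: Lambda_def)
  qed
  then have "matrix_inv (basis_matrix B) ** (k ** basis_matrix B) = Lambda B ((*v) k)"
    using det_basis_matrix by simp
  then show ?thesis by (simp add: matrix_mul_assoc)
qed

end

lemma distinct_concat_map:
  assumes "distinct xs" "\<And>x. x \<in> set xs \<Longrightarrow> distinct (f x)"
    and "\<And>x y. x \<in> set xs \<Longrightarrow> y \<in> set xs \<Longrightarrow> x \<noteq> y \<Longrightarrow> set (f x) \<inter> set (f y) = {}"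
  shows "distinct (concat (map f xs))"
  using assms by (induction xs) (auto simp: disjoint_iff)

text \<open>One enumeration for both the adapted basis and the rows of the block diagonal matrices.
  Comparing \<open>total_basis\<close> and \<open>D_embed\<close> through it avoids computing
  offsets.\<close>

definition block_keys :: "nat list \<Rightarrow> (nat \<Rightarrow> nat) \<Rightarrow> (nat \<times> nat \<times> nat) list" where
  "block_keys ds t = concat (map (\<lambda>d. concat (map (\<lambda>l. map (\<lambda>a. (d, l, a)) [0..<t d]) [0..<d])) ds)"

lemma set_block_keys: "set (block_keys ds t) = {(d, l, a). d \<in> set ds \<and> l < d \<and> a < t d}"
  by (force simp: block_keys_def)

lemma distinct_block_keys: "distinct ds \<Longrightarrow> distinct (block_keys ds t)"
  unfolding block_keys_def
  by (intro distinct_concat_map) (auto simp: distinct_map inj_on_def)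

lemma total_basis_eq:
  "total_basis X H Y v = map (\<lambda>(d, l, a). (((*v) X) ^^ l) (v d ! a)) (block_keys (mult_dims X H Y) (\<lambda>d. length (v d)))"
proof -
  have "basis_layer X v d l = map (\<lambda>a. (((*v) X) ^^ l) (v d ! a)) [0..<length (v d)]" for d l
    unfolding basis_layer_def by (subst map_nth[of "v d", symmetric]) (simp only: map_map o_def)
  then have "basis_layer X v = (\<lambda>d l. map (\<lambda>a. (((*v) X) ^^ l) (v d ! a)) [0..<length (v d)])"
    by (intro ext)
  then show ?thesis
    by (simp add: total_basis_def block_keys_def map_concat o_def)
qed

text \<open>Transport along \<open>idx\<close> matches the permutations in the two Leibniz formulas
  and preserves signs.\<close>

lemma det_vec_lambda_idx:
  fixes M :: "real Matrix.mat"
  assumes M: "M \<in> carrier_mat CARD('n) CARD('n)"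
  shows "det (\<chi> i j. M $$ (idx i, idx j) :: real^'n::{finite,linorder}^'n::{finite,linorder}) = Determinant.det M"
proof -
  let ?n = "CARD('n)"
  let ?V = "UNIV :: 'n set"
  have img: "idx ` ?V = {0..<?n}" and inj: "inj_on idx ?V"
    using bij_betw_idx[where 'n='n] by (auto simp: bij_betw_def atLeast0LessThan)
  have "map_permutation ?V idx = (\<lambda>p x. if x \<in> {0..<?n} then idx (p (inv_into ?V idx x)) else x)"
    by (simp add: map_permutation_def restrict_id_def img fun_eq_iff)
  moreover have "bij_betw idx ?V {0..<?n}" using img inj by (simp add: bij_betw_def)
  ultimately have bij: "bij_betw (map_permutation ?V idx) {p. p permutes ?V} {p. p permutes {0..<?n}}"
    using bij_betw_permutations[of idx ?V "{0..<?n}"] by simp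
  have "Determinant.det M = (\<Sum>p\<in>{p. p permutes {0..<?n}}. signof p * (\<Prod>i = 0..<?n. M $$ (i, p i)))"
    using M by (simp add: Determinant.det_def)
  also have "\<dots> = (\<Sum>p\<in>{p. p permutes ?V}. signof (map_permutation ?V idx p)
      * (\<Prod>i = 0..<?n. M $$ (i, map_permutation ?V idx p i)))"
    by (rule sum.reindex_bij_betw[OF bij, symmetric])
  also have "\<dots> = (\<Sum>p\<in>{p. p permutes ?V}. of_int (sign p) * (\<Prod>i\<in>?V. M $$ (idx i, idx (p i))))"
  proof (intro sum.cong refl arg_cong2[where f = "(*)"])
    fix p assume "p \<in> {p. p permutes ?V}"
    then have p: "p permutes ?V" by simp
    show "signof (map_permutation ?V idx p) = (of_int (sign p) :: real)"
      using sign_map_permutation[OF inj p finite] by simp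
    have "map_permutation ?V idx p (idx i) = idx (p i)" for i
      using inj by (simp add: map_permutation_def inv_into_f_f)
    then show "(\<Prod>i = 0..<?n. M $$ (i, map_permutation ?V idx p i)) = (\<Prod>i\<in>?V. M $$ (idx i, idx (p i)))"
      unfolding img[symmetric] by (simp add: prod.reindex[OF inj])
  qed
  finally show ?thesis by (simp add: Determinants.det_def)
qed

section \<open>Block diagonal matrices\<close>

lemma prod_list_concat_replicate:
  "prod_list (concat (map (\<lambda>i. replicate (e i) (x i)) [0..<k])) = (\<Prod>i<k. x i ^ e i :: 'a::comm_monoid_mult)"
  by (induction k) (simp_all add: prod_list_replicate)

lemma det_diag_block_mat:
  fixes Ms :: "real Matrix.mat list"
  assumes "\<And>M. M \<in> set Ms \<Longrightarrow> square_mat M"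
  shows "Determinant.det (diag_block_mat Ms) = prod_list (map Determinant.det Ms)"
  using assms
proof (induction Ms)
  case Nil
  then show ?case by (simp add: Determinant.det_def)
next
  case (Cons A Ms)
  let ?B = "diag_block_mat Ms"
  have B: "dim_col ?B = dim_row ?B"
    unfolding dim_diag_block_mat by (rule arg_cong[of _ _ sum_list]) (use Cons.prems in auto)
  have "Determinant.det (diag_block_mat (A # Ms)) = Determinant.det A * Determinant.det ?B"
    unfolding diag_block_mat.simps Let_def
    by (rule det_four_block_mat_upper_right_zero[where n = "dim_row A" and m = "dim_row ?B"])
       (use Cons.prems[of A] B in auto)
  then show ?case using Cons by simp
qed

text \<open>Each row carries a tag: the label of its block and its place inside the block.
  Distinctness is asked of the labels, since equal blocks may be repeated.\<close>

lemma diag_block_mat_index: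
  assumes sq: "\<And>k. k \<in> set ks \<Longrightarrow> square_mat (M k)" and dist: "distinct ks"
  defines "pos \<equiv> concat (map (\<lambda>k. map (Pair k) [0..<dim_row (M k)]) ks)"
  shows "diag_block_mat (map M ks) \<in> carrier_mat (length pos) (length pos)"
    and "\<And>p q. p < length pos \<Longrightarrow> q < length pos \<Longrightarrow> diag_block_mat (map M ks) $$ (p, q) =
      (if fst (pos ! p) = fst (pos ! q) then M (fst (pos ! p)) $$ (snd (pos ! p), snd (pos ! q)) else 0)"
proof -
  let ?pos = "\<lambda>ks. concat (map (\<lambda>k. map (Pair k) [0..<dim_row (M k)]) ks)"
  have "diag_block_mat (map M ks) \<in> carrier_mat (length (?pos ks)) (length (?pos ks)) \<and>
    (\<forall>p q. p < length (?pos ks) \<longrightarrow> q < length (?pos ks) \<longrightarrow> diag_block_mat (map M ks) $$ (p, q) =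
      (if fst (?pos ks ! p) = fst (?pos ks ! q)
       then M (fst (?pos ks ! p)) $$ (snd (?pos ks ! p), snd (?pos ks ! q)) else 0))"
    using sq dist
  proof (induction ks)
    case (Cons k ks)
    let ?m = "dim_row (M k)" and ?B = "diag_block_mat (map M ks)" and ?l = "length (?pos ks)"
    have IH: "?B \<in> carrier_mat ?l ?l" "\<And>p q. p < ?l \<Longrightarrow> q < ?l \<Longrightarrow> ?B $$ (p, q) =
      (if fst (?pos ks ! p) = fst (?pos ks ! q)
       then M (fst (?pos ks ! p)) $$ (snd (?pos ks ! p), snd (?pos ks ! q)) else 0)"
      using Cons by auto
    have sqk: "dim_col (M k) = ?m" using Cons.prems(1)[of k] by auto
    have eq: "diag_block_mat (map M (k # ks)) = four_block_mat (M k) (0\<^sub>m ?m ?l) (0\<^sub>m ?l ?m) ?B"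
      using IH(1) sqk by (auto simp: Let_def)
    have carr: "diag_block_mat (map M (k # ks)) \<in> carrier_mat (?m + ?l) (?m + ?l)"
      unfolding eq using IH(1) sqk by auto
    have len: "length (?pos (k # ks)) = ?m + ?l" by simp
    have low: "?pos (k # ks) ! p = (k, p)" if "p < ?m" for p
      using that by (simp add: nth_append)
    have high: "?pos (k # ks) ! p = ?pos ks ! (p - ?m)" if "\<not> p < ?m" for p
      using that by (simp add: nth_append)
    have notin: "fst (?pos ks ! p) \<noteq> k" if "p < ?l" for p
    proof -
      have "?pos ks ! p \<in> set (?pos ks)" using that by (rule nth_mem)
      then show ?thesis using Cons.prems(2) by auto
    qed
    show ?case
    proof (intro conjI allI impI)
      show "diag_block_mat (map M (k # ks)) \<in> carrier_mat (length (?pos (k # ks))) (length (?pos (k # ks)))"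
        using carr unfolding len .
      fix p q assume pq: "p < length (?pos (k # ks))" "q < length (?pos (k # ks))"
      then have pq: "p < ?m + ?l" "q < ?m + ?l" by (simp_all only: len)
      have "diag_block_mat (map M (k # ks)) $$ (p, q) = (if p < ?m then if q < ?m then M k $$ (p, q) else 0
          else if q < ?m then 0 else ?B $$ (p - ?m, q - ?m))"
        unfolding eq using pq IH(1) sqk by auto
      also have "\<dots> = (if fst (?pos (k # ks) ! p) = fst (?pos (k # ks) ! q)
         then M (fst (?pos (k # ks) ! p)) $$ (snd (?pos (k # ks) ! p), snd (?pos (k # ks) ! q)) else 0)"
      proof (cases "p < ?m")
        case p: True
        show ?thesis
        proof (cases "q < ?m")
          case True
          then show ?thesis using p by (simp only: low if_True fst_conv snd_conv refl)
        next
          case False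
          then have "q - ?m < ?l" using pq by simp
          then have "k \<noteq> fst (?pos ks ! (q - ?m))" by (rule notin[THEN not_sym])
          then show ?thesis using p False by (simp only: low[OF p] high[OF False] if_True if_False fst_conv)
        qed
      next
        case p: False
        then have pl: "p - ?m < ?l" using pq by simp
        then have pn: "fst (?pos ks ! (p - ?m)) \<noteq> k" by (rule notin)
        show ?thesis
        proof (cases "q < ?m")
          case True
          then show ?thesis using p pn by (simp only: low[OF True] high[OF p] if_True if_False fst_conv)
        next
          case False
          then have "q - ?m < ?l" using pq by simp
          then show ?thesis using p False IH(2)[OF pl] by (simp only: high[OF p] high[OF False] if_False)
        qed
      qed
      finally show "diag_block_mat (map M (k # ks)) $$ (p, q) =
        (if fst (?pos (k # ks) ! p) = fst (?pos (k # ks) ! q)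
         then M (fst (?pos (k # ks) ! p)) $$ (snd (?pos (k # ks) ! p), snd (?pos (k # ks) ! q)) else 0)" .
    qed
  qed auto
  then show "diag_block_mat (map M ks) \<in> carrier_mat (length pos) (length pos)"
    and "\<And>p q. p < length pos \<Longrightarrow> q < length pos \<Longrightarrow> diag_block_mat (map M ks) $$ (p, q) =
      (if fst (pos ! p) = fst (pos ! q) then M (fst (pos ! p)) $$ (snd (pos ! p), snd (pos ! q)) else 0)"
    unfolding pos_def by auto
qed

lemma concat_concat: "concat (concat xss) = concat (map concat xss)"
  by (induction xss) auto

text \<open>Labelling the blocks by pairs \<open>(d, l)\<close> separates the \<open>d\<close>
  copies of one block, and listing the tags of all rows gives back \<open>block_keys\<close>. The
  family \<open>g\<close> is indexed by positions in the partition, \<open>G\<close> by the parts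
  themselves.\<close>

lemma
  fixes ds :: "nat list" and t :: "nat \<Rightarrow> nat" and G :: "nat \<Rightarrow> real Matrix.mat"
    and g :: "nat \<Rightarrow> real Matrix.mat" and i j :: "'n::{finite,linorder}"
  assumes ds: "distinct ds" and len: "length (block_keys ds t) = CARD('n)"
    and G: "\<And>d. d \<in> set ds \<Longrightarrow> G d \<in> carrier_mat (t d) (t d)"
    and g: "\<And>i. i < length ds \<Longrightarrow> g i = G (ds ! i)"
  defines "p \<equiv> map (\<lambda>d. (d, t d)) ds" and "K \<equiv> block_keys ds t"
  shows D_embed_index: "(D_embed p g :: real^'n::{finite,linorder}^'n::{finite,linorder}) $ i $ j =
      (if fst (K ! idx i) = fst (K ! idx j) \<and> fst (snd (K ! idx i)) = fst (snd (K ! idx j))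
       then G (fst (K ! idx i)) $$ (snd (snd (K ! idx i)), snd (snd (K ! idx j))) else 0)"
    and det_D_embed: "det (D_embed p g :: real^'n::{finite,linorder}^'n::{finite,linorder}) = chi_char p g"
proof -
  let ?blocks = "concat (map (\<lambda>i. replicate (fst (p ! i)) (g i)) [0..<length p])"
  define ks where "ks = concat (map (\<lambda>d. map (Pair d) [0..<d]) ds)"
  define pos where "pos = concat (map (\<lambda>k. map (Pair k) [0..<dim_row (G (fst k))]) ks)"
  have ks_set: "fst k \<in> set ds" if "k \<in> set ks" for k using that by (auto simp: ks_def)
  have "?blocks = concat (map (\<lambda>d. replicate d (G d)) ds)"
  proof -
    have "map (\<lambda>i. replicate (fst (p ! i)) (g i)) [0..<length p] = map (\<lambda>i. replicate (ds ! i) (G (ds ! i))) [0..<length ds]"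
      by (simp add: p_def g)
    also have "\<dots> = map (\<lambda>d. replicate d (G d)) ds"
      by (subst (3) map_nth[of ds, symmetric]) (simp only: map_map o_def)
    finally show ?thesis by simp
  qed
  also have "\<dots> = map (\<lambda>k. G (fst k)) ks"
    by (simp add: ks_def map_concat o_def map_replicate_const)
  finally have blocks: "?blocks = map (\<lambda>k. G (fst k)) ks" .
  have sq: "square_mat (G (fst k))" if "k \<in> set ks" for k
    using G[OF ks_set[OF that]] by auto
  have dist: "distinct ks"
    unfolding ks_def by (rule distinct_concat_map) (auto simp: ds distinct_map inj_on_def)
  have pos_eq: "pos = concat (map (\<lambda>k. map (Pair k) [0..<t (fst k)]) ks)"
  proof -
    have "dim_row (G (fst k)) = t (fst k)" if "k \<in> set ks" for k
      using G[OF ks_set[OF that]] by (rule carrier_matD(1))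
    then show ?thesis
      unfolding pos_def by (intro arg_cong[where f = concat] map_cong refl) simp
  qed
  have K_eq: "K = map (\<lambda>x. (fst (fst x), snd (fst x), snd x)) pos"
    by (simp add: K_def block_keys_def pos_eq ks_def map_concat concat_concat o_def)
  then have len_pos: "length pos = CARD('n)" using len by (simp add: K_def)
  have "diag_block_mat (map (\<lambda>k. G (fst k)) ks) \<in> carrier_mat (length pos) (length pos)"
    unfolding pos_def using sq dist by (rule diag_block_mat_index(1))
  then have carr: "diag_block_mat ?blocks \<in> carrier_mat CARD('n) CARD('n)"
    by (simp only: blocks len_pos)
  have entry: "diag_block_mat (map (\<lambda>k. G (fst k)) ks) $$ (q, r) =
      (if fst (pos ! q) = fst (pos ! r) then G (fst (fst (pos ! q))) $$ (snd (pos ! q), snd (pos ! r)) else 0)"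
    if "q < length pos" "r < length pos" for q r
    using sq dist that unfolding pos_def by (rule diag_block_mat_index(2))
  have emb: "D_embed p g = (\<chi> i j. diag_block_mat ?blocks $$ (idx i, idx j))"
    by (simp add: D_embed_def Let_def)
  have lt: "idx k < length pos" for k :: 'n by (simp add: len_pos idx_less)
  show "(D_embed p g :: real^'n::{finite,linorder}^'n::{finite,linorder}) $ i $ j =
      (if fst (K ! idx i) = fst (K ! idx j) \<and> fst (snd (K ! idx i)) = fst (snd (K ! idx j))
       then G (fst (K ! idx i)) $$ (snd (snd (K ! idx i)), snd (snd (K ! idx j))) else 0)"
    unfolding emb blocks using entry[OF lt[of i] lt[of j]] lt by (simp add: K_eq prod_eq_iff)
  have "det (D_embed p g :: real^'n::{finite,linorder}^'n::{finite,linorder}) = Determinant.det (diag_block_mat ?blocks)"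
    unfolding emb by (rule det_vec_lambda_idx[OF carr])
  also have "\<dots> = prod_list (map Determinant.det ?blocks)"
    by (rule det_diag_block_mat) (use sq in \<open>auto simp: blocks\<close>)
  also have "\<dots> = chi_char p g"
    unfolding map_concat map_map o_def map_replicate chi_char_def by (rule prod_list_concat_replicate)
  finally show "det (D_embed p g :: real^'n::{finite,linorder}^'n::{finite,linorder}) = chi_char p g" .
qed

section \<open>The triple in the adapted basis\<close>

locale sl2_basis = sl2 X H Y
  for X H Y :: "real^'n::{finite,linorder}^'n::{finite,linorder}" +
  fixes v :: "nat \<Rightarrow> (real^'n::{finite,linorder}) list"
  assumes bases: "lowest_bases X H Y v"
begin

definition ds where "ds = mult_dims X H Y"
definition t where "t d = length (v d)"
definition K where "K = block_keys ds t"
definition basis_vec where "basis_vec = (\<lambda>(d, l, a). px l (v d ! a))"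
definition B where "B = total_basis X H Y v"
definition P where "P = basis_matrix B"
definition key :: "'n::{finite,linorder} \<Rightarrow> nat \<times> nat \<times> nat" where "key i = K ! idx i"

lemma set_ds: "set ds = {d. d \<ge> 1 \<and> L d \<noteq> {0}}"
  by (simp only: ds_def set_mult_dims)

lemma distinct_ds: "distinct ds"
  by (simp add: ds_def mult_dims_def)

lemma basis_v:
  assumes d: "d \<in> set ds"
  shows "distinct (v d)" "independent (set (v d))" "span (set (v d)) = L d"
proof -
  have "d \<ge> 1" using d by (simp add: set_ds)
  have "ordered_basis_of (lowest X H Y d) (v d)"
    using bases d unfolding lowest_bases_def ds_def by blast
  then have "ordered_basis_of (L d) (v d)" by (simp only: lowest_eq[OF \<open>d \<ge> 1\<close>])
  then show "distinct (v d)" "independent (set (v d))" "span (set (v d)) = L d"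
    by (simp_all add: ordered_basis_of_def)
qed

lemma v_in_L: "d \<in> set ds \<Longrightarrow> a < t d \<Longrightarrow> v d ! a \<in> L d"
  unfolding basis_v(3)[symmetric] t_def by (intro span_base nth_mem)

lemma dim_lowest: "d \<in> set ds \<Longrightarrow> dim (lowest X H Y d) = t d"
  using basis_v[of d] dim_span_eq_card_independent[of "set (v d)"]
  by (simp add: lowest_eq set_ds t_def distinct_card)

lemma assoc_partition_eq: "assoc_partition X H Y = map (\<lambda>d. (d, t d)) ds"
  unfolding assoc_partition_def by (simp add: dim_lowest flip: ds_def)

lemma B_eq: "B = map basis_vec K"
proof -
  have "t = (\<lambda>d. length (v d))" by (simp add: t_def fun_eq_iff)
  then show ?thesis by (simp add: B_def total_basis_eq K_def basis_vec_def ds_def)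
qed

lemma set_K: "set K = (SIGMA d:set ds. {..<d} \<times> {..<t d})"
  by (auto simp: K_def set_block_keys)

text \<open>The terms of a relation with fixed \<open>d\<close> and \<open>l\<close> combine to
  \<open>X^l\<close> of a vector in \<open>L d\<close>; \<open>px_sum_zero\<close> kills each of
  these vectors, and then the basis \<open>v d\<close> of \<open>L d\<close> kills the
  coefficients.\<close>

lemma fam_independent: "inj_on basis_vec (set K)" "independent (basis_vec ` set K)"
proof -
  have zero: "c \<tau> = 0" if sum: "(\<Sum>\<tau>\<in>set K. c \<tau> *\<^sub>R basis_vec \<tau>) = 0" and \<tau>: "\<tau> \<in> set K" for c \<tau>
  proof -
    obtain d l a where dla: "\<tau> = (d, l, a)" "d \<in> set ds" "l < d" "a < t d"
      using \<tau> by (auto simp: set_K)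
    define w where "w d l = (\<Sum>a<t d. c (d, l, a) *\<^sub>R (v d ! a))" for d l
    have "(\<Sum>\<tau>\<in>set K. c \<tau> *\<^sub>R basis_vec \<tau>) = (\<Sum>d\<in>set ds. \<Sum>l<d. \<Sum>a<t d. c (d, l, a) *\<^sub>R basis_vec (d, l, a))"
      unfolding set_K by (simp add: sum.Sigma sum.cartesian_product split_def)
    also have "\<dots> = (\<Sum>d\<in>set ds. \<Sum>l<d. px l (w d l))"
      by (simp add: w_def px_sum px_scaleR basis_vec_def)
    finally have "(\<Sum>d\<in>set ds. \<Sum>l<d. px l (w d l)) = 0" using sum by simp
    moreover have "w d l \<in> L d" if "d \<in> set ds" for d l
      unfolding w_def using v_in_L[OF that] by (intro subspace_sum subspace_scale subspace_L) auto
    ultimately have w0: "w d l = 0"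
      using dla(2,3) by (intro px_sum_zero[of "set ds" w]) auto
    note vd = basis_v[OF dla(2)]
    have bij: "bij_betw ((!) (v d)) {..<t d} (set (v d))"
      unfolding t_def by (intro bij_betw_nth vd(1) refl)
    define u where "u b = c (d, l, inv_into {..<t d} ((!) (v d)) b)" for b
    have u: "u (v d ! a) = c (d, l, a)" if "a < t d" for a
      using bij_betw_inv_into_left[OF bij] that by (simp add: u_def)
    have "(\<Sum>b\<in>set (v d). u b *\<^sub>R b) = (\<Sum>a<t d. u (v d ! a) *\<^sub>R (v d ! a))"
      by (rule sum.reindex_bij_betw[OF bij, symmetric])
    also have "\<dots> = w d l" by (simp add: w_def u)
    finally have "(\<Sum>b\<in>set (v d). u b *\<^sub>R b) = 0" by (simp add: w0)
    then have "u (v d ! a) = 0"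
      by (rule independentD[OF vd(2) finite_set order_refl]) (use dla(4) in \<open>auto simp: t_def\<close>)
    then show ?thesis using u[OF dla(4)] dla(1) by simp
  qed
  show "inj_on basis_vec (set K)" "independent (basis_vec ` set K)"
    by (rule independent_family[OF finite_set], rule zero, assumption+)+
qed

lemma span_fam: "span (basis_vec ` set K) = UNIV"
proof -
  have "u \<in> span (basis_vec ` set K)" for u
  proof -
    have "{px l w | d l w. l < d \<and> w \<in> L d} \<subseteq> span (basis_vec ` set K)"
    proof clarify
      fix d l w assume l: "l < d" and w: "w \<in> L d"
      show "px l w \<in> span (basis_vec ` set K)"
      proof (cases "d \<in> set ds")
        case True
        have "px l ` set (v d) \<subseteq> basis_vec ` set K"
        proof clarify
          fix x assume "x \<in> set (v d)"
          then obtain a where "a < t d" "x = v d ! a" by (auto simp: in_set_conv_nth t_def)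
          then have "px l x = basis_vec (d, l, a)" "(d, l, a) \<in> set K"
            using True l by (simp_all add: basis_vec_def set_K)
          then show "px l x \<in> basis_vec ` set K" by blast
        qed
        then have "span (px l ` set (v d)) \<subseteq> span (basis_vec ` set K)" by (rule span_mono)
        moreover have "px l w \<in> px l ` span (set (v d))" using w basis_v(3)[OF True] by simp
        ultimately show ?thesis using linear_span_image[OF linear_px[of l], of "set (v d)"] by blast
      next
        case False
        then have "w = 0" using w l by (auto simp: set_ds)
        then show ?thesis by (simp add: px_0 span_zero)
      qed
    qed
    then have "span {px l w | d l w. l < d \<and> w \<in> L d} \<subseteq> span (basis_vec ` set K)"
      by (intro span_minimal) auto
    then show ?thesis using span_px[of u] by blast
  qed
  then show ?thesis by blast
qed

lemma distinct_K: "distinct K"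
  unfolding K_def by (rule distinct_block_keys[OF distinct_ds])

lemma length_K: "length K = CARD('n)"
  using dim_span_eq_card_independent[OF fam_independent(2)] card_image[OF fam_independent(1)]
  by (simp add: span_fam distinct_card[OF distinct_K])

lemma B_basis: "distinct B" "independent (set B)" "span (set B) = UNIV"
  using fam_independent span_fam distinct_K by (simp_all add: B_eq distinct_map)

lemma bij_key': "bij_betw key UNIV {(d, l, a). d \<in> set ds \<and> l < d \<and> a < t d}"
proof -
  have "bij_betw idx (UNIV :: 'n set) {..<length K}"
    unfolding length_K by (rule bij_betw_idx)
  from bij_betw_trans[OF this bij_betw_nth[OF distinct_K refl refl]]
  show ?thesis
    by (simp add: key_def[abs_def] o_def K_def set_block_keys)
qed

sublocale block_structure key "set ds" t
  by unfold_locales (rule bij_key')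

lemma det_P: "det P \<noteq> 0"
  unfolding P_def by (rule det_basis_matrix[OF B_basis])

lemma B_idx: "B ! idx i = px (kl i) (v (kd i) ! ka i)"
proof -
  have "idx i < length K" unfolding length_K by (rule idx_less)
  then have "B ! idx i = basis_vec (key i)" by (simp add: B_eq key_def)
  then show ?thesis by (simp add: basis_vec_def kl_def kd_def ka_def split_def)
qed

lemma v_key: "v (kd i) ! ka i \<in> L (kd i)"
  using v_in_L key_valid by blast

lemma X_P: "X ** P = P ** Nmat"
  unfolding P_def mult_basis_matrix_eq_iff
proof
  fix j
  show "X *v (B ! idx j) = (\<Sum>k\<in>UNIV. Nmat $ k $ j *\<^sub>R (B ! idx k))"
  proof (cases "Suc (kl j) < kd j")
    case True
    define p where "p = ix (kd j) (Suc (kl j)) (ka j)"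
    have p: "kd p = kd j" "kl p = Suc (kl j)" "ka p = ka j"
      using True key_valid[of j] by (simp_all add: p_def)
    have "(\<Sum>k\<in>UNIV. Nmat $ k $ j *\<^sub>R (B ! idx k)) = Nmat $ p $ j *\<^sub>R (B ! idx p)"
      by (rule sum_eq_single, rule key_eqI) (auto simp: Nmat_def brow_def p split: if_splits)
    also have "\<dots> = X *v (B ! idx j)"
      by (simp add: Nmat_def brow_def B_idx p)
    finally show ?thesis ..
  next
    case False
    then have top: "Suc (kl j) = kd j" using key_valid(2)[of j] by simp
    have "Nmat $ k $ j = 0" for k
      using top key_valid(2)[of k] by (auto simp: Nmat_def brow_def)
    moreover have "px (Suc (kl j)) (v (kd j) ! ka j) = 0"
      unfolding top using v_key[of j] key_valid(2)[of j] by (intro px_top) auto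
    ultimately show ?thesis by (simp add: B_idx)
  qed
qed

text \<open>\<open>1 - d + 2l\<close> is the weight of \<open>X^l v\<close> for \<open>v\<close> in
  \<open>L d\<close>. The \<open>brow\<close> form, shared by \<open>Nmat\<close> and
  \<open>Yd\<close>, makes \<open>levi_brow_commute\<close> applicable to the whole triple.\<close>

definition Hd where "Hd = brow (\<lambda>d l' l. if l' = l then 1 - real d + 2 * real l else 0)"

lemma Hd_entry: "Hd $ i $ j = (if i = j then 1 + real_of_int (wt i) else 0)"
  by (auto simp: Hd_def brow_def wt_def dest: key_eqI)

lemma H_P: "H ** P = P ** Hd"
  unfolding P_def mult_basis_matrix_eq_iff
proof
  fix j
  have "(\<Sum>k\<in>UNIV. Hd $ k $ j *\<^sub>R (B ! idx k)) = Hd $ j $ j *\<^sub>R (B ! idx j)"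
    by (rule sum_eq_single) (auto simp: Hd_entry split: if_splits)
  moreover have "H *v (v (kd j) ! ka j) = (1 - real (kd j)) *\<^sub>R (v (kd j) ! ka j)"
    using v_key[of j] by (simp add: L_def)
  ultimately show "H *v (B ! idx j) = (\<Sum>k\<in>UNIV. Hd $ k $ j *\<^sub>R (B ! idx k))"
    by (simp add: B_idx H_px px_scaleR Hd_entry wt_def scaleR_left_distrib[symmetric] del: of_int_mult)
qed

definition Yd where
  "Yd = brow (\<lambda>d l' l. if l = Suc l' then (real l' + 1) * (real d - 1 - real l') else 0)"

lemma Y_P: "Y ** P = P ** Yd"
  unfolding P_def mult_basis_matrix_eq_iff
proof
  fix j
  show "Y *v (B ! idx j) = (\<Sum>k\<in>UNIV. Yd $ k $ j *\<^sub>R (B ! idx k))"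
  proof (cases "kl j")
    case (Suc m)
    define p where "p = ix (kd j) m (ka j)"
    have p: "kd p = kd j" "kl p = m" "ka p = ka j"
      using Suc key_valid[of j] by (simp_all add: p_def)
    have "(\<Sum>k\<in>UNIV. Yd $ k $ j *\<^sub>R (B ! idx k)) = Yd $ p $ j *\<^sub>R (B ! idx p)"
      by (rule sum_eq_single, rule key_eqI) (auto simp: Yd_def brow_def p Suc split: if_splits)
    also have "\<dots> = Y *v (B ! idx j)"
      using Y_px_Suc[OF v_key[of j], of m] by (simp add: Yd_def brow_def B_idx p Suc del: funpow.simps)
    finally show ?thesis ..
  next
    case 0
    have "Yd $ k $ j = 0" for k by (auto simp: Yd_def brow_def 0)
    then show ?thesis using v_key[of j] by (simp add: B_idx 0 L_def)
  qed
qed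

section \<open>Passage to coordinates in the adapted basis\<close>

definition in_basis :: "real^'n::{finite,linorder}^'n::{finite,linorder} \<Rightarrow> real^'n::{finite,linorder}^'n::{finite,linorder}" where "in_basis z = matrix_inv P ** z ** P"
definition from_basis :: "real^'n::{finite,linorder}^'n::{finite,linorder} \<Rightarrow> real^'n::{finite,linorder}^'n::{finite,linorder}" where "from_basis c = P ** c ** matrix_inv P"

lemma in_basis_from_basis [simp]: "in_basis (from_basis c) = c" and from_basis_in_basis [simp]: "from_basis (in_basis z) = z"
  using det_P by (simp_all add: in_basis_def from_basis_def matrix_mul_assoc matrix_inv_left matrix_inv_right)

lemma in_basis_mul: "in_basis (y ** z) = in_basis y ** in_basis z"
  using det_P by (simp add: in_basis_def matrix_mul_assoc)

lemma from_basis_mul: "from_basis (y ** z) = from_basis y ** from_basis z"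
  using det_P by (simp add: from_basis_def matrix_mul_assoc)

lemma in_basis_1: "in_basis (mat 1) = mat 1" and from_basis_1: "from_basis (mat 1) = mat 1"
  using det_P by (simp_all add: in_basis_def from_basis_def matrix_inv_left matrix_inv_right)

lemma det_in_basis: "det (in_basis z) = det z" and det_from_basis: "det (from_basis z) = det z"
  using det_P by (simp_all add: in_basis_def from_basis_def det_mul det_matrix_inv)

lemma in_basis_eq_iff: "in_basis y = in_basis z \<longleftrightarrow> y = z"
  by (metis from_basis_in_basis)

lemma in_basis_inv: "det z \<noteq> 0 \<Longrightarrow> in_basis (matrix_inv z) = matrix_inv (in_basis z)"
  by (intro matrix_inv_unique[symmetric]) (simp add: in_basis_mul[symmetric] matrix_inv_right in_basis_1)

lemma in_basis_X: "in_basis X = Nmat" and in_basis_H: "in_basis H = Hd" and in_basis_Y: "in_basis Y = Yd"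
  using det_P by (simp_all add: in_basis_def X_P H_P Y_P matrix_mul_assoc[symmetric])

lemma Lambda_B: "Lambda (total_basis X H Y v) ((*v) k) = in_basis k"
  using Lambda_eq[OF B_basis] by (simp add: in_basis_def P_def B_def)

lemma continuous_on_in_basis: "continuous_on S in_basis" and continuous_on_from_basis: "continuous_on S from_basis"
  unfolding in_basis_def[abs_def] from_basis_def[abs_def]
  by (intro continuous_on_matmul continuous_on_const continuous_on_id)+

lemma Ad_eq_iff: "det z \<noteq> 0 \<Longrightarrow> Ad z A = A \<longleftrightarrow> z ** A = A ** z"
  unfolding Ad_def
  by (metis matrix_inv_cancel(3,4))

text \<open>Commuting with the diagonal \<open>Hd\<close> confines the nonzero entries to pairs of
  equal weight, so of the centralizer of \<open>Nmat\<close> only degree zero remains. Conversely,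
  the Levi algebra commutes with every \<open>brow\<close>.\<close>

lemma triple_centralizer_iff: "z \<in> triple_centralizer X H Y \<longleftrightarrow> in_basis z \<in> levi \<and> det z = 1"
proof -
  have comm: "z ** A = A ** z \<longleftrightarrow> in_basis z ** in_basis A = in_basis A ** in_basis z" for A
    by (simp add: in_basis_mul[symmetric] in_basis_eq_iff)
  have "z \<in> triple_centralizer X H Y \<longleftrightarrow> det z = 1 \<and> in_basis z ** Nmat = Nmat ** in_basis z
      \<and> in_basis z ** Hd = Hd ** in_basis z \<and> in_basis z ** Yd = Yd ** in_basis z"
    by (auto simp: triple_centralizer_def SL_def Ad_eq_iff comm in_basis_X in_basis_H in_basis_Y)
  also have "\<dots> \<longleftrightarrow> in_basis z \<in> levi \<and> det z = 1"
  proof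
    let ?c = "in_basis z"
    assume *: "det z = 1 \<and> ?c ** Nmat = Nmat ** ?c \<and> ?c ** Hd = Hd ** ?c \<and> ?c ** Yd = Yd ** ?c"
    have "wt i = wt j" if nz: "?c $ i $ j \<noteq> 0" for i j
    proof -
      have "(?c ** Hd) $ i $ j = ?c $ i $ j * Hd $ j $ j"
        unfolding matrix_matrix_mult_def by (simp, rule sum_eq_single) (auto simp: Hd_entry split: if_splits)
      moreover have "(Hd ** ?c) $ i $ j = Hd $ i $ i * ?c $ i $ j"
        unfolding matrix_matrix_mult_def by (simp, rule sum_eq_single) (auto simp: Hd_entry split: if_splits)
      ultimately show ?thesis using * nz by (simp add: Hd_entry)
    qed
    moreover have "?c \<in> centralizer Nmat" using * by (simp add: centralizer_def)
    ultimately have "?c \<in> levi"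
      unfolding levi_def using centralizer_homogeneous[of ?c] by blast
    then show "?c \<in> levi \<and> det z = 1" using * by simp
  next
    assume "in_basis z \<in> levi \<and> det z = 1"
    then show "det z = 1 \<and> in_basis z ** Nmat = Nmat ** in_basis z \<and> in_basis z ** Hd = Hd ** in_basis z \<and> in_basis z ** Yd = Yd ** in_basis z"
      by (simp add: levi_brow_commute Nmat_def Hd_def Yd_def)
  qed
  finally show ?thesis .
qed

end

section \<open>Maximal compact subgroups and the orbit\<close>

context block_structure
begin

lemma bcol_cong:
  assumes "\<And>d a b. d \<in> Ds \<Longrightarrow> a < t d \<Longrightarrow> b < t d \<Longrightarrow> A d a b = C d a b"
  shows "bcol A = bcol C"
proof -
  have "bcol A $ i $ j = bcol C $ i $ j" for i j
    using assms[of "kd i" "ka i" "ka j"] key_valid[of i] key_valid[of j] by (auto simp: bcol_def)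
  then show ?thesis by (intro vec_eq_iff[THEN iffD2] allI)
qed

lemma bcol_eqD:
  assumes eq: "bcol A = bcol C" and v: "d \<in> Ds" "0 < d" "a < t d" "b < t d"
  shows "A d a b = C d a b"
proof -
  have "bcol A $ ix d 0 a $ ix d 0 b = bcol C $ ix d 0 a $ ix d 0 b" by (simp only: eq)
  then show ?thesis using v by (simp add: bcol_def)
qed

lemma bcol_mat_1: "bcol (\<lambda>d a b. if a = b then 1 else 0) = mat 1"
proof -
  have "bcol (\<lambda>d a b. if a = b then 1 else 0) $ i $ j = (mat 1 :: real^'n^'n) $ i $ j" for i j
    using key_eqI[of i j] by (auto simp: bcol_def mat_def)
  then show ?thesis by (intro vec_eq_iff[THEN iffD2] allI)
qed

lemma bcol_mul: "bcol A ** bcol C = bcol (\<lambda>d a b. \<Sum>c<t d. A d a c * C d c b)"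
proof -
  have "(bcol A ** bcol C) $ i $ j = bcol (\<lambda>d a b. \<Sum>c<t d. A d a c * C d c b) $ i $ j" for i j
  proof (cases "kd i = kd j \<and> kl i = kl j")
    case True
    let ?S = "{k. kd k = kd i \<and> kl k = kl i}"
    have bij: "bij_betw ka ?S {..<t (kd i)}"
    proof (rule bij_betw_byWitness[where f' = "ix (kd i) (kl i)"])
      show "\<forall>k\<in>?S. ix (kd i) (kl i) (ka k) = k"
      proof
        fix k assume "k \<in> ?S"
        then show "ix (kd i) (kl i) (ka k) = k" using ix_key[of k] by simp
      qed
      show "ka ` ?S \<subseteq> {..<t (kd i)}"
      proof (rule image_subsetI)
        fix k assume "k \<in> ?S"
        then show "ka k \<in> {..<t (kd i)}" using key_valid(3)[of k] by simp
      qed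
    qed (use key_valid[of i] in auto)
    have "(bcol A ** bcol C) $ i $ j = (\<Sum>k\<in>UNIV. bcol A $ i $ k * bcol C $ k $ j)"
      by (simp add: matrix_matrix_mult_def)
    also have "\<dots> = (\<Sum>k\<in>?S. bcol A $ i $ k * bcol C $ k $ j)"
      by (rule sum.mono_neutral_right) (auto simp: bcol_def)
    also have "\<dots> = (\<Sum>k\<in>?S. A (kd i) (ka i) (ka k) * C (kd i) (ka k) (ka j))"
      using True by (intro sum.cong) (auto simp: bcol_def)
    also have "\<dots> = (\<Sum>c<t (kd i). A (kd i) (ka i) c * C (kd i) c (ka j))"
      by (rule sum.reindex_bij_betw[OF bij])
    finally show ?thesis using True by (simp add: bcol_def)
  next
    case False
    then have "(\<Sum>k\<in>UNIV. bcol A $ i $ k * bcol C $ k $ j) = 0"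
      by (intro sum.neutral) (auto simp: bcol_def)
    then have "(bcol A ** bcol C) $ i $ j = 0" by (simp add: matrix_matrix_mult_def)
    then show ?thesis using False by (simp add: bcol_def if_not_P)
  qed
  then show ?thesis by (intro vec_eq_iff[THEN iffD2] allI)
qed

lemma orthogonal_bcol_iff:
  assumes pos: "\<And>d. d \<in> Ds \<Longrightarrow> 0 < d"
  shows "orthogonal_matrix (bcol A) \<longleftrightarrow>
    (\<forall>d\<in>Ds. \<forall>a<t d. \<forall>b<t d. (\<Sum>c<t d. A d c a * A d c b) = (if a = b then 1 else 0))"
    (is "_ \<longleftrightarrow> ?R")
proof -
  have "orthogonal_matrix (bcol A) \<longleftrightarrow>
      bcol (\<lambda>d a b. \<Sum>c<t d. A d c a * A d c b) = bcol (\<lambda>d a b. if a = b then 1 else 0)"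
    by (simp add: orthogonal_matrix transpose_bcol bcol_mul bcol_mat_1)
  also have "\<dots> \<longleftrightarrow> ?R"
  proof
    assume eq: "bcol (\<lambda>d a b. \<Sum>c<t d. A d c a * A d c b) = bcol (\<lambda>d a b. if a = b then 1 else 0)"
    show ?R using bcol_eqD[OF eq] pos by blast
  qed (auto intro: bcol_cong)
  finally show ?thesis .
qed

end

lemma O_group_iff:
  "A \<in> O_group t \<longleftrightarrow> A \<in> carrier_mat t t \<and>
    (\<forall>a<t. \<forall>b<t. (\<Sum>c<t. A $$ (c, a) * A $$ (c, b)) = (if a = b then 1 else 0))"
proof -
  have "(transpose_mat A * A = 1\<^sub>m t) \<longleftrightarrow>
      (\<forall>a<t. \<forall>b<t. (\<Sum>c<t. A $$ (c, a) * A $$ (c, b)) = (if a = b then 1 else 0))"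
    if A: "A \<in> carrier_mat t t"
  proof -
    have "(transpose_mat A * A) $$ (a, b) = (\<Sum>c<t. A $$ (c, a) * A $$ (c, b))" if "a < t" "b < t" for a b
      using A that by (simp add: scalar_prod_def lessThan_atLeast0)
    moreover have "transpose_mat A * A \<in> carrier_mat t t" using A by simp
    ultimately show ?thesis by (auto simp: mat_eq_iff)
  qed
  then show ?thesis by (auto simp: O_group_def)
qed

context sl2_basis
begin

text \<open>The restriction makes the family extensional, as membership in the \<open>PiE\<close> of
  \<open>O_prod\<close> demands.\<close>

definition blocks_of :: "(nat \<Rightarrow> nat \<Rightarrow> nat \<Rightarrow> real) \<Rightarrow> nat \<Rightarrow> real Matrix.mat" where
  "blocks_of A = (\<lambda>i\<in>{..<length ds}. Matrix.mat (t (ds ! i)) (t (ds ! i)) (\<lambda>(a, b). A (ds ! i) a b))"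

lemma D_embed_bcol:
  assumes G: "\<And>d. d \<in> set ds \<Longrightarrow> G d \<in> carrier_mat (t d) (t d)"
    and g: "\<And>i. i < length ds \<Longrightarrow> g i = G (ds ! i)"
  shows "D_embed (assoc_partition X H Y) g = bcol (\<lambda>d a b. G d $$ (a, b))"
    and "det (D_embed (assoc_partition X H Y) g :: real^'n::{finite,linorder}^'n::{finite,linorder})
      = chi_char (assoc_partition X H Y) g"
proof -
  have len: "length (block_keys ds t) = CARD('n)" using length_K by (simp only: K_def)
  have "(D_embed (assoc_partition X H Y) g :: real^'n::{finite,linorder}^'n::{finite,linorder}) $ i $ j
      = bcol (\<lambda>d a b. G d $$ (a, b)) $ i $ j" for i j
  proof -
    have "(D_embed (assoc_partition X H Y) g :: real^'n::{finite,linorder}^'n::{finite,linorder}) $ i $ j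
      = (if fst (K ! idx i) = fst (K ! idx j) \<and> fst (snd (K ! idx i)) = fst (snd (K ! idx j))
       then G (fst (K ! idx i)) $$ (snd (snd (K ! idx i)), snd (snd (K ! idx j))) else 0)"
      unfolding assoc_partition_eq K_def using distinct_ds len G g by (rule D_embed_index)
    then show ?thesis by (simp add: bcol_def kd_def kl_def ka_def key_def)
  qed
  then show "D_embed (assoc_partition X H Y) g = bcol (\<lambda>d a b. G d $$ (a, b))"
    by (intro vec_eq_iff[THEN iffD2] allI)
  show "det (D_embed (assoc_partition X H Y) g :: real^'n::{finite,linorder}^'n::{finite,linorder})
      = chi_char (assoc_partition X H Y) g"
    unfolding assoc_partition_eq using distinct_ds len G g by (rule det_D_embed)
qed

lemma ds_pos: "d \<in> set ds \<Longrightarrow> 0 < d"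
  by (simp add: set_ds)

lemma orthogonal_bcol_ds_iff:
  "orthogonal_matrix (bcol A) \<longleftrightarrow>
    (\<forall>d\<in>set ds. \<forall>a<t d. \<forall>b<t d. (\<Sum>c<t d. A d c a * A d c b) = (if a = b then 1 else 0))"
  using ds_pos by (rule orthogonal_bcol_iff)

lemma D_embed_set_eq:
  "{D_embed (assoc_partition X H Y) g | g.
      g \<in> O_prod (assoc_partition X H Y) \<and> chi_char (assoc_partition X H Y) g = 1} = SO \<inter> levi"
  (is "?D = _")
proof
  let ?p = "assoc_partition X H Y"
  have p: "length ?p = length ds" "\<And>i. i < length ds \<Longrightarrow> snd (?p ! i) = t (ds ! i)"
    by (simp_all add: assoc_partition_eq)
  show "?D \<subseteq> SO \<inter> levi"
  proof clarify
    fix g assume g: "g \<in> O_prod ?p" and chi: "chi_char ?p g = 1"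
    define G where "G d = g (inv_into {..<length ds} ((!) ds) d)" for d
    have gG: "g i = G (ds ! i)" if "i < length ds" for i
      using that inv_into_f_f[OF inj_on_nth[OF distinct_ds, of "{..<length ds}"], of i] by (simp add: G_def)
    have GO: "G d \<in> O_group (t d)" if d: "d \<in> set ds" for d
    proof -
      obtain i where i: "i < length ds" "d = ds ! i" using d by (auto simp: in_set_conv_nth)
      have "g i \<in> O_group (snd (?p ! i))" using g i(1) p(1) unfolding O_prod_def by (auto simp: PiE_iff)
      then show ?thesis using gG[OF i(1)] p(2)[OF i(1)] i(2) by simp
    qed
    have carr: "\<And>d. d \<in> set ds \<Longrightarrow> G d \<in> carrier_mat (t d) (t d)"
      using GO by (simp add: O_group_iff)
    have eq: "D_embed ?p g = bcol (\<lambda>d a b. G d $$ (a, b))"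
      using carr gG by (rule D_embed_bcol(1))
    have det: "det (D_embed ?p g :: real^'n::{finite,linorder}^'n::{finite,linorder}) = chi_char ?p g"
      using carr gG by (rule D_embed_bcol(2))
    have "orthogonal_matrix (bcol (\<lambda>d a b. G d $$ (a, b)))"
      unfolding orthogonal_bcol_ds_iff using GO by (simp add: O_group_iff)
    then have "(D_embed ?p g :: real^'n::{finite,linorder}^'n::{finite,linorder}) \<in> SO"
      using det chi eq by (simp add: SO_def)
    moreover have "D_embed ?p g \<in> levi" unfolding eq levi_def by simp
    ultimately show "D_embed ?p g \<in> SO \<inter> levi" by simp
  qed
  show "SO \<inter> levi \<subseteq> ?D"
  proof
    fix k assume "k \<in> SO \<inter> levi"
    then obtain A where A: "k = bcol A" "orthogonal_matrix k" "det k = 1" by (auto simp: levi_def SO_def)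
    define G where "G d = Matrix.mat (t d) (t d) (\<lambda>(a, b). A d a b)" for d
    have carr: "\<And>d. d \<in> set ds \<Longrightarrow> G d \<in> carrier_mat (t d) (t d)" by (simp add: G_def)
    have gG: "\<And>i. i < length ds \<Longrightarrow> blocks_of A i = G (ds ! i)" by (simp add: blocks_of_def G_def)
    have eq: "D_embed ?p (blocks_of A) = bcol (\<lambda>d a b. G d $$ (a, b))"
      using carr gG by (rule D_embed_bcol(1))
    have det: "det (D_embed ?p (blocks_of A) :: real^'n::{finite,linorder}^'n::{finite,linorder}) = chi_char ?p (blocks_of A)"
      using carr gG by (rule D_embed_bcol(2))
    have k: "D_embed ?p (blocks_of A) = k"
      unfolding eq A(1) by (rule bcol_cong) (simp add: G_def)
    have orth: "\<forall>d\<in>set ds. \<forall>a<t d. \<forall>b<t d. (\<Sum>c<t d. A d c a * A d c b) = (if a = b then 1 else 0)"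
      using A(2) unfolding A(1) orthogonal_bcol_ds_iff .
    have GO: "G d \<in> O_group (t d)" if d: "d \<in> set ds" for d
      using orth d by (simp add: O_group_iff G_def)
    have "blocks_of A i \<in> O_group (snd (?p ! i))" if i: "i < length ds" for i
      unfolding gG[OF i] p(2)[OF i] by (rule GO[OF nth_mem[OF i]])
    then have "blocks_of A \<in> O_prod ?p"
      unfolding O_prod_def PiE_iff p(1) by (simp add: blocks_of_def)
    moreover have "chi_char ?p (blocks_of A) = 1" using det k A(3) by simp
    ultimately show "k \<in> ?D" using k by blast
  qed
qed

text \<open>Conjugation by \<open>P\<close> preserves determinants, whatever the sign of
  \<open>det P\<close>. In the other direction, a frame of positive determinant is rescaled by an
  \<open>n\<close>-th root to determinant 1, which keeps it a frame.\<close>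

lemma nilp_orbit_homeomorphic_conj_class:
  "top_of_set (nilp_orbit X) homeomorphic_space top_of_set (conj_class Nmat)"
proof -
  have to: "in_basis Z \<in> conj_class Nmat" if Z: "Z \<in> nilp_orbit X" for Z
  proof -
    obtain g where g: "det g = 1" "Z = Ad g X" using Z unfolding nilp_orbit_def SL_def by blast
    then have "Z ** g = g ** X" by (simp add: Ad_def)
    then have "in_basis Z ** in_basis g = in_basis g ** Nmat" by (simp add: in_basis_mul[symmetric] in_basis_X[symmetric])
    then have "in_basis g \<in> frames Nmat (in_basis Z)" by (simp add: frames_def)
    moreover have "det (in_basis g) > 0" using g(1) by (simp add: det_in_basis)
    ultimately show ?thesis unfolding conj_class_def by blast
  qed
  have bk: "from_basis W \<in> nilp_orbit X" if W: "W \<in> conj_class Nmat" for W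
  proof -
    obtain g where g: "W ** g = g ** Nmat" "det g > 0" using W unfolding conj_class_def frames_def by blast
    define h where "h = (1 / root CARD('n) (det g)) *\<^sub>R g"
    have h: "det h = 1" "W ** h = h ** Nmat"
      using g by (simp_all add: h_def det_scaleR power_divide matmul_distribs)
    have "in_basis (from_basis W ** from_basis h) = in_basis (from_basis h ** X)"
      using h(2) by (simp add: in_basis_mul in_basis_X)
    then have eq: "from_basis W ** from_basis h = from_basis h ** X" by (simp only: in_basis_eq_iff)
    have "from_basis W = Ad (from_basis h) X"
      using h(1) by (simp add: Ad_def eq[symmetric] det_from_basis)
    then show ?thesis using h(1) by (auto simp: nilp_orbit_def SL_def det_from_basis)
  qed
  have "homeomorphic_maps (top_of_set (nilp_orbit X)) (top_of_set (conj_class Nmat)) in_basis from_basis"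
    unfolding homeomorphic_maps_def using to bk
    by (auto simp: continuous_map_in_subtopology continuous_on_in_basis continuous_on_from_basis)
  then show ?thesis by (rule homeomorphic_maps_imp_homeomorphic_space)
qed

lemma nilp_orbit_homotopy_equivalent:
  "top_of_set (nilp_orbit X) homotopy_equivalent_space coset_space SO (SO \<inter> levi)"
  using homotopy_eqv_trans[OF homeomorphic_imp_homotopy_equivalent_space[OF nilp_orbit_homeomorphic_conj_class]
    conj_class_homotopy_equivalent_coset_space[OF graded_centralizer_axioms]]
  by (simp only: SO_centralizer_eq_levi)

section \<open>Conjugacy of maximal compact subgroups of the centralizer\<close>

lemma compact_SO_levi: "compact (SO \<inter> levi)"
  by (intro compact_Int_closed compact_SO closed_subspace subspace_levi)

lemma inv_matrix_group:
  assumes x: "x \<in> triple_centralizer X H Y"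
  shows "matrix_inv x \<in> triple_centralizer X H Y"
    "inv\<^bsub>matrix_group (triple_centralizer X H Y)\<^esub> x = matrix_inv x"
proof -
  have x': "in_basis x \<in> levi" "det x = 1" using x by (simp_all add: triple_centralizer_iff)
  then show mem: "matrix_inv x \<in> triple_centralizer X H Y"
    by (simp add: triple_centralizer_iff in_basis_inv levi_matrix_inv det_in_basis det_matrix_inv)
  show "inv\<^bsub>matrix_group (triple_centralizer X H Y)\<^esub> x = matrix_inv x"
    unfolding m_inv_def
  proof (rule the_equality)
    show "matrix_inv x \<in> carrier (matrix_group (triple_centralizer X H Y)) \<and>
      x \<otimes>\<^bsub>matrix_group (triple_centralizer X H Y)\<^esub> matrix_inv x = \<one>\<^bsub>matrix_group (triple_centralizer X H Y)\<^esub> \<and>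
      matrix_inv x \<otimes>\<^bsub>matrix_group (triple_centralizer X H Y)\<^esub> x = \<one>\<^bsub>matrix_group (triple_centralizer X H Y)\<^esub>"
      using mem x' by (simp add: matrix_group_def matrix_inv_left matrix_inv_right)
  qed (auto simp: matrix_group_def dest: matrix_inv_unique)
qed

lemma subgroup_matrix_groupI:
  assumes "S \<subseteq> triple_centralizer X H Y" "mat 1 \<in> S"
    "\<And>x y. x \<in> S \<Longrightarrow> y \<in> S \<Longrightarrow> x ** y \<in> S" "\<And>x. x \<in> S \<Longrightarrow> matrix_inv x \<in> S"
  shows "subgroup S (matrix_group (triple_centralizer X H Y))"
proof
  show "inv\<^bsub>matrix_group (triple_centralizer X H Y)\<^esub> x \<in> S" if "x \<in> S" for x
    using inv_matrix_group(2)[of x] assms(1,4) that by auto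
qed (use assms in \<open>auto simp: matrix_group_def\<close>)

text \<open>Conjugation inside the Levi algebra makes \<open>Q\<close> orthogonal, so
  \<open>Q\<close> lies in a conjugate of \<open>SO \<inter> levi\<close>. That conjugate is itself
  a compact subgroup of the centralizer, and maximality of \<open>Q\<close> turns the inclusion into
  equality.\<close>

lemma maximal_compact_conjugate:
  assumes max: "maximal_compact_subgroup (triple_centralizer X H Y) Q"
  obtains z where "z \<in> triple_centralizer X H Y" "in_basis ` (Ad z ` Q) = SO \<inter> levi"
proof -
  let ?G = "triple_centralizer X H Y"
  have sg: "subgroup Q (matrix_group ?G)" and comp: "compact Q"
    using max by (simp_all add: maximal_compact_subgroup_def)
  have QG: "Q \<subseteq> ?G" using subgroup.subset[OF sg] by (simp add: matrix_group_def)
  have Q1: "mat 1 \<in> Q" using subgroup.one_closed[OF sg] by (simp add: matrix_group_def)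
  have Qm: "x ** y \<in> Q" if "x \<in> Q" "y \<in> Q" for x y
    using subgroup.m_closed[OF sg that] by (simp add: matrix_group_def)
  define Q' where "Q' = in_basis ` Q"
  have Q'levi: "Q' \<subseteq> levi" and Q'det: "\<And>k. k \<in> Q' \<Longrightarrow> det k = 1"
    using QG by (auto simp: Q'_def triple_centralizer_iff det_in_basis)
  have Q'nz: "\<And>k. k \<in> Q' \<Longrightarrow> det k \<noteq> 0" using Q'det by fastforce
  have Q'c: "compact Q'" unfolding Q'_def by (intro compact_continuous_image continuous_on_in_basis comp)
  have Q'1: "mat 1 \<in> Q'" unfolding Q'_def using Q1 in_basis_1 by force
  have Q'm: "\<And>k l. k \<in> Q' \<Longrightarrow> l \<in> Q' \<Longrightarrow> k ** l \<in> Q'"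
    unfolding Q'_def using Qm by (auto simp: in_basis_mul[symmetric])
  obtain c where c: "c \<in> levi" "det c = 1"
    and orth: "\<And>k. k \<in> Q' \<Longrightarrow> orthogonal_matrix (matrix_inv c ** k ** c)"
    using conjugate_into_orthogonal[OF Q'c Q'1 Q'm Q'levi Q'nz subspace_levi levi_mat_1 levi_mul
        levi_transpose levi_matrix_inv] by blast
  have ci: "matrix_inv c \<in> levi" "det (matrix_inv c) = 1"
    using c by (simp_all add: levi_matrix_inv det_matrix_inv)
  have inS: "matrix_inv c ** k ** c \<in> SO \<inter> levi" if "k \<in> Q'" for k
    using that orth[OF that] Q'det[OF that] Q'levi c ci by (auto simp: SO_def det_mul intro!: levi_mul)
  define f where "f s = from_basis (c ** s ** matrix_inv c)" for s
  have f_mul: "f s ** f s' = f (s ** s')" for s s'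
  proof -
    have "c ** s ** matrix_inv c ** (c ** s' ** matrix_inv c) = c ** (s ** s') ** matrix_inv c"
      using c(2) by (simp add: matrix_mul_assoc)
    then show ?thesis by (simp add: f_def from_basis_mul[symmetric])
  qed
  have f_1: "f (mat 1) = mat 1" using c(2) by (simp add: f_def matrix_inv_right from_basis_1)
  have "subgroup (f ` (SO \<inter> levi)) (matrix_group ?G)"
  proof (rule subgroup_matrix_groupI)
    show "f ` (SO \<inter> levi) \<subseteq> ?G"
      using c ci by (auto simp: f_def triple_centralizer_iff det_from_basis det_mul SO_def intro!: levi_mul)
    show "mat 1 \<in> f ` (SO \<inter> levi)"
      using f_1 levi_mat_1 by (force simp: SO_def orthogonal_matrix_id)
    show "x ** y \<in> f ` (SO \<inter> levi)" if "x \<in> f ` (SO \<inter> levi)" "y \<in> f ` (SO \<inter> levi)" for x y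
      using that by (auto simp: f_mul intro!: imageI SO_mul levi_mul)
    show "matrix_inv x \<in> f ` (SO \<inter> levi)" if x: "x \<in> f ` (SO \<inter> levi)" for x
    proof -
      obtain s where s: "s \<in> SO" "s \<in> levi" "x = f s" using x by auto
      have "f s ** f (transpose s) = mat 1" using s(1) f_1 by (simp add: f_mul SO_iff)
      then have "matrix_inv x = f (transpose s)" unfolding s(3) by (rule matrix_inv_unique)
      then show ?thesis using s by (auto intro: SO_transpose levi_transpose)
    qed
  qed
  moreover have "compact (f ` (SO \<inter> levi))"
  proof (intro compact_continuous_image compact_SO_levi)
    have "continuous_on (SO \<inter> levi) (\<lambda>s. c ** s ** matrix_inv c)"
      by (intro continuous_on_matmul continuous_on_const continuous_on_id)
    then show "continuous_on (SO \<inter> levi) f"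
      unfolding f_def by (rule continuous_on_compose2[OF continuous_on_from_basis]) auto
  qed
  moreover have "Q \<subseteq> f ` (SO \<inter> levi)"
  proof
    fix k assume k: "k \<in> Q"
    have "f (matrix_inv c ** in_basis k ** c) = k"
      using c(2) by (simp add: f_def matrix_mul_assoc matrix_inv_right)
    moreover have "matrix_inv c ** in_basis k ** c \<in> SO \<inter> levi" by (rule inS) (simp add: Q'_def k)
    ultimately show "k \<in> f ` (SO \<inter> levi)" by (metis imageI)
  qed
  ultimately have Q: "f ` (SO \<inter> levi) = Q"
    using max unfolding maximal_compact_subgroup_def by blast
  define z where "z = from_basis (matrix_inv c)"
  have zG: "z \<in> ?G" using ci by (simp add: z_def triple_centralizer_iff det_from_basis)
  have "in_basis (Ad z (f s)) = s" for s
  proof -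
    have dz: "det z \<noteq> 0" using ci by (simp add: z_def det_from_basis)
    have "in_basis (Ad z (f s)) = in_basis z ** in_basis (f s) ** matrix_inv (in_basis z)"
      using dz by (simp add: Ad_def in_basis_mul in_basis_inv)
    also have "\<dots> = matrix_inv c ** (c ** s ** matrix_inv c) ** c"
      using c(2) by (simp add: z_def f_def matrix_inv_matrix_inv)
    also have "\<dots> = s"
      using c(2) by (simp add: matrix_mul_assoc matrix_inv_left)
    finally show ?thesis .
  qed
  then have "in_basis ` (Ad z ` Q) = SO \<inter> levi"
    unfolding Q[symmetric] by (simp add: image_image)
  with zG show thesis by (rule that)
qed

section \<open>The action of the centralizer on adapted bases\<close>

lemma triple_centralizer_commute:
  assumes z: "z \<in> triple_centralizer X H Y"
  shows "z ** X = X ** z" "z ** H = H ** z" "z ** Y = Y ** z"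
  using z Ad_eq_iff[of z] by (auto simp: triple_centralizer_def SL_def)

lemma triple_centralizer_L:
  assumes z: "z \<in> triple_centralizer X H Y" and u: "u \<in> L d"
  shows "z *v u \<in> L d"
  using u by (simp add: L_def matrix_vector_mul_assoc triple_centralizer_commute[OF z, symmetric])
    (simp add: matrix_vector_mul_assoc[symmetric] matrix_vector_mult_scaleR)

lemma triple_centralizer_image_L:
  assumes z: "z \<in> triple_centralizer X H Y"
  shows "(*v) z ` L d = L d"
proof
  show "(*v) z ` L d \<subseteq> L d" using triple_centralizer_L[OF z] by blast
  show "L d \<subseteq> (*v) z ` L d"
  proof
    fix u assume u: "u \<in> L d"
    have "det z \<noteq> 0" using z by (simp add: triple_centralizer_iff)
    then have "u = z *v (matrix_inv z *v u)" by (simp add: matrix_vector_mul_assoc matrix_inv_right)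
    moreover have "matrix_inv z *v u \<in> L d"
      by (rule triple_centralizer_L[OF inv_matrix_group(1)[OF z] u])
    ultimately show "u \<in> (*v) z ` L d" by blast
  qed
qed

text \<open>An element of the centralizer preserves every \<open>L d\<close>, so it carries
  admissible bases to admissible bases. This is the freedom by which the basis is adapted to a given
  compact group.\<close>

lemma lowest_bases_map:
  assumes z: "z \<in> triple_centralizer X H Y"
  shows "lowest_bases X H Y (\<lambda>d. map ((*v) z) (v d))"
  unfolding lowest_bases_def
proof
  fix d assume "d \<in> set (mult_dims X H Y)"
  then have d: "d \<in> set ds" by (simp add: ds_def)
  then have d1: "d \<ge> 1" by (simp add: set_ds)
  have "det z \<noteq> 0" using z by (simp add: triple_centralizer_iff)
  then have inj: "inj ((*v) z)"
    by (intro inj_on_inverseI[of _ "(*v) (matrix_inv z)"]) (simp add: matrix_vector_mul_assoc matrix_inv_left)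
  note vd = basis_v[OF d]
  have "independent ((*v) z ` set (v d))"
    by (rule linear_independent_injective_image[OF matrix_vector_mul_linear vd(2)])
       (rule inj_on_subset[OF inj subset_UNIV])
  moreover have "span ((*v) z ` set (v d)) = L d"
    using linear_span_image[OF matrix_vector_mul_linear, of z "set (v d)"]
    by (simp add: vd(3) triple_centralizer_image_L[OF z])
  moreover have "distinct (map ((*v) z) (v d))"
    using vd(1) by (simp add: distinct_map inj_on_subset[OF inj])
  ultimately show "ordered_basis_of (lowest X H Y d) (map ((*v) z) (v d))"
    unfolding lowest_eq[OF d1] ordered_basis_of_def by simp
qed

lemma total_basis_map:
  assumes z: "z \<in> triple_centralizer X H Y"
  shows "total_basis X H Y (\<lambda>d. map ((*v) z) (v d)) = map ((*v) z) (total_basis X H Y v)"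
proof -
  have "px l (z *v u) = z *v px l u" for l u
    by (induction l) (simp_all add: matrix_vector_mul_assoc triple_centralizer_commute(1)[OF z])
  then show ?thesis
    unfolding total_basis_eq by (auto simp: set_block_keys)
qed

text \<open>The moved basis has basis matrix \<open>z^-1 P\<close>, so \<open>k\<close> gets the
  matrix \<open>P^-1 z k z^-1 P\<close>: moving the basis by \<open>z^-1\<close> has the same effect
  as conjugating \<open>k\<close> by \<open>z\<close>.\<close>

lemma Lambda_map:
  assumes z: "z \<in> triple_centralizer X H Y"
  shows "Lambda (total_basis X H Y (\<lambda>d. map ((*v) (matrix_inv z)) (v d))) ((*v) k) = in_basis (Ad z k)"
proof -
  let ?q = "matrix_inv z" and ?w = "\<lambda>d. map ((*v) (matrix_inv z)) (v d)"
  note q = inv_matrix_group(1)[OF z]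
  interpret W: sl2_basis X H Y ?w
    by unfold_locales (rule lowest_bases_map[OF q])
  have dz: "det z \<noteq> 0" using z by (simp add: triple_centralizer_iff)
  have "idx i < length B" for i :: 'n
    using length_basis[OF B_basis] idx_less by simp
  then have P: "W.P = ?q ** P"
    by (simp add: W.P_def P_def W.B_def total_basis_map[OF q] B_def[symmetric] vec_eq_iff mult_basis_matrix)
      (simp add: basis_matrix_def)
  have "W.in_basis k = matrix_inv P ** z ** k ** (?q ** P)"
    using dz det_P by (simp add: W.in_basis_def P matrix_inv_mul det_matrix_inv matrix_inv_matrix_inv)
  then show ?thesis
    unfolding W.Lambda_B by (simp add: in_basis_def Ad_def matrix_mul_assoc)
qed

end

text \<open>The matrices \<open>D(g)\<close> are orthogonal for the inner product in which the
  adapted basis is orthonormal, whereas \<open>K\<close> and the bases of the lowest weight spaces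
  are given independently of each other. They have to be matched by an element of the centralizer of
  the triple, which can be spent in two ways: on conjugating \<open>K\<close> with the bases kept,
  or on moving the bases with \<open>K\<close> kept.\<close>

theorem theorem3p4:
  fixes X H Y :: "real^'n::{finite,linorder}^'n::{finite,linorder}"
    and K :: "(real^'n::{finite,linorder}^'n::{finite,linorder}) set"
    and v :: "nat \<Rightarrow> (real^'n::{finite,linorder}) list"
  assumes "X \<in> sl" and "nilpotent_matrix X" and "X \<noteq> 0"
    and "sl2_triple X H Y"
    and "maximal_compact_subgroup (triple_centralizer X H Y) K"
    and "lowest_bases X H Y v"
  shows
    "(\<exists>z \<in> triple_centralizer X H Y.
        (\<lambda>k. Lambda (total_basis X H Y v) ((*v) k)) ` (Ad z ` K)
          = {D_embed (assoc_partition X H Y) g | g.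
               g \<in> O_prod (assoc_partition X H Y) \<and> chi_char (assoc_partition X H Y) g = 1} \<and>
        top_of_set (nilp_orbit X) homotopy_equivalent_space
          coset_space SO ((\<lambda>k. Lambda (total_basis X H Y v) ((*v) k)) ` (Ad z ` K)))
     \<and>
     (\<exists>w. lowest_bases X H Y w \<and>
        (\<lambda>k. Lambda (total_basis X H Y w) ((*v) k)) ` K
          = {D_embed (assoc_partition X H Y) g | g.
               g \<in> O_prod (assoc_partition X H Y) \<and> chi_char (assoc_partition X H Y) g = 1} \<and>
        top_of_set (nilp_orbit X) homotopy_equivalent_space
          coset_space SO ((\<lambda>k. Lambda (total_basis X H Y w) ((*v) k)) ` K))"
proof -
  interpret sl2_basis X H Y v
    by unfold_locales (rule assms)+
  obtain z where z: "z \<in> triple_centralizer X H Y" "in_basis ` (Ad z ` K) = SO \<inter> levi"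
    by (rule maximal_compact_conjugate[OF assms(5)])
  let ?w = "\<lambda>d. map ((*v) (matrix_inv z)) (v d)"
  have 1: "(\<lambda>k. Lambda (total_basis X H Y v) ((*v) k)) ` (Ad z ` K) = SO \<inter> levi"
    unfolding Lambda_B z(2) ..
  have 2: "(\<lambda>k. Lambda (total_basis X H Y ?w) ((*v) k)) ` K = SO \<inter> levi"
    unfolding Lambda_map[OF z(1)] using z(2) by (simp add: image_image)
  show ?thesis
    unfolding D_embed_set_eq
  proof (intro conjI bexI[of _ z] exI[of _ ?w] z(1) lowest_bases_map inv_matrix_group(1))
  qed (simp_all only: 1 2 nilp_orbit_homotopy_equivalent)
qed

end
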